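(* For $X\sim N(\theta^*,\sigma^2I_n)$ and every $k\in[n]$, $$\inf_{\widehat{\theta}}\sup_{\theta^*\in\Theta_{k}^{\wedge}}\mathbb{E}\|\widehat{\theta}-\theta^*\|^2\asymp\begin{cases} \sigma^2, & k=1, \\ \sigma^2\log\log(16n), & k=2, \\ \sigma^2\log(en), & 3\leq k\leq \frac{\log(en)}{\log\log(16n)}, \\ \sigma^2k\log\log(16n/k), & k>\frac{\log(en)}{\log\log(16n)}, \end{cases}$$ where $\asymp$ means two-sided bounds up to universal positive constant factors and the infimum is over all measurable functions of $X$.
   Context: $[n]=\{1,\dots,n\}$. For reals $a\le b$, $(a:b]$ is the set of integers $i$ with $a<i\le b$. For $k\in[n]$, $\Theta_k^{\wedge}$ is the set of $\theta\in\mathbb{R}^n$ for which there exist integers $0=a_0\le a_1\le\cdots\le a_k=n$, an index $\ell\in[k]$ and reals $\mu_1,\dots,\mu_k$ with $\mu_1\le\cdots\le\mu_{\ell-1}\le\mu_\ell\ge\mu_{\ell+1}\ge\cdots\ge\mu_k$ and $\theta_i=\mu_j$ for all $i\in(a_{j-1}:a_j]$ (unimodal vectors with at most $k$ constant pieces). *)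

theory Defs
  imports "HOL-Probability.Probability"
begin

text \<open>Vectors in R^n are functions nat => real, extensional on the index set [n] = {1..n}.\<close>

definition unimodal_pieces :: "nat \<Rightarrow> nat \<Rightarrow> (nat \<Rightarrow> real) set" where
  "unimodal_pieces n k = {\<theta> \<in> extensional {1..n}.
     \<exists>(a::nat \<Rightarrow> nat) (l::nat) (\<mu>::nat \<Rightarrow> real).
       a 0 = 0 \<and> a k = n \<and> (\<forall>j<k. a j \<le> a (Suc j)) \<and>
       1 \<le> l \<and> l \<le> k \<and>
       (\<forall>j. 1 \<le> j \<and> j < l \<longrightarrow> \<mu> j \<le> \<mu> (Suc j)) \<and>
       (\<forall>j. l \<le> j \<and> j < k \<longrightarrow> \<mu> j \<ge> \<mu> (Suc j)) \<and>
       (\<forall>j\<in>{1..k}. \<forall>i. a (j - 1) < i \<and> i \<le> a j \<longrightarrow> \<theta> i = \<mu> j)}"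

definition gauss_model :: "nat \<Rightarrow> real \<Rightarrow> (nat \<Rightarrow> real) \<Rightarrow> (nat \<Rightarrow> real) measure" where
  "gauss_model n \<sigma> \<theta> = PiM {1..n} (\<lambda>i. density lborel (normal_density (\<theta> i) \<sigma>))"

definition estimators :: "nat \<Rightarrow> ((nat \<Rightarrow> real) \<Rightarrow> (nat \<Rightarrow> real)) set" where
  "estimators n = measurable (PiM {1..n} (\<lambda>_. borel)) (PiM {1..n} (\<lambda>_. borel))"

definition sq_risk :: "nat \<Rightarrow> real \<Rightarrow> ((nat \<Rightarrow> real) \<Rightarrow> (nat \<Rightarrow> real)) \<Rightarrow> (nat \<Rightarrow> real) \<Rightarrow> ennreal" where
  "sq_risk n \<sigma> T \<theta> = (\<integral>\<^sup>+ x. ennreal (\<Sum>i\<in>{1..n}. (T x i - \<theta> i)\<^sup>2) \<partial>gauss_model n \<sigma> \<theta>)"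

definition unimodal_rate :: "nat \<Rightarrow> nat \<Rightarrow> real" where
  "unimodal_rate n k =
     (if k = 1 then 1
      else if k = 2 then ln (ln (16 * real n))
      else if real k \<le> ln (exp 1 * real n) / ln (ln (16 * real n)) then ln (exp 1 * real n)
      else real k * ln (ln (16 * real n / real k)))"

end

theory Submission
  imports Defs
begin

text \<open>
  Upper bound. The estimator is an approximate least squares fit over a countable dense subset of the
  class, so with \<open>V\<close> the difference of fit and truth it suffices to bound
  \<open>\<langle>Z, V\<rangle>\<^sup>2 / \<parallel>V\<parallel>\<^sup>2\<close>, where \<open>Z\<close> is the standardised noise. Cut
  \<open>{1..n}\<close> at the jumps of the truth and at the multiples of \<open>n div k + 1\<close>. On each resulting interval the truth
  is constant, so \<open>V\<close> is monotone there, except on the one interval that contains the mode of the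
  fit. The positive and negative parts of a monotone vector decrease away from an end point of the interval; for such a
  nonnegative \<open>u\<close> with increments \<open>D\<^sub>r\<close> one has \<open>\<Sum> r D\<^sub>r\<^sup>2 \<le> \<parallel>u\<parallel>\<^sup>2\<close>, so summation by parts gives
  \<open>\<langle>Z, u\<rangle>\<^sup>2 \<le> m L \<parallel>u\<parallel>\<^sup>2\<close>, with \<open>m\<close> the number of pieces and
  \<open>L = max S\<^sub>r\<^sup>2 / r\<close>, which is of iterated logarithmic order. Near the mode of the fit the end
  point is random, but there
  \<open>\<langle>Z, u\<rangle>\<^sup>2 / \<parallel>u\<parallel>\<^sup>2\<close> is at most a sum of \<open>log n\<close> independent dyadic
  maxima with exponential moments, so a union bound over all modes costs only \<open>log n\<close>.

  Lower bound. A second moment change of measure bounds the average risk over \<open>M\<close> separated hypotheses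
  within squared distance \<open>\<sigma>\<^sup>2 / 2 * ln M\<close> of a common centre. It is applied to single spikes, which gives
  \<open>log n\<close>, and to increasing staircases with \<open>k div 2\<close> blocks, each carrying a bump on its last
  \<open>2 ^ i\<close> coordinates with \<open>i\<close> independent across blocks, which gives \<open>k log log (n / k)\<close>.
\<close>

section \<open>Testing lower bound in the Gaussian model\<close>

text \<open>The obstacle in the upper bound is that the fit depends on the noise: neither its mode
  nor the number of its jumps in one interval may multiply a random quantity before expectations are
  taken. So \<open>L\<close> is split into a deterministic level \<open>s\<close> of order log log
  and a random excess. The level is multiplied by jump counts, whose total over all intervals is
  linear in \<open>k\<close>. The excess is multiplied instead by one plus the log of the interval
  length, from a second bound on the same inner product that ignores jumps, and \<open>s\<close> is
  large enough for this product to have bounded mean on each interval. The cuts at the multiples of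
  \<open>n div k + 1\<close> keep lengths of order \<open>n / k\<close> at the cost of about
  \<open>k\<close> more intervals, which turns log log n into log log (n / k). The mode of the fit
  matters only strictly inside \<open>{1..n}\<close>: with at most two pieces a unimodal vector is
  monotone, while three pieces admit a spike anywhere. This is why log n enters between
  \<open>k = 2\<close> and \<open>k = 3\<close>. From there on the threshold in the rate selects, up
  to constants, the larger of log n and k log log (n / k).\<close>

lemma PiM_density:
  fixes f :: "'i \<Rightarrow> 'a \<Rightarrow> ennreal"
  assumes I: "finite I" and M: "product_sigma_finite M" "product_sigma_finite (\<lambda>i. density (M i) (f i))"
    and f: "\<And>i. f i \<in> borel_measurable (M i)"
  shows "PiM I (\<lambda>i. density (M i) (f i)) = density (PiM I M) (\<lambda>x. \<Prod>i\<in>I. f i (x i))"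
proof -
  interpret M: product_sigma_finite M by fact
  interpret D: product_sigma_finite "\<lambda>i. density (M i) (f i)" by fact
  note f [measurable]
  have sets: "sets (PiM I (\<lambda>i. density (M i) (f i))) = sets (PiM I M)" by (intro sets_PiM_cong) auto
  have fm: "(\<lambda>x. \<Prod>i\<in>I. f i (x i)) \<in> borel_measurable (PiM I M)" by measurable
  have "density (PiM I M) (\<lambda>x. \<Prod>i\<in>I. f i (x i)) = PiM I (\<lambda>i. density (M i) (f i))"
  proof (rule D.PiM_eqI [OF I])
    show "sets (density (PiM I M) (\<lambda>x. \<Prod>i\<in>I. f i (x i))) = sets (PiM I (\<lambda>i. density (M i) (f i)))"
      using sets by simp
    fix A assume A: "\<And>i. i \<in> I \<Longrightarrow> A i \<in> sets (density (M i) (f i))"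
    then have A': "\<And>i. i \<in> I \<Longrightarrow> A i \<in> sets (M i)" by simp
    have "Pi\<^sub>E I A \<in> sets (PiM I M)" using A' I by (intro sets_PiM_I_finite) auto
    then have "emeasure (density (PiM I M) (\<lambda>x. \<Prod>i\<in>I. f i (x i))) (Pi\<^sub>E I A)
        = (\<integral>\<^sup>+ x. (\<Prod>i\<in>I. f i (x i)) * indicator (Pi\<^sub>E I A) x \<partial>PiM I M)"
      by (rule emeasure_density [OF fm])
    also have "\<dots> = (\<integral>\<^sup>+ x. (\<Prod>i\<in>I. f i (x i) * indicator (A i) (x i)) \<partial>PiM I M)"
    proof (rule nn_integral_cong)
      fix x assume "x \<in> space (PiM I M)"
      then have "indicator (Pi\<^sub>E I A) x = (\<Prod>i\<in>I. indicator (A i) (x i) :: ennreal)"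
        using I by (auto simp: indicator_def space_PiM PiE_iff prod_zero_iff)
      then show "(\<Prod>i\<in>I. f i (x i)) * indicator (Pi\<^sub>E I A) x = (\<Prod>i\<in>I. f i (x i) * indicator (A i) (x i))"
        by (simp add: prod.distrib)
    qed
    also have "\<dots> = (\<Prod>i\<in>I. \<integral>\<^sup>+ x. f i x * indicator (A i) x \<partial>M i)"
      by (rule M.product_nn_integral_prod [OF I]) (use A' f in measurable)
    also have "\<dots> = (\<Prod>i\<in>I. emeasure (density (M i) (f i)) (A i))"
      by (intro prod.cong refl) (simp add: emeasure_density f A')
    finally show "emeasure (density (PiM I M) (\<lambda>x. \<Prod>i\<in>I. f i (x i))) (Pi\<^sub>E I A) = (\<Prod>i\<in>I. emeasure (density (M i) (f i)) (A i))" .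
  qed
  then show ?thesis ..
qed

lemma ennreal_mult_add:
  "0 \<le> a \<Longrightarrow> 0 \<le> b \<Longrightarrow> 0 \<le> c \<Longrightarrow> 0 \<le> d \<Longrightarrow> ennreal (a * b + c * d) = ennreal a * ennreal b + ennreal c * ennreal d"
  by (simp add: ennreal_mult)

section \<open>Change of measure between Gaussian product densities\<close>

abbreviation leb :: "nat \<Rightarrow> (nat \<Rightarrow> real) measure" where
  "leb n \<equiv> PiM {1..n} (\<lambda>_. lborel)"

definition gdens :: "nat \<Rightarrow> real \<Rightarrow> (nat \<Rightarrow> real) \<Rightarrow> (nat \<Rightarrow> real) \<Rightarrow> real" where
  "gdens n \<sigma> \<theta> x = (\<Prod>i\<in>{1..n}. normal_density (\<theta> i) \<sigma> (x i))"

lemma gdens_pos: "\<sigma> > 0 \<Longrightarrow> gdens n \<sigma> \<theta> x > 0"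
  unfolding gdens_def by (intro prod_pos normal_density_pos)

lemma gdens_measurable [measurable]: "gdens n \<sigma> \<theta> \<in> borel_measurable (leb n)"
  unfolding gdens_def [abs_def] by measurable

lemma gauss_model_density:
  assumes "\<sigma> > 0"
  shows "gauss_model n \<sigma> \<theta> = density (leb n) (\<lambda>x. ennreal (gdens n \<sigma> \<theta> x))"
proof -
  have 1: "product_sigma_finite (\<lambda>_::nat. lborel :: real measure)" by standard
  have 2: "product_sigma_finite (\<lambda>i::nat. density lborel (\<lambda>x. ennreal (normal_density (\<theta> i) \<sigma> x)))"
    by (intro product_sigma_finite.intro prob_space_imp_sigma_finite prob_space_normal_density assms)
  show ?thesis unfolding gauss_model_def gdens_def
    by (subst PiM_density [OF _ 1 2]) (auto simp: prod_ennreal)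
qed

text \<open>In one dimension, completing the square turns \<open>p_a^2 / p_b\<close> into a multiple
  of the normal density centred at \<open>2 * a - b\<close>, the reflection of \<open>b\<close> in
  \<open>a\<close>. The multiple is therefore the integral, and it multiplies over
  coordinates.\<close>

lemma nn_integral_gdens_chi_square:
  assumes \<sigma>: "\<sigma> > 0"
  shows "(\<integral>\<^sup>+ x. ennreal ((gdens n \<sigma> \<theta> x)\<^sup>2 / gdens n \<sigma> \<theta>' x) \<partial>leb n) = ennreal (exp ((\<Sum>i\<in>{1..n}. (\<theta> i - \<theta>' i)\<^sup>2) / \<sigma>\<^sup>2))"
proof -
  interpret product_sigma_finite "\<lambda>_::nat. lborel :: real measure" by standard
  have pt: "(normal_density a \<sigma> x)\<^sup>2 / normal_density b \<sigma> x = exp ((a - b)\<^sup>2 / \<sigma>\<^sup>2) * normal_density (2 * a - b) \<sigma> x" for a b x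
  proof -
    define K where "K = 1 / sqrt (2 * pi * \<sigma>\<^sup>2)"
    have K: "K > 0" using \<sigma> by (simp add: K_def)
    have "2 * (-(x - a)\<^sup>2 / (2 * \<sigma>\<^sup>2)) - (-(x - b)\<^sup>2 / (2 * \<sigma>\<^sup>2)) = (a - b)\<^sup>2 / \<sigma>\<^sup>2 + -(x - (2 * a - b))\<^sup>2 / (2 * \<sigma>\<^sup>2)"
      using \<sigma> by (simp add: field_simps) (simp add: power2_eq_square algebra_simps)
    then have e: "(exp (-(x - a)\<^sup>2 / (2 * \<sigma>\<^sup>2)))\<^sup>2 / exp (-(x - b)\<^sup>2 / (2 * \<sigma>\<^sup>2)) = exp ((a - b)\<^sup>2 / \<sigma>\<^sup>2) * exp (-(x - (2 * a - b))\<^sup>2 / (2 * \<sigma>\<^sup>2))"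
      by (metis exp_add exp_diff exp_double)
    have "(K * A)\<^sup>2 / (K * B) = K * (A\<^sup>2 / B)" for A B using K by (simp add: power2_eq_square)
    then have "(K * exp (-(x - a)\<^sup>2 / (2 * \<sigma>\<^sup>2)))\<^sup>2 / (K * exp (-(x - b)\<^sup>2 / (2 * \<sigma>\<^sup>2)))
        = K * (exp ((a - b)\<^sup>2 / \<sigma>\<^sup>2) * exp (-(x - (2 * a - b))\<^sup>2 / (2 * \<sigma>\<^sup>2)))"
      by (simp only: e)
    also have "\<dots> = exp ((a - b)\<^sup>2 / \<sigma>\<^sup>2) * (K * exp (-(x - (2 * a - b))\<^sup>2 / (2 * \<sigma>\<^sup>2)))"
      by (rule mult.left_commute)
    finally show ?thesis unfolding normal_density_def K_def .
  qed
  have one: "(\<integral>\<^sup>+ x. ennreal ((normal_density a \<sigma> x)\<^sup>2 / normal_density b \<sigma> x) \<partial>lborel) = ennreal (exp ((a - b)\<^sup>2 / \<sigma>\<^sup>2))" for a b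
  proof -
    have "(\<integral>\<^sup>+ x. ennreal ((normal_density a \<sigma> x)\<^sup>2 / normal_density b \<sigma> x) \<partial>lborel)
        = ennreal (exp ((a - b)\<^sup>2 / \<sigma>\<^sup>2)) * (\<integral>\<^sup>+ x. ennreal (normal_density (2 * a - b) \<sigma> x) \<partial>lborel)"
      unfolding pt by (subst nn_integral_cmult [symmetric]) (auto simp: ennreal_mult')
    also have "(\<integral>\<^sup>+ x. ennreal (normal_density (2 * a - b) \<sigma> x) \<partial>lborel) = 1"
      using \<sigma> by (subst nn_integral_eq_integral) auto
    finally show ?thesis by simp
  qed
  have "(\<integral>\<^sup>+ x. ennreal ((gdens n \<sigma> \<theta> x)\<^sup>2 / gdens n \<sigma> \<theta>' x) \<partial>leb n)
      = (\<integral>\<^sup>+ x. (\<Prod>i\<in>{1..n}. ennreal ((normal_density (\<theta> i) \<sigma> (x i))\<^sup>2 / normal_density (\<theta>' i) \<sigma> (x i))) \<partial>leb n)"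
    by (intro nn_integral_cong) (simp add: gdens_def prod_ennreal prod_dividef prod_power_distrib)
  also have "\<dots> = (\<Prod>i\<in>{1..n}. ennreal (exp ((\<theta> i - \<theta>' i)\<^sup>2 / \<sigma>\<^sup>2)))"
    by (subst product_nn_integral_prod) (auto simp: one)
  also have "\<dots> = ennreal (exp ((\<Sum>i\<in>{1..n}. (\<theta> i - \<theta>' i)\<^sup>2) / \<sigma>\<^sup>2))"
    by (simp add: prod_ennreal exp_sum sum_divide_distrib)
  finally show ?thesis .
qed

text \<open>AM-GM applied pointwise to the two densities, with a free weight \<open>l\<close>. The
  indicator of \<open>A\<close> is dropped from the quadratic term, which becomes a full chi-square
  integral, and kept in the linear one, so that summing over disjoint events costs a single unit of
  reference mass.\<close>

lemma gauss_model_change_of_measure: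
  assumes \<sigma>: "\<sigma> > 0" and A: "A \<in> sets (leb n)" and l: "l > 0"
  shows "emeasure (gauss_model n \<sigma> \<theta>) A
      \<le> ennreal (l / 2 * exp ((\<Sum>i\<in>{1..n}. (\<theta> i - \<theta>' i)\<^sup>2) / \<sigma>\<^sup>2)) + ennreal (1 / (2 * l)) * emeasure (gauss_model n \<sigma> \<theta>') A"
proof -
  have pt: "p \<le> l / 2 * (p\<^sup>2 / c) + 1 / (2 * l) * c" if "c > 0" for p c :: real
  proof -
    have "0 \<le> (l * p - c)\<^sup>2 / (2 * l * c)" using that l by simp
    also have "\<dots> = l / 2 * (p\<^sup>2 / c) + 1 / (2 * l) * c - p"
      using that l by (simp add: field_simps power2_eq_square)
    finally show ?thesis by simp
  qed
  have "emeasure (gauss_model n \<sigma> \<theta>) A = (\<integral>\<^sup>+ x. ennreal (gdens n \<sigma> \<theta> x) * indicator A x \<partial>leb n)"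
    unfolding gauss_model_density [OF \<sigma>] by (rule emeasure_density [OF _ A]) measurable
  also have "\<dots> \<le> (\<integral>\<^sup>+ x. ennreal (l / 2) * ennreal ((gdens n \<sigma> \<theta> x)\<^sup>2 / gdens n \<sigma> \<theta>' x)
       + ennreal (1 / (2 * l)) * (ennreal (gdens n \<sigma> \<theta>' x) * indicator A x) \<partial>leb n)"
  proof (rule nn_integral_mono)
    fix x
    have g: "gdens n \<sigma> \<theta>' x > 0" by (rule gdens_pos [OF \<sigma>])
    show "ennreal (gdens n \<sigma> \<theta> x) * indicator A x \<le> ennreal (l / 2) * ennreal ((gdens n \<sigma> \<theta> x)\<^sup>2 / gdens n \<sigma> \<theta>' x)
       + ennreal (1 / (2 * l)) * (ennreal (gdens n \<sigma> \<theta>' x) * indicator A x)"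
    proof (cases "x \<in> A")
      case True
      have "ennreal (gdens n \<sigma> \<theta> x) \<le> ennreal (l / 2 * ((gdens n \<sigma> \<theta> x)\<^sup>2 / gdens n \<sigma> \<theta>' x) + 1 / (2 * l) * gdens n \<sigma> \<theta>' x)"
        by (intro ennreal_leI pt g)
      also have "\<dots> = ennreal (l / 2) * ennreal ((gdens n \<sigma> \<theta> x)\<^sup>2 / gdens n \<sigma> \<theta>' x) + ennreal (1 / (2 * l)) * ennreal (gdens n \<sigma> \<theta>' x)"
        using l g by (intro ennreal_mult_add) auto
      finally show ?thesis using True by simp
    qed simp
  qed
  also have "\<dots> = ennreal (l / 2) * (\<integral>\<^sup>+ x. ennreal ((gdens n \<sigma> \<theta> x)\<^sup>2 / gdens n \<sigma> \<theta>' x) \<partial>leb n)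
       + ennreal (1 / (2 * l)) * (\<integral>\<^sup>+ x. ennreal (gdens n \<sigma> \<theta>' x) * indicator A x \<partial>leb n)"
    using A by (simp add: nn_integral_add nn_integral_cmult del: One_nat_def)
  also have "(\<integral>\<^sup>+ x. ennreal (gdens n \<sigma> \<theta>' x) * indicator A x \<partial>leb n) = emeasure (gauss_model n \<sigma> \<theta>') A"
    unfolding gauss_model_density [OF \<sigma>] by (rule emeasure_density [OF _ A, symmetric]) measurable
  finally show ?thesis using l unfolding nn_integral_gdens_chi_square [OF \<sigma>] by (subst ennreal_mult') auto
qed

lemma gauss_model_facts:
  assumes "\<sigma> > 0"
  shows "prob_space (gauss_model n \<sigma> \<theta>)" "sets (gauss_model n \<sigma> \<theta>) = sets (leb n)"
    "sets (leb n) = sets (PiM {1..n} (\<lambda>_. borel))" "space (gauss_model n \<sigma> \<theta>) = space (leb n)"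
proof -
  show "prob_space (gauss_model n \<sigma> \<theta>)"
    unfolding gauss_model_def by (intro prob_space_PiM prob_space_normal_density assms)
  show s: "sets (gauss_model n \<sigma> \<theta>) = sets (leb n)"
    unfolding gauss_model_def by (intro sets_PiM_cong) auto
  show "sets (leb n) = sets (PiM {1..n} (\<lambda>_. borel))" by (intro sets_PiM_cong) auto
  show "space (gauss_model n \<sigma> \<theta>) = space (leb n)" using s by (rule sets_eq_imp_space_eq)
qed

lemma estimator_component_measurable:
  assumes "T \<in> estimators n" "i \<in> {1..n}"
  shows "(\<lambda>x. T x i) \<in> borel_measurable (leb n)"
proof -
  have "T \<in> measurable (PiM {1..n} (\<lambda>_. borel)) (PiM {1..n} (\<lambda>_. borel))"
    using assms(1) by (simp only: estimators_def)
  from measurable_compose [OF this measurable_component_singleton [OF assms(2)]]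
  have "(\<lambda>x. T x i) \<in> borel_measurable (PiM {1..n} (\<lambda>_. borel))" .
  moreover have "sets (leb n) = sets (PiM {1..n} (\<lambda>_. borel))" by (intro sets_PiM_cong) auto
  ultimately show ?thesis using measurable_cong_sets [OF _ refl] by blast
qed

text \<open>Staircases are tested one block at a time, and the risks on disjoint blocks add up to at
  most the whole risk.\<close>

definition block_risk :: "nat \<Rightarrow> real \<Rightarrow> ((nat \<Rightarrow> real) \<Rightarrow> (nat \<Rightarrow> real)) \<Rightarrow> nat set \<Rightarrow> (nat \<Rightarrow> real) \<Rightarrow> ennreal" where
  "block_risk n \<sigma> T B \<theta> = (\<integral>\<^sup>+ x. ennreal (\<Sum>i\<in>B. (T x i - \<theta> i)\<^sup>2) \<partial>gauss_model n \<sigma> \<theta>)"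

text \<open>A multiple-testing bound: if \<open>A\<^sub>s\<close> is the event that the estimator is close to hypothesis \<open>s\<close>, these events are
  disjoint, and \<open>P\<^sub>s(A\<^sub>s) \<le> \<lambda>/2 \<integral>p\<^sub>s\<^sup>2/p\<^sub>0 + P\<^sub>0(A\<^sub>s)/(2\<lambda>)\<close>; take \<open>\<lambda> = M powr (-3/4)\<close>.\<close>

lemma multiple_hypotheses_bound:
  fixes th :: "'s \<Rightarrow> nat \<Rightarrow> real"
  assumes \<sigma>: "\<sigma> > 0" and S: "finite S" "card S \<ge> 2" and T: "T \<in> estimators n" and B: "B \<subseteq> {1..n}" and d: "d \<ge> 0"
    and close: "\<And>s. s \<in> S \<Longrightarrow> (\<Sum>i\<in>{1..n}. (th s i - base i)\<^sup>2) \<le> \<sigma>\<^sup>2 / 2 * ln (real (card S))"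
    and sep: "\<And>s t. s \<in> S \<Longrightarrow> t \<in> S \<Longrightarrow> s \<noteq> t \<Longrightarrow> d \<le> (\<Sum>i\<in>B. (th s i - th t i)\<^sup>2)"
  shows "ennreal (real (card S) * d / 32) \<le> (\<Sum>s\<in>S. block_risk n \<sigma> T B (th s))"
proof -
  define M where "M = real (card S)"
  \<comment> \<open>\<open>w\<close> is the fourth root of \<open>M\<close>: with weight
    \<open>1 / w ^ 3\<close>, both parts of the bound on the total success probability come out as
    \<open>w ^ 3 / 2\<close>.\<close>
  define w where "w = sqrt (sqrt M)"
  define A where "A = (\<lambda>s. {x \<in> space (leb n). (\<Sum>i\<in>B. (T x i - th s i)\<^sup>2) < d / 4})"
  define P where "P = (\<lambda>s. gauss_model n \<sigma> (th s))"
  define P0 where "P0 = gauss_model n \<sigma> base"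
  have M2: "M \<ge> 2" using S by (simp add: M_def)
  have finB: "finite B" using B finite_subset by blast
  have w2: "w\<^sup>2 = sqrt M" using M2 by (simp add: w_def)
  have w4: "w ^ 4 = M"
  proof -
    have "w ^ 4 = (w\<^sup>2)\<^sup>2" by (simp flip: power_mult)
    then show ?thesis using M2 unfolding w2 by simp
  qed
  have w0: "w \<ge> 0" using M2 by (simp add: w_def)
  \<comment> \<open>Since \<open>(8 / 7) ^ 4 < 2\<close>, the total \<open>w ^ 3\<close> is at most
    \<open>7 / 8 * M\<close>, so at least one eighth of the total mass \<open>M\<close> lies outside
    the events \<open>A s\<close>.\<close>
  have w87: "w \<ge> 8 / 7"
  proof (rule ccontr)
    assume "\<not> w \<ge> 8 / 7"
    then have "w ^ 4 \<le> (8 / 7) ^ 4" using w0 by (intro power_mono) auto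
    then show False using M2 unfolding w4 by (simp add: power4_eq_xxxx)
  qed
  interpret P: prob_space "P s" for s unfolding P_def by (rule gauss_model_facts [OF \<sigma>])
  interpret P0: prob_space P0 unfolding P0_def by (rule gauss_model_facts [OF \<sigma>])
  have meas [measurable]: "(\<lambda>x. \<Sum>i\<in>B. (T x i - th s i)\<^sup>2) \<in> borel_measurable (leb n)" for s
    using estimator_component_measurable [OF T] B by (intro borel_measurable_sum borel_measurable_power borel_measurable_diff) auto
  have Am: "A s \<in> sets (leb n)" for s unfolding A_def by measurable
  have AmP: "A s \<in> sets (P t)" "A s \<in> sets P0" for s t
    using Am gauss_model_facts(2) [OF \<sigma>] by (auto simp: P_def P0_def)
  have disj: "disjoint_family_on A S"
    unfolding disjoint_family_on_def
  proof (intro ballI impI)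
    fix s t assume st: "s \<in> S" "t \<in> S" "s \<noteq> t"
    show "A s \<inter> A t = {}"
    proof (rule ccontr)
      assume "A s \<inter> A t \<noteq> {}"
      then obtain x where x: "(\<Sum>i\<in>B. (T x i - th s i)\<^sup>2) < d / 4" "(\<Sum>i\<in>B. (T x i - th t i)\<^sup>2) < d / 4"
        by (auto simp: A_def)
      have "(\<Sum>i\<in>B. (th s i - th t i)\<^sup>2) \<le> (\<Sum>i\<in>B. 2 * (T x i - th s i)\<^sup>2 + 2 * (T x i - th t i)\<^sup>2)"
      proof (rule sum_mono)
        fix i
        have "0 \<le> ((T x i - th s i) + (T x i - th t i))\<^sup>2" by simp
        then show "(th s i - th t i)\<^sup>2 \<le> 2 * (T x i - th s i)\<^sup>2 + 2 * (T x i - th t i)\<^sup>2"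
          by (simp add: power2_eq_square algebra_simps)
      qed
      also have "\<dots> = 2 * (\<Sum>i\<in>B. (T x i - th s i)\<^sup>2) + 2 * (\<Sum>i\<in>B. (T x i - th t i)\<^sup>2)"
        by (simp add: sum.distrib sum_distrib_left)
      finally show False using x sep [OF st] by simp
    qed
  qed
  have "(\<Sum>s\<in>S. P0.prob (A s)) = P0.prob (\<Union>s\<in>S. A s)"
    by (rule P0.finite_measure_finite_Union [symmetric]) (use S AmP disj in auto)
  then have sumP0: "(\<Sum>s\<in>S. P0.prob (A s)) \<le> 1" by simp
  have each: "P.prob s (A s) \<le> 1 / (2 * w ^ 3) * sqrt M + w ^ 3 / 2 * P0.prob (A s)" if "s \<in> S" for s
  proof -
    have ex: "exp ((\<Sum>i\<in>{1..n}. (th s i - base i)\<^sup>2) / \<sigma>\<^sup>2) \<le> sqrt M"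
    proof -
      have "(\<Sum>i\<in>{1..n}. (th s i - base i)\<^sup>2) / \<sigma>\<^sup>2 \<le> (\<sigma>\<^sup>2 / 2 * ln M) / \<sigma>\<^sup>2"
        unfolding M_def by (intro divide_right_mono close that) auto
      also have "\<dots> = ln (sqrt M)" using \<sigma> M2 by (simp add: ln_sqrt)
      finally have "exp ((\<Sum>i\<in>{1..n}. (th s i - base i)\<^sup>2) / \<sigma>\<^sup>2) \<le> exp (ln (sqrt M))" by (simp only: exp_le_cancel_iff)
      then show ?thesis using M2 by simp
    qed
    have w3: "1 / w ^ 3 > 0" using w87 by simp
    have "ennreal (P.prob s (A s)) \<le> ennreal ((1 / w ^ 3) / 2 * exp ((\<Sum>i\<in>{1..n}. (th s i - base i)\<^sup>2) / \<sigma>\<^sup>2)) + ennreal (1 / (2 * (1 / w ^ 3))) * ennreal (P0.prob (A s))"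
      using gauss_model_change_of_measure [OF \<sigma> Am w3, of "th s" s base]
      unfolding P.emeasure_eq_measure [symmetric] P0.emeasure_eq_measure [symmetric] by (simp add: P_def P0_def)
    also have "\<dots> = ennreal ((1 / w ^ 3) / 2 * exp ((\<Sum>i\<in>{1..n}. (th s i - base i)\<^sup>2) / \<sigma>\<^sup>2) + w ^ 3 / 2 * P0.prob (A s))"
    proof -
      have "ennreal (1 / (2 * (1 / w ^ 3))) * ennreal (P0.prob (A s)) = ennreal (w ^ 3 / 2 * P0.prob (A s))"
        using w0 by (subst ennreal_mult' [symmetric]) auto
      then show ?thesis using w0 by (subst ennreal_plus) auto
    qed
    finally have "P.prob s (A s) \<le> (1 / w ^ 3) / 2 * exp ((\<Sum>i\<in>{1..n}. (th s i - base i)\<^sup>2) / \<sigma>\<^sup>2) + w ^ 3 / 2 * P0.prob (A s)"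
      using w0 by (subst (asm) ennreal_le_iff) auto
    also have "\<dots> \<le> (1 / w ^ 3) / 2 * sqrt M + w ^ 3 / 2 * P0.prob (A s)"
      using w0 by (intro add_right_mono mult_left_mono ex) auto
    finally show ?thesis by simp
  qed
  have "(\<Sum>s\<in>S. P.prob s (A s)) \<le> (\<Sum>s\<in>S. 1 / (2 * w ^ 3) * sqrt M + w ^ 3 / 2 * P0.prob (A s))"
    by (intro sum_mono each)
  also have "\<dots> = M * (1 / (2 * w ^ 3) * sqrt M) + w ^ 3 / 2 * (\<Sum>s\<in>S. P0.prob (A s))"
    by (simp add: sum.distrib sum_distrib_left M_def)
  also have "\<dots> \<le> M * (1 / (2 * w ^ 3) * sqrt M) + w ^ 3 / 2 * 1"
    using sumP0 w0 by (intro add_left_mono mult_left_mono) auto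
  also have "\<dots> = w ^ 3"
  proof -
    have "M * (1 / (2 * w ^ 3) * sqrt M) = w ^ 4 * w\<^sup>2 / (2 * w ^ 3)" by (simp add: w4 w2)
    also have "w ^ 4 * w\<^sup>2 = w ^ 3 * w ^ 3" by (simp flip: power_add)
    also have "w ^ 3 * w ^ 3 / (2 * w ^ 3) = w ^ 3 / 2" 
      using w87 by (intro nonzero_mult_divide_mult_cancel_right) simp
    finally show ?thesis by simp
  qed
  also have "\<dots> \<le> 7 / 8 * M"
  proof -
    have "w ^ 3 * (8 / 7) \<le> w ^ 3 * w" using w0 w87 by (intro mult_left_mono) auto
    also have "\<dots> = M" unfolding w4 [symmetric] by (simp add: power4_eq_xxxx power3_eq_cube mult.assoc)
    finally show ?thesis by simp
  qed
  finally have sumP: "(\<Sum>s\<in>S. P.prob s (A s)) \<le> 7 / 8 * M" .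
  have risk: "ennreal (d / 4 * (1 - P.prob s (A s))) \<le> block_risk n \<sigma> T B (th s)" for s
  proof -
    have sp: "space (P s) = space (leb n)" unfolding P_def by (rule gauss_model_facts(4) [OF \<sigma>])
    have "ennreal (d / 4 * (1 - P.prob s (A s))) = ennreal (d / 4) * emeasure (P s) (space (P s) - A s)"
    proof -
      have "emeasure (P s) (space (P s) - A s) = ennreal (1 - P.prob s (A s))"
        using AmP(1) by (simp add: P.emeasure_eq_measure P.prob_compl)
      then show ?thesis using d by (subst ennreal_mult') auto
    qed
    also have "\<dots> = (\<integral>\<^sup>+ x. ennreal (d / 4) * indicator (space (P s) - A s) x \<partial>P s)"
      using AmP(1) by (subst nn_integral_cmult_indicator) auto
    also have "\<dots> \<le> (\<integral>\<^sup>+ x. ennreal (\<Sum>i\<in>B. (T x i - th s i)\<^sup>2) \<partial>P s)"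
    proof (rule nn_integral_mono)
      fix x assume "x \<in> space (P s)"
      then show "ennreal (d / 4) * indicator (space (P s) - A s) x \<le> ennreal (\<Sum>i\<in>B. (T x i - th s i)\<^sup>2)"
        by (auto simp: indicator_def A_def sp intro!: ennreal_leI)
    qed
    finally show ?thesis unfolding block_risk_def P_def .
  qed
  have "real (card S) * d / 32 = d / 4 * (M - 7 / 8 * M)" by (simp add: M_def)
  also have "\<dots> \<le> d / 4 * (M - (\<Sum>s\<in>S. P.prob s (A s)))" using d sumP by (intro mult_left_mono) auto
  also have "\<dots> = (\<Sum>s\<in>S. d / 4 * (1 - P.prob s (A s)))"
    unfolding sum_distrib_left [symmetric] by (simp add: M_def sum_subtractf)
  finally have "ennreal (real (card S) * d / 32) \<le> ennreal (\<Sum>s\<in>S. d / 4 * (1 - P.prob s (A s)))"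
    by (rule ennreal_leI)
  also have "\<dots> = (\<Sum>s\<in>S. ennreal (d / 4 * (1 - P.prob s (A s))))"
    using d by (intro sum_ennreal [symmetric]) (auto simp: P.prob_le_1)
  also have "\<dots> \<le> (\<Sum>s\<in>S. block_risk n \<sigma> T B (th s))" by (intro sum_mono risk)
  finally show ?thesis .
qed

lemma minimax_lower_from_average:
  assumes S: "finite S" "S \<noteq> {}" and th: "\<And>s. s \<in> S \<Longrightarrow> th s \<in> C"
    and avg: "\<And>T. T \<in> estimators n \<Longrightarrow> ennreal (real (card S) * r) \<le> (\<Sum>s\<in>S. sq_risk n \<sigma> T (th s))" and r: "r \<ge> 0"
  shows "ennreal r \<le> (INF T\<in>estimators n. SUP \<theta>\<in>C. sq_risk n \<sigma> T \<theta>)"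
proof (rule INF_greatest)
  fix T assume T: "T \<in> estimators n"
  define U where "U = (SUP \<theta>\<in>C. sq_risk n \<sigma> T \<theta>)"
  have M: "card S > 0" using S by (simp add: card_gt_0_iff)
  have "ennreal (real (card S)) * ennreal r = ennreal (real (card S) * r)" by (simp add: ennreal_mult')
  also have "\<dots> \<le> (\<Sum>s\<in>S. sq_risk n \<sigma> T (th s))" by (rule avg [OF T])
  also have "\<dots> \<le> (\<Sum>s\<in>S. U)" unfolding U_def by (intro sum_mono SUP_upper th)
  also have "\<dots> = ennreal (real (card S)) * U" by (simp add: ennreal_of_nat_eq_real_of_nat)
  finally have "ennreal (real (card S)) * ennreal r \<le> ennreal (real (card S)) * U" .
  then show "ennreal r \<le> U" using M by (subst (asm) ennreal_mult_le_mult_iff) auto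
qed

lemma block_risk_all: "block_risk n \<sigma> T {1..n} \<theta> = sq_risk n \<sigma> T \<theta>"
  by (simp add: block_risk_def sq_risk_def)

section \<open>Approximate least squares estimators\<close>

lemma unimodal_pieces_map:
  assumes "\<theta> \<in> unimodal_pieces n k" "mono F"
  shows "(\<lambda>i\<in>{1..n}. F (\<theta> i)) \<in> unimodal_pieces n k"
proof -
  obtain a l \<mu> where a: "a 0 = 0" "a k = n" "\<forall>j<k. a j \<le> a (Suc j)"
    and l: "1 \<le> l" "l \<le> k"
    and up: "\<forall>j. 1 \<le> j \<and> j < l \<longrightarrow> \<mu> j \<le> \<mu> (Suc j)"
    and down: "\<forall>j. l \<le> j \<and> j < k \<longrightarrow> \<mu> (Suc j) \<le> \<mu> j"
    and val: "\<forall>j\<in>{1..k}. \<forall>i. a (j - 1) < i \<and> i \<le> a j \<longrightarrow> \<theta> i = \<mu> j"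
    using assms unfolding unimodal_pieces_def by blast
  have amono: "a j \<le> n" if "j \<le> k" for j
    using that a by (induction j rule: inc_induct) (auto intro: order_trans)
  show ?thesis
    unfolding unimodal_pieces_def
    by (rule CollectI, rule conjI, simp, rule exI [of _ a], rule exI [of _ l], rule exI [of _ "F \<circ> \<mu>"])
      (use a l up down val amono assms(2) in \<open>auto simp: mono_def, fastforce\<close>)
qed

lemma const_in_unimodal_pieces:
  assumes "k \<ge> 1"
  shows "(\<lambda>i\<in>{1..n}. c) \<in> unimodal_pieces n k"
  unfolding unimodal_pieces_def
  by (rule CollectI, rule conjI, simp, rule exI [of _ "\<lambda>j. if j = 0 then 0 else n"], rule exI [of _ 1], rule exI [of _ "\<lambda>_. c"])
    (use assms in \<open>auto split: if_splits\<close>)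

text \<open>Rounding each coordinate down to a multiple of \<open>1 / (m + 1)\<close> is a monotone
  map, so it preserves pieces and mode and produces rational values. The loss is continuous in the
  coordinates.\<close>

lemma unimodal_pieces_rational_approx:
  fixes x :: "nat \<Rightarrow> real"
  assumes \<theta>: "\<theta> \<in> unimodal_pieces n k" and "\<delta> > 0"
  shows "\<exists>q \<in> unimodal_pieces n k \<inter> ({1..n} \<rightarrow>\<^sub>E \<rat>). (\<Sum>i\<in>{1..n}. (x i - q i)\<^sup>2) \<le> (\<Sum>i\<in>{1..n}. (x i - \<theta> i)\<^sup>2) + \<delta>"
proof -
  define F where "F = (\<lambda>(m::nat) t. real_of_int \<lfloor>t * real (Suc m)\<rfloor> / real (Suc m))"
  have lim: "(\<lambda>m. F m t) \<longlonglongrightarrow> t" for t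
  proof (rule tendsto_sandwich)
    show "(\<lambda>m. t - 1 / real (Suc m)) \<longlonglongrightarrow> t"
      using tendsto_diff [OF tendsto_const LIMSEQ_inverse_real_of_nat, of t] by (simp add: inverse_eq_divide)
    show "(\<lambda>m. t) \<longlonglongrightarrow> t" by simp
    show "\<forall>\<^sub>F m in sequentially. t - 1 / real (Suc m) \<le> F m t"
    proof (intro always_eventually allI)
      fix m
      have "t * real (Suc m) - 1 \<le> real_of_int \<lfloor>t * real (Suc m)\<rfloor>" by linarith
      from divide_right_mono [OF this, of "real (Suc m)"]
      show "t - 1 / real (Suc m) \<le> F m t" by (simp add: F_def diff_divide_distrib)
    qed
    show "\<forall>\<^sub>F m in sequentially. F m t \<le> t"
    proof (intro always_eventually allI)
      fix m
      have "real_of_int \<lfloor>t * real (Suc m)\<rfloor> \<le> t * real (Suc m)" by linarith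
      from divide_right_mono [OF this, of "real (Suc m)"]
      show "F m t \<le> t" by (simp add: F_def)
    qed
  qed
  have "(\<lambda>m. \<Sum>i\<in>{1..n}. (x i - F m (\<theta> i))\<^sup>2) \<longlonglongrightarrow> (\<Sum>i\<in>{1..n}. (x i - \<theta> i)\<^sup>2)"
    by (intro tendsto_intros lim)
  then have "\<forall>\<^sub>F m in sequentially. (\<Sum>i\<in>{1..n}. (x i - F m (\<theta> i))\<^sup>2) < (\<Sum>i\<in>{1..n}. (x i - \<theta> i)\<^sup>2) + \<delta>"
    using assms by (intro order_tendstoD) auto
  then obtain m where m: "(\<Sum>i\<in>{1..n}. (x i - F m (\<theta> i))\<^sup>2) < (\<Sum>i\<in>{1..n}. (x i - \<theta> i)\<^sup>2) + \<delta>"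
    by (auto simp: eventually_sequentially)
  have mono: "mono (F m)"
    by (auto simp: mono_def F_def intro!: divide_right_mono floor_mono mult_right_mono)
  show ?thesis
  proof (rule bexI [of _ "\<lambda>i\<in>{1..n}. F m (\<theta> i)"])
    show "(\<lambda>i\<in>{1..n}. F m (\<theta> i)) \<in> unimodal_pieces n k \<inter> ({1..n} \<rightarrow>\<^sub>E \<rat>)"
      using unimodal_pieces_map [OF \<theta> mono] by (auto simp: F_def)
    show "(\<Sum>i\<in>{1..n}. (x i - (\<lambda>i\<in>{1..n}. F m (\<theta> i)) i)\<^sup>2) \<le> (\<Sum>i\<in>{1..n}. (x i - \<theta> i)\<^sup>2) + \<delta>"
      using m by (simp del: One_nat_def)
  qed
qed

text \<open>The slack avoids a measurable selection of exact minimisers. Among an enumeration of the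
  rational members of the class, the least index whose loss is within \<open>\<delta> / 2\<close> of
  all others is measurable, being defined by countably many inequalities; the other
  \<open>\<delta> / 2\<close> pays for the rational approximation.\<close>

lemma approximate_least_squares:
  assumes k: "k \<ge> 1" and d: "\<delta> > 0"
  shows "\<exists>T\<in>estimators n. \<forall>x. T x \<in> unimodal_pieces n k \<and>
     (\<forall>\<theta>\<in>unimodal_pieces n k. (\<Sum>i\<in>{1..n}. (x i - T x i)\<^sup>2) \<le> (\<Sum>i\<in>{1..n}. (x i - \<theta> i)\<^sup>2) + \<delta>)"
proof -
  define Q where "Q = unimodal_pieces n k \<inter> ({1..n} \<rightarrow>\<^sub>E \<rat>)"
  have "countable ({1..n} \<rightarrow>\<^sub>E (\<rat> :: real set))" by (intro countable_PiE countable_rat) auto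
  then have cQ: "countable Q" unfolding Q_def by (rule countable_subset [rotated]) auto
  have "(\<lambda>i\<in>{1..n}. 0) \<in> Q" using const_in_unimodal_pieces [OF k] by (auto simp: Q_def)
  then have neQ: "Q \<noteq> {}" by auto
  define q where "q = from_nat_into Q"
  have q: "q j \<in> Q" for j unfolding q_def using neQ by (rule from_nat_into)
  have qr: "\<exists>j. q j = p" if "p \<in> Q" for p
    using range_from_nat_into [OF neQ cQ] that unfolding q_def by (metis rangeE)
  define loss where "loss = (\<lambda>p (x::nat \<Rightarrow> real). \<Sum>i\<in>{1..n}. (x i - p i)\<^sup>2)"
  define J where "J = (\<lambda>x. LEAST j. \<forall>l. loss (q j) x \<le> loss (q l) x + \<delta> / 2)"
  have J: "loss (q (J x)) x \<le> loss (q l) x + \<delta> / 2" for x l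
  proof -
    have bdd: "bdd_below (range (\<lambda>j. loss (q j) x))"
      by (rule bdd_belowI [of _ 0]) (auto simp: loss_def sum_nonneg)
    have "(INF j. loss (q j) x) < (INF j. loss (q j) x) + \<delta> / 2" using d by simp
    from cINF_less_iff [THEN iffD1, OF UNIV_not_empty bdd this]
    obtain j where "loss (q j) x < (INF j. loss (q j) x) + \<delta> / 2" by blast
    then have "\<exists>j. \<forall>l. loss (q j) x \<le> loss (q l) x + \<delta> / 2"
      using cINF_lower [OF bdd] by (intro exI [of _ j] allI) (smt (verit) UNIV_I)
    then have "\<forall>l. loss (q (J x)) x \<le> loss (q l) x + \<delta> / 2" unfolding J_def by (rule LeastI_ex)
    then show ?thesis by blast
  qed
  have meas_loss [measurable]: "loss p \<in> borel_measurable (PiM {1..n} (\<lambda>_. borel))" for p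
    unfolding loss_def by measurable
  have [measurable]: "Measurable.pred (PiM {1..n} (\<lambda>_. borel)) (\<lambda>x. loss (q j) x \<le> loss (q l) x + \<delta> / 2)" for j l
    unfolding pred_def by (intro borel_measurable_le borel_measurable_add meas_loss borel_measurable_const)
  have "J \<in> measurable (PiM {1..n} (\<lambda>_. borel)) (count_space UNIV)"
    unfolding J_def by measurable
  moreover have "q \<in> measurable (count_space UNIV) (PiM {1..n} (\<lambda>_. borel))"
    using q by (auto simp: space_PiM Q_def PiE_def)
  ultimately have "(\<lambda>x. q (J x)) \<in> estimators n"
    unfolding estimators_def by (rule measurable_compose)
  moreover have "q (J x) \<in> unimodal_pieces n k" for x using q by (auto simp: Q_def)
  moreover have "(\<Sum>i\<in>{1..n}. (x i - q (J x) i)\<^sup>2) \<le> (\<Sum>i\<in>{1..n}. (x i - \<theta> i)\<^sup>2) + \<delta>" if th: "\<theta> \<in> unimodal_pieces n k" for x \<theta>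
  proof -
    have d2: "\<delta> / 2 > 0" using d by simp
    obtain p where p: "p \<in> Q" "loss p x \<le> loss \<theta> x + \<delta> / 2"
      using unimodal_pieces_rational_approx [OF th d2, of x] unfolding Q_def loss_def by blast
    obtain l where "q l = p" using qr [OF p(1)] by blast
    then have "loss (q (J x)) x \<le> loss \<theta> x + \<delta>" using J [of x l] p(2) by simp
    then show ?thesis by (simp add: loss_def)
  qed
  ultimately show ?thesis by (intro bexI [of _ "\<lambda>x. q (J x)"]) auto
qed

text \<open>Basic inequality of least squares: the squared error \<open>S\<close> is at most twice
  the noise term plus the slack. The noise term is at most
  \<open>\<sigma> * sqrt B * sqrt S\<close>, and AM-GM lets half of \<open>S\<close> be absorbed on
  the left; doubling what remains gives the factor \<open>4\<close>.\<close>

lemma least_squares_inequality: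
  fixes z v \<theta> :: "nat \<Rightarrow> real"
  assumes "\<sigma> > 0" "B \<ge> 0"
    and B: "(\<Sum>i\<in>I. z i * (v i - \<theta> i))\<^sup>2 \<le> B * (\<Sum>i\<in>I. (v i - \<theta> i)\<^sup>2)"
    and ls: "(\<Sum>i\<in>I. (x i - v i)\<^sup>2) \<le> (\<Sum>i\<in>I. (x i - \<theta> i)\<^sup>2) + \<sigma>\<^sup>2 / 2"
    and x: "\<And>i. i \<in> I \<Longrightarrow> x i = \<theta> i + \<sigma> * z i"
  shows "(\<Sum>i\<in>I. (v i - \<theta> i)\<^sup>2) \<le> \<sigma>\<^sup>2 * (4 * B + 1)"
proof -
  define S where "S = (\<Sum>i\<in>I. (v i - \<theta> i)\<^sup>2)"
  define c where "c = (\<Sum>i\<in>I. z i * (v i - \<theta> i))"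
  have S0: "S \<ge> 0" by (simp add: S_def sum_nonneg)
  have "(\<Sum>i\<in>I. (x i - v i)\<^sup>2) = (\<Sum>i\<in>I. (x i - \<theta> i)\<^sup>2 - 2 * \<sigma> * (z i * (v i - \<theta> i)) + (v i - \<theta> i)\<^sup>2)"
    by (intro sum.cong) (auto simp: x power2_eq_square algebra_simps)
  also have "\<dots> = (\<Sum>i\<in>I. (x i - \<theta> i)\<^sup>2) - 2 * \<sigma> * c + S"
    by (simp add: sum.distrib sum_subtractf sum_distrib_left c_def S_def)
  finally have 1: "S \<le> 2 * \<sigma> * c + \<sigma>\<^sup>2 / 2" using ls by simp
  have "c \<le> sqrt B * sqrt S"
    using B unfolding c_def S_def by (metis abs_le_D1 real_sqrt_abs real_sqrt_le_iff real_sqrt_mult)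
  then have "2 * \<sigma> * c \<le> 2 * \<sigma> * (sqrt B * sqrt S)" using assms by (intro mult_left_mono) auto
  also have "\<dots> \<le> S / 2 + 2 * \<sigma>\<^sup>2 * B"
  proof -
    have "0 \<le> (sqrt S - 2 * \<sigma> * sqrt B)\<^sup>2" by simp
    also have "\<dots> = S + 4 * \<sigma>\<^sup>2 * B - 4 * \<sigma> * (sqrt B * sqrt S)"
      using S0 assms by (simp add: power2_diff power_mult_distrib mult_ac)
    finally show ?thesis by simp
  qed
  finally have "S \<le> 4 * (\<sigma>\<^sup>2 * B) + \<sigma>\<^sup>2" using 1 by simp
  then show ?thesis unfolding S_def by (simp add: algebra_simps)
qed

section \<open>Maximal inequalities for Gaussian partial sums\<close>

definition std_gauss :: "'i set \<Rightarrow> ('i \<Rightarrow> real) measure" where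
  "std_gauss I = PiM I (\<lambda>_. density lborel std_normal_density)"

lemma prob_space_std_normal: "prob_space (density lborel std_normal_density)"
  by (rule prob_space_normal_density) simp

lemma product_prob_space_std_normal: "product_prob_space (\<lambda>_. density lborel std_normal_density)"
  by (intro product_prob_spaceI prob_space_std_normal)

lemma prob_space_std_gauss: "prob_space (std_gauss I)"
  unfolding std_gauss_def by (intro prob_space_PiM prob_space_std_normal)

text \<open>Outside \<open>I\<close> the coordinate is the constant \<open>undefined\<close>.
  Covering this case frees all later measurability proofs from index conditions.\<close>

lemma measurable_std_gauss_component [measurable]: "(\<lambda>z. z i) \<in> borel_measurable (std_gauss I)"
proof (cases "i \<in> I")
  case True
  then have "(\<lambda>z. z i) \<in> measurable (std_gauss I) (density lborel std_normal_density)"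
    unfolding std_gauss_def by (rule measurable_component_singleton)
  then show ?thesis by simp
next
  case False
  have "(\<lambda>z. z i) \<in> borel_measurable (std_gauss I) \<longleftrightarrow> (\<lambda>z. undefined :: real) \<in> borel_measurable (std_gauss I)"
    by (rule measurable_cong) (use False in \<open>auto simp: std_gauss_def space_PiM PiE_def extensional_def\<close>)
  then show ?thesis by simp
qed

lemma sets_std_gauss: "sets (std_gauss I) = sets (PiM I (\<lambda>_. borel))"
  unfolding std_gauss_def by (intro sets_PiM_cong) auto

lemma nn_integral_std_normal_exp:
  "(\<integral>\<^sup>+ y. ennreal (exp (\<mu> * y)) \<partial>density lborel std_normal_density) = ennreal (exp (\<mu>\<^sup>2 / 2))"
proof -
  have eq: "std_normal_density y * exp (\<mu> * y) = exp (\<mu>\<^sup>2 / 2) * normal_density \<mu> 1 y" for y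
  proof -
    have "- y\<^sup>2 / 2 + \<mu> * y = \<mu>\<^sup>2 / 2 + - (y - \<mu>)\<^sup>2 / 2"
      by (simp add: power2_eq_square algebra_simps add_divide_distrib diff_divide_distrib)
    then have "exp (- y\<^sup>2 / 2) * exp (\<mu> * y) = exp (\<mu>\<^sup>2 / 2) * exp (- (y - \<mu>)\<^sup>2 / 2)"
      by (simp only: exp_add [symmetric])
    then show ?thesis by (simp add: normal_density_def)
  qed
  have "(\<integral>\<^sup>+ y. ennreal (exp (\<mu> * y)) \<partial>density lborel std_normal_density)
      = (\<integral>\<^sup>+ y. ennreal (std_normal_density y) * ennreal (exp (\<mu> * y)) \<partial>lborel)"
    by (subst nn_integral_density) auto
  also have "\<dots> = (\<integral>\<^sup>+ y. ennreal (exp (\<mu>\<^sup>2 / 2)) * ennreal (normal_density \<mu> 1 y) \<partial>lborel)"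
    by (simp add: ennreal_mult' [symmetric] eq)
  also have "\<dots> = ennreal (exp (\<mu>\<^sup>2 / 2)) * (\<integral>\<^sup>+ y. ennreal (normal_density \<mu> 1 y) \<partial>lborel)"
    by (subst nn_integral_cmult) auto
  also have "(\<integral>\<^sup>+ y. ennreal (normal_density \<mu> 1 y) \<partial>lborel) = 1"
    by (subst nn_integral_eq_integral) auto
  finally show ?thesis by simp
qed

text \<open>Ville's inequality for the supermartingale
  \<open>exp (\<mu> * (x + s * S\<^sub>r) - \<mu>\<^sup>2 * r / 2)\<close>, by conditioning on the first coordinate.\<close>

lemma std_gauss_line_crossing:
  fixes \<mu> s a x :: real
  assumes "\<mu> \<ge> 0" and s: "s\<^sup>2 = 1"
  shows "(\<integral>\<^sup>+ z. (if \<exists>r\<le>m. a \<le> x + s * (\<Sum>j<r. z (p + j)) - \<mu> * real r / 2 then 1 else 0) \<partial>std_gauss {p..<p + m})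
           \<le> ennreal (exp (\<mu> * (x - a)))"
proof (induction m arbitrary: p x)
  case 0
  interpret prob_space "std_gauss {p..<p+0}" by (rule prob_space_std_gauss)
  show ?case
  proof (cases "a \<le> x")
    case True
    have "emeasure (std_gauss {}) (space (std_gauss ({}::nat set))) = 1"
      using prob_space.emeasure_space_1 [OF prob_space_std_gauss] .
    then show ?thesis using True assms by simp
  qed simp
next
  case (Suc m)
  interpret PS: product_prob_space "\<lambda>_::nat. density lborel std_normal_density"
    by (rule product_prob_space_std_normal)
  interpret P: prob_space "std_gauss {p..<p + Suc m}" by (rule prob_space_std_gauss)
  let ?f = "\<lambda>z. (if \<exists>r\<le>Suc m. a \<le> x + s * (\<Sum>j<r. z (p + j)) - \<mu> * real r / 2 then 1 else (0::ennreal))"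
  show ?case
  proof (cases "a \<le> x")
    case True
    have "(\<integral>\<^sup>+ z. ?f z \<partial>std_gauss {p..<p + Suc m}) \<le> (\<integral>\<^sup>+ z. 1 \<partial>std_gauss {p..<p + Suc m})"
      by (intro nn_integral_mono) auto
    also have "\<dots> = 1" using P.emeasure_space_1 by (subst nn_integral_const) simp
    also have "\<dots> \<le> ennreal (exp (\<mu> * (x - a)))" using assms True by simp
    finally show ?thesis .
  next
    case False
    have ins: "{p..<p + Suc m} = insert p {Suc p..<Suc p + m}" by auto
    have meas: "?f \<in> borel_measurable (std_gauss {p..<p + Suc m})" by measurable
    \<comment> \<open>Once the first coordinate is fixed, what is left is the same crossing problem
      started at \<open>x + s * y - \<mu> / 2\<close>; hence the induction over all \<open>p\<close>
      and \<open>x\<close>. The time \<open>r = 0\<close> drops out because here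
      \<open>x < a\<close>.\<close>
    have step: "?f (z(p := y)) = (if \<exists>r\<le>m. a \<le> (x + s * y - \<mu> / 2) + s * (\<Sum>j<r. z (Suc p + j)) - \<mu> * real r / 2 then 1 else 0)"
      for z y
    proof -
      have sum: "(\<Sum>j<Suc r. (z(p := y)) (p + j)) = y + (\<Sum>j<r. z (Suc p + j))" for r
        by (subst sum.lessThan_Suc_shift) simp
      have "(\<exists>r\<le>Suc m. a \<le> x + s * (\<Sum>j<r. (z(p := y)) (p + j)) - \<mu> * real r / 2)
         \<longleftrightarrow> (\<exists>r\<le>m. a \<le> x + s * (\<Sum>j<Suc r. (z(p := y)) (p + j)) - \<mu> * real (Suc r) / 2)"
      proof
        assume "\<exists>r\<le>Suc m. a \<le> x + s * (\<Sum>j<r. (z(p := y)) (p + j)) - \<mu> * real r / 2"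
        then obtain r where r: "r \<le> Suc m" "a \<le> x + s * (\<Sum>j<r. (z(p := y)) (p + j)) - \<mu> * real r / 2" by blast
        then obtain r' where "r = Suc r'" using False by (cases r) auto
        then show "\<exists>r\<le>m. a \<le> x + s * (\<Sum>j<Suc r. (z(p := y)) (p + j)) - \<mu> * real (Suc r) / 2"
          using r by blast
      next
        assume "\<exists>r\<le>m. a \<le> x + s * (\<Sum>j<Suc r. (z(p := y)) (p + j)) - \<mu> * real (Suc r) / 2"
        then show "\<exists>r\<le>Suc m. a \<le> x + s * (\<Sum>j<r. (z(p := y)) (p + j)) - \<mu> * real r / 2"
          by (meson Suc_le_mono)
      qed
      also have "\<dots> \<longleftrightarrow> (\<exists>r\<le>m. a \<le> (x + s * y - \<mu> / 2) + s * (\<Sum>j<r. z (Suc p + j)) - \<mu> * real r / 2)"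
        unfolding sum by (simp add: algebra_simps add_divide_distrib)
      finally show ?thesis by simp
    qed
    have "(\<integral>\<^sup>+ z. ?f z \<partial>std_gauss {p..<p + Suc m})
        = (\<integral>\<^sup>+ y. (\<integral>\<^sup>+ z. ?f (z(p := y)) \<partial>std_gauss {Suc p..<Suc p + m}) \<partial>density lborel std_normal_density)"
      unfolding std_gauss_def ins
      by (rule PS.product_nn_integral_insert_rev) (use meas in \<open>auto simp only: std_gauss_def ins finite_atLeastLessThan atLeastLessThan_iff\<close>)
    also have "\<dots> \<le> (\<integral>\<^sup>+ y. ennreal (exp (\<mu> * (x + s * y - \<mu> / 2 - a))) \<partial>density lborel std_normal_density)"
      unfolding step by (intro nn_integral_mono Suc.IH)
    also have "\<dots> = (\<integral>\<^sup>+ y. ennreal (exp (\<mu> * (x - a) - \<mu>\<^sup>2 / 2)) * ennreal (exp ((\<mu> * s) * y)) \<partial>density lborel std_normal_density)"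
    proof (intro nn_integral_cong)
      fix y
      have "\<mu> * (x + s * y - \<mu> / 2 - a) = (\<mu> * (x - a) - \<mu>\<^sup>2 / 2) + (\<mu> * s) * y"
        by (simp add: algebra_simps power2_eq_square)
      then show "ennreal (exp (\<mu> * (x + s * y - \<mu> / 2 - a)))
        = ennreal (exp (\<mu> * (x - a) - \<mu>\<^sup>2 / 2)) * ennreal (exp ((\<mu> * s) * y))"
        by (simp only: exp_add ennreal_mult' [symmetric] exp_ge_zero)
    qed
    also have "\<dots> = ennreal (exp (\<mu> * (x - a) - \<mu>\<^sup>2 / 2)) * ennreal (exp ((\<mu> * s)\<^sup>2 / 2))"
      by (subst nn_integral_cmult) (auto simp: nn_integral_std_normal_exp)
    also have "\<dots> = ennreal (exp (\<mu> * (x - a)))"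
      using s by (simp add: ennreal_mult' [symmetric] power_mult_distrib flip: exp_add)
    finally show ?thesis .
  qed
qed

section \<open>Exponential moments of maximal squared partial sums\<close>

definition wmax :: "nat \<Rightarrow> (nat \<Rightarrow> real) \<Rightarrow> real" where
  "wmax m g = Max ((\<lambda>r. (\<Sum>j<r. g j)\<^sup>2) ` {..m}) / real m"

text \<open>Sum of the geometric series with terms
  \<open>2 * exp ((j + 1) / 4) * exp (- j / 2)\<close>, obtained by integrating
  \<open>exp (t / 4)\<close> against the tail \<open>2 * exp (- t / 2)\<close> at integer
  levels.\<close>

definition wmax_const :: real where
  "wmax_const = 2 * exp (1/4) / (1 - exp (- (1/4)))"

lemma wmax_const_ge_1: "wmax_const \<ge> 1"
proof -
  have "1 - exp (- (1/4::real)) \<le> 1" "0 < 1 - exp (- (1/4::real))" "exp (1/4::real) \<ge> 1" by auto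
  then have "1 * (1 - exp (- (1/4::real))) \<le> 2 * exp (1/4)"
    by (smt (verit, best))
  with \<open>0 < 1 - exp (- (1/4::real))\<close> show ?thesis unfolding wmax_const_def
    by (simp only: le_divide_eq if_True)
qed

lemma wmax_cong: "(\<And>j. j < m \<Longrightarrow> g j = h j) \<Longrightarrow> wmax m g = wmax m h"
proof -
  assume a: "\<And>j. j < m \<Longrightarrow> g j = h j"
  have "(\<lambda>r. (\<Sum>j<r. g j)\<^sup>2) ` {..m} = (\<lambda>r. (\<Sum>j<r. h j)\<^sup>2) ` {..m}"
  proof (rule image_cong [OF refl])
    fix r assume "r \<in> {..m}"
    then have "(\<Sum>j<r. g j) = (\<Sum>j<r. h j)" by (intro sum.cong) (auto intro: a)
    then show "(\<Sum>j<r. g j)\<^sup>2 = (\<Sum>j<r. h j)\<^sup>2" by simp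
  qed
  then show ?thesis unfolding wmax_def by simp
qed

lemma wmax_ge: "r \<le> m \<Longrightarrow> (\<Sum>j<r. g j)\<^sup>2 / real m \<le> wmax m g"
  unfolding wmax_def by (intro divide_right_mono Max_ge) auto

lemma wmax_nonneg: "0 \<le> wmax m g"
  using wmax_ge [of 0 m g] by simp

lemma wmax_attained: "\<exists>r\<le>m. wmax m g = (\<Sum>j<r. g j)\<^sup>2 / real m"
proof -
  have "Max ((\<lambda>r. (\<Sum>j<r. g j)\<^sup>2) ` {..m}) \<in> (\<lambda>r. (\<Sum>j<r. g j)\<^sup>2) ` {..m}"
    by (intro Max_in) auto
  then obtain r where "r \<le> m" "Max ((\<lambda>r. (\<Sum>j<r. g j)\<^sup>2) ` {..m}) = (\<Sum>j<r. g j)\<^sup>2" by blast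
  then show ?thesis unfolding wmax_def by (intro exI [of _ r]) simp
qed

lemma measurable_wmax_std_gauss [measurable]: "(\<lambda>z. wmax m (\<lambda>j. z (f j))) \<in> borel_measurable (std_gauss I)"
  unfolding wmax_def by measurable

lemma std_gauss_wmax_tail:
  assumes "m \<ge> 1" "t \<ge> 0"
  shows "(\<integral>\<^sup>+ z. (if t \<le> wmax m z then 1 else 0) \<partial>std_gauss {..<m}) \<le> ennreal (2 * exp (- t / 2))"
proof -
  \<comment> \<open>If some \<open>\<bar>S_r\<bar>\<close> with \<open>r \<le> m\<close> reaches
    \<open>sqrt (t * m) = 2 * a\<close>, then \<open>S_r\<close> or \<open>- S_r\<close> crosses the
    line of intercept \<open>a\<close> and slope \<open>\<mu> / 2\<close>, which is still at most
    \<open>2 * a\<close> at time \<open>m\<close>. The two parameters balance so that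
    \<open>\<mu> * a = t / 2\<close>.\<close>
  define \<mu> where "\<mu> = sqrt t / sqrt m"
  define a where "a = sqrt t * sqrt m / 2"
  let ?g = "\<lambda>s z. (if \<exists>r\<le>m. a \<le> 0 + s * (\<Sum>j<r. z (0 + j)) - \<mu> * real r / 2 then 1 else (0::ennreal))"
  have m: "real m > 0" using assms by simp
  have mu: "\<mu> \<ge> 0" using assms by (simp add: \<mu>_def)
  have mua: "\<mu> * (0 - a) = - t / 2" using assms m by (simp add: \<mu>_def a_def)
  have mum: "\<mu> * real r / 2 \<le> a" if "r \<le> m" for r
  proof -
    have "\<mu> * real r \<le> \<mu> * real m" using mu that by (intro mult_left_mono) auto
    also have "\<dots> = sqrt t * (sqrt m * sqrt m) / sqrt m" using assms by (simp add: \<mu>_def)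
    also have "\<dots> = 2 * a" using m unfolding a_def by (simp del: real_sqrt_mult_self)
    finally show ?thesis by simp
  qed
  have "(if t \<le> wmax m z then 1 else 0) \<le> ?g 1 z + ?g (-1) z" for z
  proof (cases "t \<le> wmax m z")
    case True
    then obtain r where r: "r \<le> m" "t \<le> (\<Sum>j<r. z j)\<^sup>2 / real m" using wmax_attained [of m z] by auto
    then have "t * m \<le> (\<Sum>j<r. z j)\<^sup>2" using m by (simp add: field_simps)
    then have "sqrt t * sqrt m \<le> \<bar>\<Sum>j<r. z j\<bar>"
      by (metis real_sqrt_abs real_sqrt_le_iff real_sqrt_mult)
    then have "2 * a \<le> \<bar>\<Sum>j<r. z j\<bar>" by (simp add: a_def)
    then have "a \<le> (\<Sum>j<r. z j) - \<mu> * real r / 2 \<or> a \<le> - (\<Sum>j<r. z j) - \<mu> * real r / 2"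
      using mum [OF r(1)] by linarith
    then show ?thesis
    proof
      assume "a \<le> (\<Sum>j<r. z j) - \<mu> * real r / 2"
      then have "?g 1 z = 1" using r(1) by auto
      then show ?thesis using True by simp
    next
      assume "a \<le> - (\<Sum>j<r. z j) - \<mu> * real r / 2"
      then have "?g (-1) z = 1" using r(1) by auto
      then show ?thesis using True by simp
    qed
  qed simp
  then have "(\<integral>\<^sup>+ z. (if t \<le> wmax m z then 1 else 0) \<partial>std_gauss {..<m}) \<le> (\<integral>\<^sup>+ z. ?g 1 z + ?g (-1) z \<partial>std_gauss {..<m})"
    by (intro nn_integral_mono)
  also have "\<dots> = (\<integral>\<^sup>+ z. ?g 1 z \<partial>std_gauss {..<m}) + (\<integral>\<^sup>+ z. ?g (-1) z \<partial>std_gauss {..<m})"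
    by (intro nn_integral_add) measurable
  also have "\<dots> \<le> ennreal (exp (- t / 2)) + ennreal (exp (- t / 2))"
    using std_gauss_line_crossing [OF mu, where s = 1 and a = a and x = 0 and p = 0 and m = m] std_gauss_line_crossing [OF mu, where s = "-1" and a = a and x = 0 and p = 0 and m = m]
    unfolding mua by (intro add_mono) (auto simp: atLeast0LessThan)
  also have "\<dots> = ennreal (2 * exp (- t / 2))" by (simp flip: ennreal_plus)
  finally show ?thesis .
qed

lemma std_gauss_exp_wmax_initial:
  assumes "m \<ge> 1"
  shows "(\<integral>\<^sup>+ z. ennreal (exp (wmax m z / 4)) \<partial>std_gauss {..<m}) \<le> ennreal wmax_const"
proof -
  let ?h = "\<lambda>j z. ennreal (exp ((real j + 1) / 4)) * (if real j \<le> wmax m z then 1 else 0)"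
  have meas: "(\<lambda>z. wmax m z) \<in> borel_measurable (std_gauss {..<m})"
    using measurable_wmax_std_gauss [of m "\<lambda>j. j"] by simp
  note [measurable] = meas
  have pt: "ennreal (exp (wmax m z / 4)) \<le> (\<Sum>j. ?h j z)" for z
  proof -
    define j where "j = nat \<lfloor>wmax m z\<rfloor>"
    have j: "real j \<le> wmax m z" "wmax m z \<le> real j + 1"
      using wmax_nonneg [of m z] unfolding j_def by linarith+
    then have "ennreal (exp (wmax m z / 4)) \<le> ?h j z" by (auto intro: ennreal_leI)
    also have "\<dots> = (\<Sum>j\<in>{j}. ?h j z)" by simp
    also have "\<dots> \<le> (\<Sum>j. ?h j z)" by (intro sum_le_suminf) auto
    finally show ?thesis .
  qed
  have rearr: "exp ((real j + 1) / 4) * (2 * exp (- real j / 2)) = 2 * exp (1/4) * exp (- (1/4)) ^ j" for j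
    by (simp add: exp_of_nat_mult [symmetric] exp_add [symmetric] field_simps)
  have sm: "summable (\<lambda>j. exp (- (1/4::real)) ^ j)" by (intro summable_geometric) auto
  have "(\<integral>\<^sup>+ z. ennreal (exp (wmax m z / 4)) \<partial>std_gauss {..<m}) \<le> (\<integral>\<^sup>+ z. (\<Sum>j. ?h j z) \<partial>std_gauss {..<m})"
    by (intro nn_integral_mono pt)
  also have "\<dots> = (\<Sum>j. \<integral>\<^sup>+ z. ?h j z \<partial>std_gauss {..<m})"
    by (intro nn_integral_suminf) measurable
  also have "\<dots> \<le> (\<Sum>j. ennreal (2 * exp (1/4) * exp (- (1/4)) ^ j))"
  proof (intro suminf_le)
    fix j
    have "(\<integral>\<^sup>+ z. ?h j z \<partial>std_gauss {..<m}) = ennreal (exp ((real j + 1) / 4)) * (\<integral>\<^sup>+ z. (if real j \<le> wmax m z then 1 else 0) \<partial>std_gauss {..<m})"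
      by (intro nn_integral_cmult) measurable
    also have "\<dots> \<le> ennreal (exp ((real j + 1) / 4)) * ennreal (2 * exp (- real j / 2))"
      by (intro mult_left_mono std_gauss_wmax_tail assms) auto
    also have "\<dots> = ennreal (2 * exp (1/4) * exp (- (1/4)) ^ j)"
      by (simp only: ennreal_mult' [symmetric] rearr exp_ge_zero)
    finally show "(\<integral>\<^sup>+ z. ?h j z \<partial>std_gauss {..<m}) \<le> ennreal (2 * exp (1/4) * exp (- (1/4)) ^ j)" .
  qed auto
  also have "\<dots> = ennreal (\<Sum>j. 2 * exp (1/4) * exp (- (1/4)) ^ j)"
    by (intro suminf_ennreal2 summable_mult sm) auto
  also have "(\<Sum>j. 2 * exp (1/4) * exp (- (1/4::real)) ^ j) = wmax_const"
    by (subst suminf_mult [OF sm], subst suminf_geometric) (auto simp: wmax_const_def)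
  finally show ?thesis .
qed

text \<open>An injective reindexing preserves the law, so the estimate serves partial sums that
  start anywhere and run forwards or backwards.\<close>

lemma std_gauss_exp_wmax:
  assumes "m \<ge> 1" and f: "inj_on f {..<m}" "f ` {..<m} \<subseteq> I"
  shows "(\<integral>\<^sup>+ z. ennreal (exp (wmax m (\<lambda>j. z (f j)) / 4)) \<partial>std_gauss I) \<le> ennreal wmax_const"
proof -
  have D: "distr (std_gauss I) (std_gauss {..<m}) (\<lambda>z. \<lambda>j\<in>{..<m}. z (f j)) = std_gauss {..<m}"
    unfolding std_gauss_def by (rule distr_PiM_reindex) (use f prob_space_std_normal in auto)
  have meas: "(\<lambda>z. \<lambda>j\<in>{..<m}. z (f j)) \<in> measurable (std_gauss I) (std_gauss {..<m})"
    unfolding std_gauss_def by (intro measurable_restrict measurable_component_singleton) (use f in auto)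
  have "(\<lambda>z. wmax m z) \<in> borel_measurable (std_gauss {..<m})"
    using measurable_wmax_std_gauss [of m "\<lambda>j. j"] by simp
  note [measurable] = this
  have "(\<integral>\<^sup>+ z. ennreal (exp (wmax m (\<lambda>j. z (f j)) / 4)) \<partial>std_gauss I)
      = (\<integral>\<^sup>+ z. ennreal (exp (wmax m (\<lambda>j\<in>{..<m}. z (f j)) / 4)) \<partial>std_gauss I)"
    by (intro nn_integral_cong arg_cong [where f = ennreal] arg_cong [where f = exp]
          arg_cong [where f = "\<lambda>x. x / 4"] wmax_cong) auto
  also have "\<dots> = (\<integral>\<^sup>+ z. ennreal (exp (wmax m z / 4)) \<partial>distr (std_gauss I) (std_gauss {..<m}) (\<lambda>z. \<lambda>j\<in>{..<m}. z (f j)))"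
    by (rule nn_integral_distr [symmetric, OF meas]) measurable
  also have "\<dots> \<le> ennreal wmax_const" unfolding D by (rule std_gauss_exp_wmax_initial [OF assms(1)])
  finally show ?thesis .
qed

section \<open>Independence over disjoint blocks, and standardisation of the model\<close>

lemma std_gauss_indep_vars:
  assumes "I \<noteq> {}"
  shows "prob_space.indep_vars (std_gauss I) (\<lambda>_. borel) (\<lambda>i z. z i) I"
proof -
  interpret prob_space "std_gauss I" by (rule prob_space_std_gauss)
  have "distr (std_gauss I) (PiM I (\<lambda>_. borel)) (\<lambda>z. \<lambda>i\<in>I. z i) = distr (std_gauss I) (std_gauss I) (\<lambda>z. z)"
    by (intro distr_cong) (auto simp: sets_std_gauss, auto simp: std_gauss_def space_PiM PiE_def extensional_restrict)
  also have "\<dots> = std_gauss I" by (simp add: distr_id)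
  also have "\<dots> = (\<Pi>\<^sub>M i\<in>I. distr (std_gauss I) borel (\<lambda>z. z i))"
    unfolding std_gauss_def
  proof (rule PiM_cong [OF refl])
    fix i assume i: "i \<in> I"
    have "distr (Pi\<^sub>M I (\<lambda>_. density lborel std_normal_density)) borel (\<lambda>z. z i)
        = distr (Pi\<^sub>M I (\<lambda>_. density lborel std_normal_density)) (density lborel std_normal_density) (\<lambda>z. z i)"
      by (intro distr_cong) auto
    also have "\<dots> = density lborel std_normal_density"
      by (rule distr_PiM_component) (use i prob_space_std_normal in auto)
    finally show "density lborel std_normal_density
      = distr (Pi\<^sub>M I (\<lambda>_. density lborel std_normal_density)) borel (\<lambda>z. z i)" ..
  qed
  finally show ?thesis
    by (subst indep_vars_iff_distr_eq_PiM' [OF assms]) measurable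
qed

lemma prod_mono_ennreal:
  fixes f g :: "'a \<Rightarrow> ennreal"
  assumes "\<And>j. j \<in> J \<Longrightarrow> f j \<le> g j"
  shows "(\<Prod>j\<in>J. f j) \<le> (\<Prod>j\<in>J. g j)"
  using assms by (induction J rule: infinite_finite_induct) (auto intro!: mult_mono)

text \<open>Maxima over disjoint index blocks are independent, so their exponential moments
  multiply. This is what makes the union bound over modes affordable.\<close>

lemma std_gauss_exp_sum_wmax:
  assumes J: "finite J" and m: "\<And>j. j \<in> J \<Longrightarrow> m j \<ge> 1"
    and inj: "\<And>j. j \<in> J \<Longrightarrow> inj_on (f j) {..<m j}"
    and sub: "\<And>j. j \<in> J \<Longrightarrow> f j ` {..<m j} \<subseteq> I"
    and disj: "disjoint_family_on (\<lambda>j. f j ` {..<m j}) J" and I: "I \<noteq> {}"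
  shows "(\<integral>\<^sup>+ z. ennreal (exp ((\<Sum>j\<in>J. wmax (m j) (\<lambda>t. z (f j t))) / 4)) \<partial>std_gauss I) \<le> ennreal (wmax_const ^ card J)"
proof -
  interpret prob_space "std_gauss I" by (rule prob_space_std_gauss)
  let ?K = "\<lambda>j. f j ` {..<m j}"
  let ?Y = "\<lambda>j z. ennreal (exp (wmax (m j) (\<lambda>t. z (f j t)) / 4))"
  have "indep_vars (\<lambda>j. PiM (?K j) (\<lambda>_. borel)) (\<lambda>j z. restrict (\<lambda>i. z i) (?K j)) J"
    by (rule indep_vars_restrict [OF std_gauss_indep_vars [OF I]]) (use sub disj in auto)
  then have "indep_vars (\<lambda>_. borel) (\<lambda>j z. ?Y j (restrict (\<lambda>i. z i) (?K j))) J"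
  proof (rule indep_vars_compose2)
    fix j
    have "?Y j \<in> borel_measurable (std_gauss (?K j))" by measurable
    then show "?Y j \<in> borel_measurable (PiM (?K j) (\<lambda>_. borel))"
      using measurable_cong_sets [OF sets_std_gauss refl] by blast
  qed
  moreover have "?Y j (restrict (\<lambda>i. z i) (?K j)) = ?Y j z" for j z
    by (intro arg_cong [where f = ennreal] arg_cong [where f = exp]
          arg_cong [where f = "\<lambda>x. x / 4"] wmax_cong) auto
  ultimately have ind: "indep_vars (\<lambda>_. borel) ?Y J" by simp
  have "(\<integral>\<^sup>+ z. ennreal (exp ((\<Sum>j\<in>J. wmax (m j) (\<lambda>t. z (f j t))) / 4)) \<partial>std_gauss I)
      = (\<integral>\<^sup>+ z. (\<Prod>j\<in>J. ?Y j z) \<partial>std_gauss I)"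
    using J by (intro nn_integral_cong) (simp add: prod_ennreal exp_sum sum_divide_distrib)
  also have "\<dots> = (\<Prod>j\<in>J. \<integral>\<^sup>+ z. ?Y j z \<partial>std_gauss I)"
    by (rule indep_vars_nn_integral [OF J ind]) auto
  also have "\<dots> \<le> (\<Prod>j\<in>J. ennreal wmax_const)"
    by (intro prod_mono_ennreal std_gauss_exp_wmax m inj sub)
  also have "\<dots> = ennreal (wmax_const ^ card J)"
    using wmax_const_ge_1 by (simp add: ennreal_power)
  finally show ?thesis .
qed

lemma gauss_model_standardise:
  assumes "\<sigma> > 0" "n \<ge> 1"
  shows "distr (gauss_model n \<sigma> \<theta>) (PiM {1..n} (\<lambda>_. borel)) (\<lambda>x. \<lambda>i\<in>{1..n}. (x i - \<theta> i) / \<sigma>) = std_gauss {1..n}"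
proof -
  define P where "P = gauss_model n \<sigma> \<theta>"
  define N where "N = (\<lambda>i. density lborel (normal_density (\<theta> i) \<sigma>))"
  have P_eq: "P = PiM {1..n} N" by (simp add: P_def gauss_model_def N_def)
  have psN: "prob_space (N i)" for i
    unfolding N_def by (rule prob_space_normal_density) (use assms in auto)
  interpret prob_space P unfolding P_eq by (intro prob_space_PiM psN)
  have comp: "(\<lambda>x. x i) \<in> borel_measurable P" if "i \<in> {1..n}" for i
  proof -
    have "(\<lambda>x. x i) \<in> measurable P (N i)" unfolding P_eq using that by (rule measurable_component_singleton)
    then show ?thesis by (simp add: N_def)
  qed
  have marg: "distr P borel (\<lambda>x. x i) = N i" if "i \<in> {1..n}" for i
  proof -
    have "distr P borel (\<lambda>x. x i) = distr P (N i) (\<lambda>x. x i)"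
      by (intro distr_cong) (auto simp: N_def)
    also have "\<dots> = N i" unfolding P_eq by (rule distr_PiM_component) (use that psN in auto)
    finally show ?thesis .
  qed
  have ind: "indep_vars (\<lambda>_. borel) (\<lambda>i x. x i) {1..n}"
  proof (subst indep_vars_iff_distr_eq_PiM')
    have "distr P (PiM {1..n} (\<lambda>_. borel)) (\<lambda>z. \<lambda>i\<in>{1..n}. z i) = distr P P (\<lambda>z. z)"
      by (intro distr_cong) (auto simp: P_eq N_def space_PiM PiE_def extensional_restrict intro!: sets_PiM_cong)
    also have "\<dots> = PiM {1..n} N" by (simp add: distr_id P_eq)
    also have "\<dots> = PiM {1..n} (\<lambda>i. distr P borel (\<lambda>x. x i))"
      by (intro PiM_cong) (auto simp: marg)
    finally show "distr P (PiM {1..n} (\<lambda>_. borel)) (\<lambda>z. \<lambda>i\<in>{1..n}. z i) = PiM {1..n} (\<lambda>i. distr P borel (\<lambda>x. x i))" .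
  qed (use assms comp in auto)
  have ind2: "indep_vars (\<lambda>_. borel) (\<lambda>i x. (x i - \<theta> i) / \<sigma>) {1..n}"
    by (rule indep_vars_compose2 [OF ind, where Y = "\<lambda>i y. (y - \<theta> i) / \<sigma>"]) auto
  have marg2: "distr P borel (\<lambda>x. (x i - \<theta> i) / \<sigma>) = density lborel std_normal_density" if i: "i \<in> {1..n}" for i
  proof -
    have lb: "distr P lborel X = distr P borel X" for X :: "(nat \<Rightarrow> real) \<Rightarrow> real"
      by (intro distr_cong) auto
    have "distributed P lborel (\<lambda>x. x i) (normal_density (\<theta> i) \<sigma>)"
      unfolding distributed_def using comp [OF i] marg [OF i]
      by (simp add: N_def lb)
    then have "distributed P lborel (\<lambda>x. (x i - \<theta> i) / \<sigma>) std_normal_density"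
      by (rule normal_standard_normal_convert [OF assms(1), THEN iffD1])
    then show ?thesis
      unfolding distributed_def by (simp add: lb)
  qed
  have "distr P (PiM {1..n} (\<lambda>_. borel)) (\<lambda>x. \<lambda>i\<in>{1..n}. (x i - \<theta> i) / \<sigma>)
      = PiM {1..n} (\<lambda>i. distr P borel (\<lambda>x. (x i - \<theta> i) / \<sigma>))"
    using ind2 assms comp by (subst (asm) indep_vars_iff_distr_eq_PiM') auto
  also have "\<dots> = std_gauss {1..n}"
    unfolding std_gauss_def by (intro PiM_cong) (auto simp: marg2)
  finally show ?thesis unfolding P_def .
qed

section \<open>Inner products with decreasing sequences\<close>

lemma sum_lessThan_add: "(\<Sum>i<a + m. f i) = (\<Sum>i<a. f i) + (\<Sum>t<m. f (a + t))"
  for f :: "nat \<Rightarrow> 'a::comm_monoid_add"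
  by (induction m) (auto simp: add.assoc)

lemma summation_by_parts:
  fixes g u :: "nat \<Rightarrow> real"
  shows "(\<Sum>j<N. g j * u j) = (\<Sum>r<N. (\<Sum>j<Suc r. g j) * (u r - u (Suc r))) + (\<Sum>j<N. g j) * u N"
  by (induction N) (auto simp: algebra_simps)

lemma decseq_zero_nonneg:
  fixes u :: "nat \<Rightarrow> real"
  assumes "decseq u" "\<And>r. r \<ge> N \<Longrightarrow> u r = 0"
  shows "0 \<le> u r"
  using decseqD [OF assms(1), of r "max r N"] assms(2) [of "max r N"] by simp

text \<open>For decreasing \<open>u \<ge> 0\<close> one has \<open>(u r - u (r+1))\<^sup>2 \<le> (u r)\<^sup>2 - (u (r+1))\<^sup>2\<close>, which telescopes.\<close>

lemma weighted_increments_le: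
  fixes u :: "nat \<Rightarrow> real"
  assumes u: "decseq u" "\<And>r. r \<ge> N \<Longrightarrow> u r = 0"
  shows "(\<Sum>r<N. real (Suc r) * (u r - u (Suc r))\<^sup>2) \<le> (\<Sum>r<N. (u r)\<^sup>2)"
proof -
  have tel: "(\<Sum>r<M. real (Suc r) * ((u r)\<^sup>2 - (u (Suc r))\<^sup>2)) = (\<Sum>r<M. (u r)\<^sup>2) - real M * (u M)\<^sup>2" for M
    by (induction M) (auto simp: algebra_simps)
  have "(u r - u (Suc r))\<^sup>2 \<le> (u r)\<^sup>2 - (u (Suc r))\<^sup>2" for r
  proof -
    have "0 \<le> u (Suc r)" "u (Suc r) \<le> u r"
      using decseq_zero_nonneg [OF u] decseqD [OF u(1), of r "Suc r"] by auto
    then have "0 \<le> 2 * u (Suc r) * (u r - u (Suc r))" by simp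
    then show ?thesis by (simp add: power2_eq_square algebra_simps)
  qed
  then have "(\<Sum>r<N. real (Suc r) * (u r - u (Suc r))\<^sup>2) \<le> (\<Sum>r<N. real (Suc r) * ((u r)\<^sup>2 - (u (Suc r))\<^sup>2))"
    by (intro sum_mono mult_left_mono) auto
  also have "\<dots> = (\<Sum>r<N. (u r)\<^sup>2)" unfolding tel using u(2) [of N] by simp
  finally show ?thesis .
qed

text \<open>Cauchy-Schwarz over those \<open>r\<close> only at which the increment is nonzero. Since
  \<open>u\<close> vanishes from \<open>N\<close> on, a final drop to zero counts as a jump
  too.\<close>

lemma decreasing_inner_le_jumps:
  fixes g u :: "nat \<Rightarrow> real"
  assumes u: "decseq u" "\<And>r. r \<ge> N \<Longrightarrow> u r = 0"
    and S: "\<And>r. r \<le> N \<Longrightarrow> (\<Sum>j<r. g j)\<^sup>2 \<le> real r * L" and L: "L \<ge> 0"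
  shows "(\<Sum>j<N. g j * u j)\<^sup>2 \<le> real (card {r. r < N \<and> u r \<noteq> u (Suc r)}) * L * (\<Sum>j<N. (u j)\<^sup>2)"
proof -
  define D where "D = {r. r < N \<and> u r \<noteq> u (Suc r)}"
  define x where "x = (\<lambda>r. (\<Sum>j<Suc r. g j) * (u r - u (Suc r)))"
  have D: "D \<subseteq> {..<N}" "finite D" by (auto simp: D_def)
  have "(\<Sum>j<N. g j * u j) = (\<Sum>r<N. x r)"
    using u(2) [of N] unfolding x_def by (subst summation_by_parts) simp
  also have "\<dots> = (\<Sum>r\<in>D. x r)"
    by (rule sum.mono_neutral_right) (auto simp: D_def x_def)
  finally have "(\<Sum>j<N. g j * u j)\<^sup>2 = (\<Sum>r\<in>D. x r)\<^sup>2" by simp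
  also have "\<dots> \<le> (\<Sum>r\<in>D. (x r)\<^sup>2) * real (card D)"
    by (rule sum_squared_le_sum_of_squares)
  also have "(\<Sum>r\<in>D. (x r)\<^sup>2) \<le> (\<Sum>r\<in>D. L * (real (Suc r) * (u r - u (Suc r))\<^sup>2))"
  proof (rule sum_mono)
    fix r assume "r \<in> D"
    then have "Suc r \<le> N" by (auto simp: D_def)
    from mult_right_mono [OF S [OF this], of "(u r - u (Suc r))\<^sup>2"]
    show "(x r)\<^sup>2 \<le> L * (real (Suc r) * (u r - u (Suc r))\<^sup>2)"
      by (simp add: x_def power_mult_distrib mult_ac)
  qed
  also have "\<dots> = L * (\<Sum>r\<in>D. real (Suc r) * (u r - u (Suc r))\<^sup>2)" by (simp add: sum_distrib_left)
  also have "\<dots> \<le> L * (\<Sum>r<N. real (Suc r) * (u r - u (Suc r))\<^sup>2)"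
    using D L by (intro mult_left_mono sum_mono2) auto
  also have "\<dots> \<le> L * (\<Sum>r<N. (u r)\<^sup>2)"
    using L by (intro mult_left_mono weighted_increments_le [OF u])
  finally show ?thesis unfolding D_def by (simp add: mult_right_mono mult_ac)
qed

lemma sum_inverse_le_ln: "N \<ge> 1 \<Longrightarrow> (\<Sum>r<N. 1 / real (Suc r)) \<le> 1 + ln (real N)"
proof (induction N)
  case (Suc N)
  show ?case
  proof (cases "N = 0")
    case False
    have "1 / real (Suc N) \<le> ln (real (Suc N)) - ln (real N)"
    proof -
      have "ln (real N / real (Suc N)) \<le> real N / real (Suc N) - 1"
        using False by (intro ln_le_minus_one) auto
      also have "\<dots> = - (1 / real (Suc N))" by (simp add: field_simps)
      finally show ?thesis using False by (subst (asm) ln_div) auto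
    qed
    then show ?thesis using Suc False by simp
  qed simp
qed simp

text \<open>A bound that does not count jumps. Inserting
  \<open>\<bar>S_r\<bar> \<le> sqrt (r * L)\<close> and summing by parts back puts the difference on
  the square roots, at most \<open>1 / sqrt (r + 1)\<close>; Cauchy-Schwarz then leaves a harmonic
  sum. It is the bound used for the random excess, whose coefficient must not depend on the
  fit.\<close>

lemma decreasing_inner_le_log:
  fixes g u :: "nat \<Rightarrow> real"
  assumes u: "decseq u" "\<And>r. r \<ge> N \<Longrightarrow> u r = 0" and N: "N \<ge> 1"
    and S: "\<And>r. r \<le> N \<Longrightarrow> (\<Sum>j<r. g j)\<^sup>2 \<le> real r * L" and L: "L \<ge> 0"
  shows "(\<Sum>j<N. g j * u j)\<^sup>2 \<le> (1 + ln (real N)) * L * (\<Sum>j<N. (u j)\<^sup>2)"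
proof -
  have u0: "0 \<le> u r" for r by (rule decseq_zero_nonneg [OF u])
  have absS: "\<bar>\<Sum>j<r. g j\<bar> \<le> sqrt (real r) * sqrt L" if "r \<le> N" for r
    using real_sqrt_le_mono [OF S [OF that]] by (simp add: real_sqrt_mult)
  have "\<bar>\<Sum>j<N. g j * u j\<bar> = \<bar>\<Sum>r<N. (\<Sum>j<Suc r. g j) * (u r - u (Suc r))\<bar>"
    using u(2) [of N] by (subst summation_by_parts) simp
  also have "\<dots> \<le> (\<Sum>r<N. \<bar>\<Sum>j<Suc r. g j\<bar> * (u r - u (Suc r)))"
  proof (rule order_trans [OF sum_abs], rule sum_mono)
    fix r
    have "u r - u (Suc r) \<ge> 0" using decseqD [OF u(1), of r "Suc r"] by simp
    then show "\<bar>(\<Sum>j<Suc r. g j) * (u r - u (Suc r))\<bar> \<le> \<bar>\<Sum>j<Suc r. g j\<bar> * (u r - u (Suc r))"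
      by (simp only: abs_mult abs_of_nonneg)
  qed
  also have "\<dots> \<le> (\<Sum>r<N. (sqrt (real (Suc r)) * sqrt L) * (u r - u (Suc r)))"
  proof (rule sum_mono)
    fix r assume "r \<in> {..<N}"
    moreover have "u r - u (Suc r) \<ge> 0" using decseqD [OF u(1), of r "Suc r"] by simp
    ultimately show "\<bar>\<Sum>j<Suc r. g j\<bar> * (u r - u (Suc r)) \<le> (sqrt (real (Suc r)) * sqrt L) * (u r - u (Suc r))"
      by (intro mult_right_mono absS) auto
  qed
  also have "\<dots> = sqrt L * (\<Sum>r<N. sqrt (real (Suc r)) * (u r - u (Suc r)))"
    by (simp add: sum_distrib_left mult_ac)
  also have "(\<Sum>r<N. sqrt (real (Suc r)) * (u r - u (Suc r))) = (\<Sum>r<N. (sqrt (real (Suc r)) - sqrt (real r)) * u r)"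
  proof -
    have "(\<Sum>r<M. sqrt (real (Suc r)) * (u r - u (Suc r))) = (\<Sum>r<M. (sqrt (real (Suc r)) - sqrt (real r)) * u r) - sqrt M * u M" for M
      by (induction M) (auto simp: algebra_simps)
    then show ?thesis using u(2) [of N] by simp
  qed
  also have "\<dots> \<le> (\<Sum>r<N. (1 / sqrt (real (Suc r))) * u r)"
  proof (intro sum_mono mult_right_mono u0)
    fix r :: nat
    have "sqrt (real r) * sqrt (real r) \<le> sqrt (real r) * sqrt (real (Suc r))"
      by (intro mult_left_mono) auto
    then have "sqrt (real (Suc r)) * sqrt (real (Suc r)) - sqrt (real r) * sqrt (real (Suc r)) \<le> 1"
      by simp
    then have "(sqrt (real (Suc r)) - sqrt (real r)) * sqrt (real (Suc r)) \<le> 1"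
      by (simp only: left_diff_distrib)
    then show "sqrt (real (Suc r)) - sqrt (real r) \<le> 1 / sqrt (real (Suc r))"
      by (subst pos_le_divide_eq) auto
  qed
  finally have "\<bar>\<Sum>j<N. g j * u j\<bar> \<le> sqrt L * (\<Sum>r<N. (1 / sqrt (real (Suc r))) * u r)"
    using L by (simp add: mult_left_mono)
  then have "(\<Sum>j<N. g j * u j)\<^sup>2 \<le> (sqrt L * (\<Sum>r<N. (1 / sqrt (real (Suc r))) * u r))\<^sup>2"
    by (rule power2_le_iff_abs_le [THEN iffD2, rotated]) (auto intro!: mult_nonneg_nonneg sum_nonneg simp: L u0)
  also have "\<dots> = L * (\<Sum>r<N. (1 / sqrt (real (Suc r))) * u r)\<^sup>2" using L by (simp add: power_mult_distrib)
  also have "\<dots> \<le> L * ((\<Sum>r<N. (1 / sqrt (real (Suc r)))\<^sup>2) * (\<Sum>r<N. (u r)\<^sup>2))"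
    using L by (intro mult_left_mono Cauchy_Schwarz_ineq_sum)
  also have "(\<Sum>r<N. (1 / sqrt (real (Suc r)))\<^sup>2) = (\<Sum>r<N. 1 / real (Suc r))"
    by (intro sum.cong) (auto simp: power_divide)
  also have "L * ((\<Sum>r<N. 1 / real (Suc r)) * (\<Sum>r<N. (u r)\<^sup>2)) \<le> L * ((1 + ln (real N)) * (\<Sum>r<N. (u r)\<^sup>2))"
    using L N by (intro mult_left_mono mult_right_mono sum_inverse_le_ln sum_nonneg) auto
  finally show ?thesis by (simp add: mult_ac)
qed

section \<open>Dyadic scales and the iterated logarithm\<close>

definition levels :: "nat \<Rightarrow> nat" where
  "levels N = nat \<lfloor>log 2 (real N)\<rfloor> + 1"

text \<open>The only property of \<open>levels\<close> used for exact counting: it numbers the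
  powers of two up to \<open>N\<close>, which are the scales of the maximal inequalities and also
  the bump widths available in a block of the lower bound.\<close>

lemma less_levels_iff: "N \<ge> 1 \<Longrightarrow> j < levels N \<longleftrightarrow> 2 ^ j \<le> N"
proof -
  assume N: "N \<ge> 1"
  have "j < levels N \<longleftrightarrow> int j \<le> \<lfloor>log 2 (real N)\<rfloor>"
  proof -
    have "0 \<le> \<lfloor>log 2 (real N)\<rfloor>" using N by (simp add: zero_le_log_cancel_iff)
    then show ?thesis unfolding levels_def by linarith
  qed
  also have "\<dots> \<longleftrightarrow> real j \<le> log 2 (real N)" by (simp add: le_floor_iff)
  also have "\<dots> \<longleftrightarrow> (2::real) powr real j \<le> real N" using N by (subst le_log_iff) auto
  also have "\<dots> \<longleftrightarrow> 2 ^ j \<le> N"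
  proof -
    have "(2::real) powr real j = real (2 ^ j)" by (simp add: powr_realpow)
    then show ?thesis by (simp only: of_nat_le_iff)
  qed
  finally show ?thesis .
qed

lemma levels_le: "N \<ge> 1 \<Longrightarrow> real (levels N) \<le> 1 + 2 * ln (real N)"
proof -
  assume N: "N \<ge> 1"
  have "real (levels N) \<le> 1 + log 2 (real N)"
    using N by (auto simp: levels_def zero_le_log_cancel_iff)
  also have "log 2 (real N) \<le> 2 * ln (real N)"
  proof -
    have "ln (real N) * 1 \<le> ln (real N) * (2 * ln 2)"
      using N ln2_ge_two_thirds by (intro mult_left_mono) auto
    then show ?thesis by (simp add: log_def field_simps)
  qed
  finally show ?thesis by simp
qed

lemma exists_level: "r \<ge> 1 \<Longrightarrow> \<exists>i. 2 ^ i \<le> r \<and> r < 2 ^ Suc i" for r :: nat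
proof -
  assume r: "r \<ge> 1"
  define i where "i = levels r - 1"
  have "i < levels r" "\<not> Suc i < levels r" by (auto simp: i_def levels_def)
  then show ?thesis using less_levels_iff [OF r] by (metis not_le)
qed

text \<open>A law of iterated logarithm bound for \<open>max S\<^sub>r\<^sup>2 / r\<close>; the exponentials come from
  \<open>x \<le> s + 4 * exp ((x - s) / 4)\<close> and have small expectation once \<open>s\<close> is of order \<open>ln (ln N)\<close>.\<close>

definition lil :: "nat \<Rightarrow> real \<Rightarrow> (nat \<Rightarrow> real) \<Rightarrow> real" where
  "lil N s g = 2 * (s + 4 * (\<Sum>i<levels N. exp ((wmax (min (2 ^ Suc i) N) g - s) / 4)))"

lemma lil_nonneg: "s \<ge> 0 \<Longrightarrow> lil N s g \<ge> 0"
  unfolding lil_def by (auto intro!: add_nonneg_nonneg sum_nonneg)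

text \<open>Peeling: passing from \<open>r\<close> to the end of its dyadic scale at most doubles
  it, which is the outer factor \<open>2\<close> of \<open>lil\<close>. The unknown scale is covered
  by summing the exponentials over all scales.\<close>

lemma partial_sum_le_lil:
  assumes "r \<le> N" "s \<ge> 0"
  shows "(\<Sum>j<r. g j)\<^sup>2 \<le> real r * lil N s g"
proof (cases "r = 0")
  case False
  then obtain i where i: "2 ^ i \<le> r" "r < 2 ^ Suc i" using exists_level [of r] by auto
  define m where "m = min (2 ^ Suc i) N"
  have N: "N \<ge> 1" using False assms by simp
  have m: "r \<le> m" "m \<le> 2 * r" "m > 0" using i assms False by (auto simp: m_def)
  have il: "i < levels N" using less_levels_iff [OF N] i assms by auto
  have w: "(\<Sum>j<r. g j)\<^sup>2 \<le> real m * wmax m g"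
    using wmax_ge [OF m(1), of g] m(3) by (simp add: field_simps)
  have "wmax m g = s + 4 * ((wmax m g - s) / 4)" by (simp add: field_simps)
  also have "\<dots> \<le> s + 4 * exp ((wmax m g - s) / 4)"
    using exp_ge_add_one_self [of "(wmax m g - s) / 4"] by linarith
  also have "\<dots> \<le> s + 4 * (\<Sum>i<levels N. exp ((wmax (min (2 ^ Suc i) N) g - s) / 4))"
    using member_le_sum [of i "{..<levels N}" "\<lambda>i. exp ((wmax (min (2 ^ Suc i) N) g - s) / 4)"] il
    by (simp add: m_def)
  finally have "2 * wmax m g \<le> lil N s g" by (simp add: lil_def)
  then have "real r * (2 * wmax m g) \<le> real r * lil N s g" by (intro mult_left_mono) auto
  moreover have "real m * wmax m g \<le> real (2 * r) * wmax m g"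
    using m(2) by (intro mult_right_mono wmax_nonneg) (simp only: of_nat_le_iff)
  ultimately show ?thesis using w by simp
qed simp

lemma decreasing_inner_le_lil:
  fixes g u :: "nat \<Rightarrow> real"
  assumes u: "decseq u" "\<And>r. r \<ge> N \<Longrightarrow> u r = 0" and N: "N \<ge> 1" and s: "s \<ge> 0"
    and card: "card {r. r < N \<and> u r \<noteq> u (Suc r)} \<le> m"
  shows "(\<Sum>j<N. g j * u j)\<^sup>2 \<le> min (real m) (1 + ln (real N)) * lil N s g * (\<Sum>j<N. (u j)\<^sup>2)"
proof -
  have 1: "(\<Sum>j<N. g j * u j)\<^sup>2 \<le> real (card {r. r < N \<and> u r \<noteq> u (Suc r)}) * lil N s g * (\<Sum>j<N. (u j)\<^sup>2)"
    by (rule decreasing_inner_le_jumps [OF u]) (auto intro: partial_sum_le_lil lil_nonneg s)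
  have 2: "\<dots> \<le> real m * lil N s g * (\<Sum>j<N. (u j)\<^sup>2)"
    using card by (intro mult_right_mono lil_nonneg s sum_nonneg) auto
  have 3: "(\<Sum>j<N. g j * u j)\<^sup>2 \<le> (1 + ln (real N)) * lil N s g * (\<Sum>j<N. (u j)\<^sup>2)"
    by (rule decreasing_inner_le_log [OF u N]) (auto intro: partial_sum_le_lil lil_nonneg s)
  show ?thesis using order_trans [OF 1 2] 3 by (simp add: min_def)
qed

text \<open>Abel's inequality, squared: the inner product is at most the largest partial sum times
  the leading value.\<close>

lemma decreasing_inner_le_wmax:
  fixes g u :: "nat \<Rightarrow> real"
  assumes u: "\<And>i j. i \<le> j \<Longrightarrow> j < m \<Longrightarrow> u j \<le> u i" "\<And>i. i < m \<Longrightarrow> 0 \<le> u i"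
  shows "(\<Sum>t<m. g t * u t)\<^sup>2 \<le> real m * wmax m g * (u 0)\<^sup>2"
proof (cases "m = 0")
  case False
  define v where "v = (\<lambda>t. if t < m then u t else 0)"
  define M where "M = sqrt (real m * wmax m g)"
  have v: "decseq v" "\<And>r. r \<ge> m \<Longrightarrow> v r = 0"
    using u by (auto simp: v_def decseq_def)
  have v0: "v 0 = u 0" using False by (simp add: v_def)
  have M: "\<bar>\<Sum>j<r. g j\<bar> \<le> M" if "r \<le> m" for r
  proof -
    have "(\<Sum>j<r. g j)\<^sup>2 \<le> real m * wmax m g" using wmax_ge [OF that, of g] False by (simp add: field_simps)
    then show ?thesis unfolding M_def by (metis real_sqrt_abs real_sqrt_le_iff)
  qed
  have M0: "M \<ge> 0" by (simp add: M_def wmax_nonneg)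
  have "(\<Sum>t<m. g t * u t) = (\<Sum>t<m. g t * v t)" by (intro sum.cong) (auto simp: v_def)
  also have "\<dots> = (\<Sum>r<m. (\<Sum>j<Suc r. g j) * (v r - v (Suc r)))"
    using v(2) [of m] by (subst summation_by_parts) simp
  finally have "\<bar>\<Sum>t<m. g t * u t\<bar> \<le> (\<Sum>r<m. \<bar>(\<Sum>j<Suc r. g j) * (v r - v (Suc r))\<bar>)" by simp
  also have "\<dots> \<le> (\<Sum>r<m. M * (v r - v (Suc r)))"
  proof (rule sum_mono)
    fix r assume "r \<in> {..<m}"
    moreover have "v r - v (Suc r) \<ge> 0" using decseqD [OF v(1), of r "Suc r"] by simp
    ultimately show "\<bar>(\<Sum>j<Suc r. g j) * (v r - v (Suc r))\<bar> \<le> M * (v r - v (Suc r))"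
      using M [of "Suc r"] by (subst abs_mult) (intro mult_mono, auto)
  qed
  also have "\<dots> = M * (v 0 - v m)" by (simp add: sum_distrib_left [symmetric] sum_lessThan_telescope')
  also have "\<dots> = M * u 0" using v(2) [of m] v0 by simp
  finally have "\<bar>\<Sum>t<m. g t * u t\<bar> \<le> M * u 0" .
  then have "(\<Sum>t<m. g t * u t)\<^sup>2 \<le> (M * u 0)\<^sup>2"
    using M0 u(2) [of 0] False by (intro power2_le_iff_abs_le [THEN iffD2]) auto
  then show ?thesis by (simp add: M_def power_mult_distrib wmax_nonneg)
qed simp

text \<open>The dyadic shell \<open>{2^j - 1 ..< 2^(j+1) - 1}\<close> cut off at \<open>N\<close> has \<open>shell_length N j\<close> elements.\<close>

definition shell_length :: "nat \<Rightarrow> nat \<Rightarrow> nat" where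
  "shell_length N j = min (2 ^ j) (N + 1 - 2 ^ j)"

definition shell_sum :: "nat \<Rightarrow> (nat \<Rightarrow> real) \<Rightarrow> real" where
  "shell_sum N g = (\<Sum>j<levels N. wmax (shell_length N j) (\<lambda>t. g (2 ^ j - 1 + t)))"

lemma sum_shells:
  fixes f :: "nat \<Rightarrow> real"
  assumes "N \<ge> 1"
  shows "(\<Sum>i<N. f i) = (\<Sum>j<levels N. \<Sum>t<shell_length N j. f (2 ^ j - 1 + t))"
proof -
  have "(\<Sum>i<min N (2 ^ k - 1). f i) = (\<Sum>j<k. \<Sum>t<shell_length N j. f (2 ^ j - 1 + t))" for k
  proof (induction k)
    case (Suc k)
    have "min N (2 ^ Suc k - 1) = min N (2 ^ k - 1) + shell_length N k"
    proof -
      have "(2::nat) ^ Suc k = 2 ^ k + 2 ^ k" "(2::nat) ^ k \<ge> 1" by auto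
      then show ?thesis unfolding shell_length_def min_def by (simp split: if_splits, linarith)
    qed
    then have "(\<Sum>i<min N (2 ^ Suc k - 1). f i) = (\<Sum>i<min N (2 ^ k - 1). f i) + (\<Sum>t<shell_length N k. f (min N (2 ^ k - 1) + t))"
      by (simp add: sum_lessThan_add)
    moreover have "(\<Sum>t<shell_length N k. f (min N (2 ^ k - 1) + t)) = (\<Sum>t<shell_length N k. f (2 ^ k - 1 + t))"
    proof (intro sum.cong refl)
      fix t assume "t \<in> {..<shell_length N k}"
      then have "t < Suc N - 2 ^ k" by (simp add: shell_length_def)
      then have "2 ^ k \<le> N" by linarith
      then have "min N (2 ^ k - 1) = 2 ^ k - 1" by linarith
      then show "f (min N (2 ^ k - 1) + t) = f (2 ^ k - 1 + t)" by simp
    qed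
    ultimately show ?case using Suc by simp
  qed simp
  moreover have "min N (2 ^ levels N - 1) = N"
    using less_levels_iff [OF assms, of "levels N"] by (simp add: min_def)
  ultimately show ?thesis by metis
qed

text \<open>Cauchy condensation: \<open>u (2 ^ (k + 1) - 1)\<close> is below all
  \<open>2 ^ k\<close> values of \<open>u\<close> on indices from \<open>2 ^ k\<close> to
  \<open>2 ^ (k + 1) - 1\<close>, so its weight \<open>2 ^ (k + 1)\<close> is paid for twice over by
  that range.\<close>

lemma sum_dyadic_squares_le:
  fixes u :: "nat \<Rightarrow> real"
  assumes u: "decseq u" "\<And>r. 0 \<le> u r"
  shows "(\<Sum>j<Suc k. 2 ^ j * (u (2 ^ j - 1))\<^sup>2) \<le> 2 * (\<Sum>i<2 ^ k. (u i)\<^sup>2)"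
proof (induction k)
  case (Suc k)
  have "2 ^ k * (u (2 ^ Suc k - 1))\<^sup>2 = (\<Sum>t<2 ^ k::nat. (u (2 ^ Suc k - 1))\<^sup>2)" by simp
  also have "\<dots> \<le> (\<Sum>t<2 ^ k. (u (2 ^ k + t))\<^sup>2)"
    by (intro sum_mono power_mono decseqD [OF u(1)] u) auto
  finally have "2 ^ k * (u (2 ^ Suc k - 1))\<^sup>2 \<le> (\<Sum>t<2 ^ k. (u (2 ^ k + t))\<^sup>2)" .
  moreover have "(\<Sum>i<2 ^ Suc k. (u i)\<^sup>2) = (\<Sum>i<2 ^ k. (u i)\<^sup>2) + (\<Sum>t<2 ^ k. (u (2 ^ k + t))\<^sup>2)"
    unfolding power_Suc mult_2 by (rule sum_lessThan_add)
  ultimately show ?case using Suc by (subst sum.lessThan_Suc) simp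
qed (use u in auto)

text \<open>Abel's inequality on each shell, Cauchy-Schwarz across shells, and condensation for the
  leading values. Compared with the iterated logarithm bound, the maximum over scales becomes a sum
  over disjoint shells, whose terms are independent for Gaussian noise; there is no factor for the
  number of jumps.\<close>

lemma decreasing_inner_le_shells:
  fixes g u :: "nat \<Rightarrow> real"
  assumes u: "decseq u" "\<And>r. r \<ge> N \<Longrightarrow> u r = 0" and N: "N \<ge> 1"
  shows "(\<Sum>i<N. g i * u i)\<^sup>2 \<le> 2 * shell_sum N g * (\<Sum>i<N. (u i)\<^sup>2)"
proof -
  define w where "w = (\<lambda>j. wmax (shell_length N j) (\<lambda>t. g (2 ^ j - 1 + t)))"
  define a where "a = (\<lambda>j. \<Sum>t<shell_length N j. g (2 ^ j - 1 + t) * u (2 ^ j - 1 + t))"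
  define b where "b = (\<lambda>j. 2 ^ j * (u (2 ^ j - 1))\<^sup>2)"
  have u0: "0 \<le> u r" for r by (rule decseq_zero_nonneg [OF u])
  have w0: "w j \<ge> 0" for j by (simp add: w_def wmax_nonneg)
  have b0: "b j \<ge> 0" for j by (simp add: b_def)
  have ab: "\<bar>a j\<bar> \<le> sqrt (b j) * sqrt (w j)" for j
  proof -
    have "(a j)\<^sup>2 \<le> real (shell_length N j) * w j * (u (2 ^ j - 1 + 0))\<^sup>2"
      unfolding a_def w_def by (rule decreasing_inner_le_wmax) (auto intro: u0 decseqD [OF u(1)])
    also have "\<dots> \<le> 2 ^ j * w j * (u (2 ^ j - 1 + 0))\<^sup>2"
    proof (intro mult_right_mono w0)
      have "shell_length N j \<le> 2 ^ j" by (simp add: shell_length_def)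
      then have "real (shell_length N j) \<le> real (2 ^ j)" by (simp only: of_nat_le_iff)
      then show "real (shell_length N j) \<le> 2 ^ j" by simp
    qed auto
    finally have "(a j)\<^sup>2 \<le> b j * w j" by (simp add: b_def mult_ac)
    then show ?thesis by (metis real_sqrt_abs real_sqrt_le_iff real_sqrt_mult)
  qed
  have "\<bar>\<Sum>i<N. g i * u i\<bar> = \<bar>\<Sum>j<levels N. a j\<bar>" by (simp add: sum_shells [OF N] a_def)
  also have "\<dots> \<le> (\<Sum>j<levels N. sqrt (b j) * sqrt (w j))"
    by (rule order_trans [OF sum_abs sum_mono]) (rule ab)
  finally have "(\<Sum>i<N. g i * u i)\<^sup>2 \<le> (\<Sum>j<levels N. sqrt (b j) * sqrt (w j))\<^sup>2"
    by (intro power2_le_iff_abs_le [THEN iffD2]) (auto intro!: sum_nonneg simp: b0 w0)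
  also have "\<dots> \<le> (\<Sum>j<levels N. (sqrt (b j))\<^sup>2) * (\<Sum>j<levels N. (sqrt (w j))\<^sup>2)"
    by (rule Cauchy_Schwarz_ineq_sum)
  also have "\<dots> = (\<Sum>j<levels N. b j) * shell_sum N g" by (simp add: b0 w0 shell_sum_def w_def wmax_nonneg)
  also have "\<dots> \<le> (2 * (\<Sum>i<N. (u i)\<^sup>2)) * shell_sum N g"
  proof (rule mult_right_mono)
    obtain k where k: "levels N = Suc k" by (auto simp: levels_def)
    have "(\<Sum>j<levels N. b j) \<le> 2 * (\<Sum>i<2 ^ k. (u i)\<^sup>2)"
      unfolding k b_def by (rule sum_dyadic_squares_le [OF u(1) u0])
    also have "(\<Sum>i<2 ^ k. (u i)\<^sup>2) \<le> (\<Sum>i<N. (u i)\<^sup>2)"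
      using less_levels_iff [OF N, of k] k by (intro sum_mono2) auto
    finally show "(\<Sum>j<levels N. b j) \<le> 2 * (\<Sum>i<N. (u i)\<^sup>2)" by simp
    show "0 \<le> shell_sum N g" unfolding shell_sum_def by (intro sum_nonneg wmax_nonneg)
  qed
  finally show ?thesis by (simp add: mult_ac)
qed

section \<open>Lower bounds for unimodal vectors\<close>

lemma minimax_lower_constant:
  assumes n: "n \<ge> 1" and k: "k \<ge> 1" and \<sigma>: "\<sigma> > 0"
  shows "ennreal (\<sigma>\<^sup>2 * (ln 2 / 64)) \<le> (INF T\<in>estimators n. SUP \<theta>\<in>unimodal_pieces n k. sq_risk n \<sigma> T \<theta>)"
proof -
  \<comment> \<open>The constants \<open>0\<close> and \<open>h\<close> lie at squared distance
    exactly \<open>d\<close>, the largest radius that the testing bound admits for two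
    hypotheses.\<close>
  define d where "d = \<sigma>\<^sup>2 / 2 * ln 2"
  define h where "h = sqrt (d / real n)"
  define th where "th = (\<lambda>b. \<lambda>i\<in>{1..n}. if b then h else 0)"
  have d0: "d \<ge> 0" by (simp add: d_def)
  have nh: "real n * h\<^sup>2 = d" using n d0 by (simp add: h_def)
  show ?thesis
  proof (rule minimax_lower_from_average [where S = UNIV and th = th])
    show "th s \<in> unimodal_pieces n k" for s
      unfolding th_def by (rule const_in_unimodal_pieces [OF k])
    fix T assume T: "T \<in> estimators n"
    have "ennreal (real (card (UNIV :: bool set)) * d / 32) \<le> (\<Sum>s\<in>UNIV. block_risk n \<sigma> T {1..n} (th s))"
    proof (rule multiple_hypotheses_bound [where base = "\<lambda>_. 0", OF \<sigma> _ _ T _ d0])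
      show "(\<Sum>i\<in>{1..n}. (th s i - 0)\<^sup>2) \<le> \<sigma>\<^sup>2 / 2 * ln (real (card (UNIV :: bool set)))" for s
        using nh d0 by (cases s) (simp_all add: th_def d_def)
      show "d \<le> (\<Sum>i\<in>{1..n}. (th s i - th t i)\<^sup>2)" if "s \<noteq> t" for s t
        using nh that by (cases s; cases t) (simp_all add: th_def)
    qed auto
    moreover have "real (card (UNIV :: bool set)) * d / 32 = real (card (UNIV :: bool set)) * (\<sigma>\<^sup>2 * (ln 2 / 64))"
      by (simp add: d_def)
    ultimately show "ennreal (real (card (UNIV :: bool set)) * (\<sigma>\<^sup>2 * (ln 2 / 64))) \<le> (\<Sum>s\<in>UNIV. sq_risk n \<sigma> T (th s))"
      by (simp only: block_risk_all)
  qed auto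
qed

section \<open>Single spikes, which need three pieces\<close>

lemma spike_in_unimodal_pieces:
  assumes "k \<ge> 3" "i0 \<in> {1..n}" "h \<ge> 0"
  shows "(\<lambda>i\<in>{1..n}. if i = i0 then h else 0) \<in> unimodal_pieces n k"
  unfolding unimodal_pieces_def
proof (rule CollectI, rule conjI, simp, intro exI conjI)
  let ?a = "\<lambda>j. if j = 0 then 0 else if j = 1 then i0 - 1 else if j = 2 then i0 else n"
  let ?mu = "\<lambda>j::nat. if j = 2 then h else 0"
  show "?a 0 = 0" "?a k = n" "1 \<le> (2::nat)" "2 \<le> k" using assms by auto
  show "\<forall>j<k. ?a j \<le> ?a (Suc j)" using assms by auto
  show "\<forall>j. 1 \<le> j \<and> j < 2 \<longrightarrow> ?mu j \<le> ?mu (Suc j)" "\<forall>j. 2 \<le> j \<and> j < k \<longrightarrow> ?mu (Suc j) \<le> ?mu j"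
    using assms by auto
  show "\<forall>j\<in>{1..k}. \<forall>i. ?a (j - 1) < i \<and> i \<le> ?a j \<longrightarrow> (\<lambda>i\<in>{1..n}. if i = i0 then h else 0) i = ?mu j"
  proof (intro ballI allI impI)
    fix j i assume j: "j \<in> {1..k}" and i: "?a (j - 1) < i \<and> i \<le> ?a j"
    consider "j = 1" | "j = 2" | "j = 3" | "j > 3" using j by fastforce
    then show "(\<lambda>i\<in>{1..n}. if i = i0 then h else 0) i = ?mu j"
    proof cases
      case 4
      then have "j - 1 \<noteq> 0" "j - 1 \<noteq> 1" "j - 1 \<noteq> 2" by auto
      then show ?thesis using i 4 by auto
    qed (use i assms in auto)
  qed
qed

lemma minimax_lower_spike:
  assumes n: "n \<ge> 2" and k: "k \<ge> 3" and \<sigma>: "\<sigma> > 0"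
  shows "ennreal (\<sigma>\<^sup>2 * (ln (real n) / 64)) \<le> (INF T\<in>estimators n. SUP \<theta>\<in>unimodal_pieces n k. sq_risk n \<sigma> T \<theta>)"
proof -
  define d where "d = \<sigma>\<^sup>2 / 2 * ln (real n)"
  define h where "h = sqrt d"
  define th where "th = (\<lambda>s. \<lambda>i\<in>{1..n}. if i = s then h else 0)"
  have d0: "d \<ge> 0" using n by (simp add: d_def)
  have h: "h\<^sup>2 = d" "h \<ge> 0" using d0 by (auto simp: h_def)
  show ?thesis
  proof (rule minimax_lower_from_average [where S = "{1..n}" and th = th])
    show "th s \<in> unimodal_pieces n k" if "s \<in> {1..n}" for s
      unfolding th_def by (rule spike_in_unimodal_pieces [OF k that h(2)])
    fix T assume T: "T \<in> estimators n"
    have "ennreal (real (card {1..n}) * d / 32) \<le> (\<Sum>s\<in>{1..n}. block_risk n \<sigma> T {1..n} (th s))"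
    proof (rule multiple_hypotheses_bound [where base = "\<lambda>_. 0", OF \<sigma> _ _ T _ d0])
      show "(\<Sum>i\<in>{1..n}. (th s i - 0)\<^sup>2) \<le> \<sigma>\<^sup>2 / 2 * ln (real (card {1..n}))" if s: "s \<in> {1..n}" for s
      proof -
        have "(\<Sum>i\<in>{1..n}. (th s i - 0)\<^sup>2) = (\<Sum>i\<in>{1..n}. if i = s then h\<^sup>2 else 0)"
          by (intro sum.cong) (auto simp: th_def)
        also have "\<dots> = d" using s h by simp
        finally show ?thesis by (simp add: d_def)
      qed
      show "d \<le> (\<Sum>i\<in>{1..n}. (th s i - th t i)\<^sup>2)" if "s \<in> {1..n}" "t \<in> {1..n}" "s \<noteq> t" for s t
      proof -
        have "d = (th s s - th t s)\<^sup>2" using that h by (simp add: th_def)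
        also have "\<dots> \<le> (\<Sum>i\<in>{1..n}. (th s i - th t i)\<^sup>2)"
          using that by (intro member_le_sum) auto
        finally show ?thesis .
      qed
    qed (use n in auto)
    moreover have "real (card {1..n}) * d / 32 = real (card {1..n}) * (\<sigma>\<^sup>2 * (ln (real n) / 64))"
      by (simp add: d_def)
    ultimately show "ennreal (real (card {1..n}) * (\<sigma>\<^sup>2 * (ln (real n) / 64))) \<le> (\<Sum>s\<in>{1..n}. sq_risk n \<sigma> T (th s))"
      by (simp only: block_risk_all)
  qed (use n in auto)
qed

text \<open>\<open>staircase n K N H c\<close> vanishes on the first \<open>n - K * N\<close> coordinates; the rest is cut into \<open>K\<close> blocks of length
  \<open>N\<close>, and block \<open>b\<close> has base level \<open>b * H\<close> raised by \<open>H / sqrt (2 ^ c b)\<close> on its last \<open>2 ^ c b\<close> coordinates.\<close>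

definition staircase :: "nat \<Rightarrow> nat \<Rightarrow> nat \<Rightarrow> real \<Rightarrow> (nat \<Rightarrow> nat) \<Rightarrow> nat \<Rightarrow> real" where
  "staircase n K N H c = (\<lambda>i\<in>{1..n}. if i \<le> n - K * N then 0
     else let b = (i - (n - K * N) - 1) div N
       in real b * H + (if n - K * N + (b + 1) * N < i + 2 ^ c b then H / sqrt (2 ^ c b) else 0))"

section \<open>Staircases, tested block by block\<close>

definition block :: "nat \<Rightarrow> nat \<Rightarrow> nat \<Rightarrow> nat \<Rightarrow> nat set" where
  "block n K N b = {n - K * N + b * N<..n - K * N + (b + 1) * N}"

lemma block_subset: "K * N \<le> n \<Longrightarrow> b < K \<Longrightarrow> block n K N b \<subseteq> {1..n}"
proof -
  assume a: "K * N \<le> n" "b < K"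
  then have "(b + 1) * N \<le> K * N" by (intro mult_right_mono) auto
  then show ?thesis using a by (auto simp: block_def)
qed

lemma block_index:
  assumes "i \<in> block n K N b"
  shows "(i - (n - K * N) - 1) div N = b"
proof (rule div_nat_eqI)
  have "n - K * N + N * b < i" "i \<le> n - K * N + (N + N * b)" using assms by (auto simp: block_def mult.commute)
  then show "N * b \<le> i - (n - K * N) - 1" "i - (n - K * N) - 1 < N * Suc b" by auto
qed

lemma staircase_on_block:
  assumes "K * N \<le> n" "b < K" "i \<in> block n K N b"
  shows "staircase n K N H c i = real b * H + (if n - K * N + (b + 1) * N < i + 2 ^ c b then H / sqrt (2 ^ c b) else 0)"
proof -
  have "i \<in> {1..n}" using block_subset assms by blast
  moreover have "\<not> i \<le> n - K * N" using assms by (auto simp: block_def)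
  ultimately show ?thesis
    by (simp only: staircase_def restrict_apply' Let_def block_index [OF assms(3)] if_False)
qed

lemma staircase_upd_off_block:
  assumes "K * N \<le> n" "N \<ge> 1" "i \<in> {1..n}" "i \<notin> block n K N b"
  shows "staircase n K N H (c(b := s)) i = staircase n K N H c i"
proof (cases "i \<le> n - K * N")
  case False
  have "(i - (n - K * N) - 1) div N \<noteq> b"
  proof
    define q where "q = i - (n - K * N) - 1"
    assume "(i - (n - K * N) - 1) div N = b"
    then have "b * N \<le> q" "q < (b + 1) * N"
      using assms(2) div_times_less_eq_dividend [of q N] dividend_less_div_times [of N q] by (auto simp: q_def)
    then have "i \<in> block n K N b" using False by (auto simp: block_def q_def)
    then show False using assms by simp
  qed
  then show ?thesis using False by (simp add: staircase_def Let_def)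
qed (simp add: staircase_def)

text \<open>Piece \<open>2 * b + 1\<close> is the flat part of block \<open>b\<close> and piece
  \<open>2 * b + 2\<close> its bump. The leading zeros join piece \<open>1\<close> because block
  \<open>0\<close> has base level \<open>0\<close>, and pieces beyond \<open>2 * K\<close> are
  empty. A bump has height at most \<open>H\<close>, the gap to the next base level, so the levels
  increase and the mode can be the last piece, \<open>l = k\<close>.\<close>

lemma staircase_in_unimodal_pieces:
  assumes K: "K \<ge> 1" "K * N \<le> n" "2 * K \<le> k" and H: "H \<ge> 0" and c: "\<And>b. b < K \<Longrightarrow> 2 ^ c b \<le> N"
  shows "staircase n K N H c \<in> unimodal_pieces n k"
  unfolding unimodal_pieces_def
proof (rule CollectI, rule conjI)
  show "staircase n K N H c \<in> extensional {1..n}" by (simp add: staircase_def)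
  define off where "off = n - K * N"
  define blk where "blk = (\<lambda>j::nat. (j - 1) div 2)"
  define a where "a = (\<lambda>j. if j = 0 then 0 else if blk j \<ge> K then n else if odd j then off + (blk j + 1) * N - 2 ^ c (blk j) else off + (blk j + 1) * N)"
  define \<mu> where "\<mu> = (\<lambda>j. real (blk j) * H + (if odd j then 0 else H / sqrt (2 ^ c (blk j))))"
  have on: "off + K * N = n" using K by (simp add: off_def)
  have blk: "blk (Suc (2 * b)) = b" "blk (Suc (Suc (2 * b))) = b" for b by (auto simp: blk_def)
  have le: "off + (b + 1) * N \<le> n" if "b < K" for b
  proof -
    have "(b + 1) * N \<le> K * N" using that by (intro mult_right_mono) auto
    then show ?thesis using on by simp
  qed
  have a_odd: "a (Suc (2 * b)) = off + (b + 1) * N - 2 ^ c b" if "b < K" for b using that by (simp add: a_def blk)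
  have a_even: "a (Suc (Suc (2 * b))) = off + (b + 1) * N" if "b < K" for b using that by (simp add: a_def blk)
  have a_big: "a j = n" if "2 * K \<le> j" for j
  proof (cases "j = 2 * K")
    case True
    then obtain b where b: "K = Suc b" "j = Suc (Suc (2 * b))" using K by (cases K) auto
    then have "a j = off + K * N" using a_even [of b] by simp
    then show ?thesis using on by simp
  next
    case False
    then have "blk j \<ge> K" using that by (auto simp: blk_def)
    then show ?thesis using that K by (simp add: a_def)
  qed
  have hle: "0 \<le> H / sqrt (2 ^ e)" "H / sqrt (2 ^ e) \<le> H" for e :: nat
  proof -
    have "1 \<le> sqrt (2 ^ e :: real)" by simp
    then have "H * 1 \<le> H * sqrt (2 ^ e)" using H by (intro mult_left_mono)
    then show "H / sqrt (2 ^ e) \<le> H" by (simp add: divide_le_eq)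
  qed (use H in simp)
  have parity: "(\<exists>b. j = Suc (2 * b)) \<or> (\<exists>b. j = Suc (Suc (2 * b)))" if "j \<ge> 1" for j
  proof (cases "even j")
    case True
    then obtain m where "j = 2 * m" by blast
    then show ?thesis using that by (intro disjI2 exI [of _ "m - 1"]) auto
  qed (auto elim: oddE)
  show "\<exists>a l \<mu>. a 0 = 0 \<and> a k = n \<and> (\<forall>j<k. a j \<le> a (Suc j)) \<and> 1 \<le> l \<and> l \<le> k \<and>
       (\<forall>j. 1 \<le> j \<and> j < l \<longrightarrow> \<mu> j \<le> \<mu> (Suc j)) \<and> (\<forall>j. l \<le> j \<and> j < k \<longrightarrow> \<mu> j \<ge> \<mu> (Suc j)) \<and>
       (\<forall>j\<in>{1..k}. \<forall>i. a (j - 1) < i \<and> i \<le> a j \<longrightarrow> staircase n K N H c i = \<mu> j)"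
  proof (intro exI conjI)
    show "a 0 = 0" by (simp add: a_def)
    show "a k = n" using K by (intro a_big)
    show "1 \<le> k" "k \<le> k" using K by auto
    show "\<forall>j. k \<le> j \<and> j < k \<longrightarrow> \<mu> j \<ge> \<mu> (Suc j)" by auto
    show "\<forall>j. 1 \<le> j \<and> j < k \<longrightarrow> \<mu> j \<le> \<mu> (Suc j)"
    proof (intro allI impI)
      fix j assume "1 \<le> j \<and> j < k"
      then consider b where "j = Suc (2 * b)" | b where "j = Suc (Suc (2 * b))" using parity by blast
      then show "\<mu> j \<le> \<mu> (Suc j)"
      proof cases
        case 1
        then show ?thesis using hle(1) by (simp add: \<mu>_def blk)
      next
        case 2
        have "Suc j = Suc (2 * Suc b)" using 2 by simp
        then have "\<mu> (Suc j) = real (Suc b) * H" by (simp only: \<mu>_def blk) simp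
        moreover have "\<mu> j = real b * H + H / sqrt (2 ^ c b)" using 2 by (simp add: \<mu>_def blk)
        ultimately show ?thesis using hle(2) [of "c b"] by (simp add: distrib_right)
      qed
    qed
    show "\<forall>j<k. a j \<le> a (Suc j)"
    proof (intro allI impI)
      fix j
      show "a j \<le> a (Suc j)"
      proof (cases "j = 0 \<or> 2 * K \<le> j")
        case True
        then show ?thesis using a_big [of j] a_big [of "Suc j"] by (auto simp: a_def)
      next
        case False
        then consider b where "j = Suc (2 * b)" "b < K" | b where "j = Suc (Suc (2 * b))" "Suc b < K"
          using parity [of j] by fastforce
        then show ?thesis
        proof cases
          case 1
          then show ?thesis using a_odd [of b] a_even [of b] by simp
        next
          case 2
          have "Suc j = Suc (2 * Suc b)" using 2 by simp
          then have "a (Suc j) = off + (Suc b + 1) * N - 2 ^ c (Suc b)" using a_odd [of "Suc b"] 2 by simp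
          then show ?thesis using a_even [of b] c [of "Suc b"] 2 by simp
        qed
      qed
    qed
    show "\<forall>j\<in>{1..k}. \<forall>i. a (j - 1) < i \<and> i \<le> a j \<longrightarrow> staircase n K N H c i = \<mu> j"
    proof (intro ballI allI impI)
      fix j i assume j: "j \<in> {1..k}" and i: "a (j - 1) < i \<and> i \<le> a j"
      show "staircase n K N H c i = \<mu> j"
      proof (cases "2 * K < j")
        case True
        then have "2 * K \<le> j - 1" "2 * K \<le> j" by auto
        then show ?thesis using i a_big [of j] a_big [of "j - 1"] by simp
      next
        case False
        then consider b where "j = Suc (2 * b)" "b < K" | b where "j = Suc (Suc (2 * b))" "b < K"
          using parity [of j] j by fastforce
        then show ?thesis
        proof cases
          case 1
          have up: "i + 2 ^ c b \<le> off + (b + 1) * N"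
          proof -
            have "i \<le> off + (b + 1) * N - 2 ^ c b" using i a_odd [OF 1(2)] 1 by simp
            moreover have "2 ^ c b \<le> off + (b + 1) * N" using c [OF 1(2)] by simp
            ultimately show ?thesis by linarith
          qed
          show ?thesis
          proof (cases "i \<le> off")
            case True
            have "b = 0"
            proof (rule ccontr)
              assume "b \<noteq> 0"
              then obtain b' where b': "b = Suc b'" by (cases b) auto
              then have "a (j - 1) = off + (b' + 1) * N" using 1 a_even [of b'] by simp
              then show False using i True by simp
            qed
            moreover have "1 \<le> i" "i \<le> n" using i le [OF 1(2)] up by auto
            ultimately show ?thesis using True 1 by (simp add: staircase_def off_def \<mu>_def blk_def)
          next
            case False
            have "off + b * N < i"
            proof (cases b)
              case 0
              then show ?thesis using False by simp
            next
              case (Suc b')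
              then have "a (j - 1) = off + (b' + 1) * N" using 1 a_even [of b'] by simp
              then show ?thesis using i Suc by simp
            qed
            then have "i \<in> block n K N b" using up by (simp add: block_def off_def [symmetric])
            then show ?thesis using staircase_on_block [OF K(2) 1(2)] up 1
              by (simp add: off_def [symmetric] \<mu>_def blk)
          qed
        next
          case 2
          have aj: "a (j - 1) = off + (b + 1) * N - 2 ^ c b" "a j = off + (b + 1) * N"
            using 2 a_odd [of b] a_even [of b] by auto
          have lo: "off + (b + 1) * N < i + 2 ^ c b" using i aj by auto
          have "off + b * N < i" using lo c [OF 2(2)] by simp
          then have "i \<in> block n K N b" using i aj by (simp add: block_def off_def [symmetric])
          then show ?thesis using staircase_on_block [OF K(2) 2(2)] lo 2
            by (simp add: off_def [symmetric] \<mu>_def blk)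
        qed
      qed
    qed
  qed
qed

text \<open>Width times squared height is \<open>H^2\<close> for every exponent. For
  \<open>s < t\<close> at least half of the wider bump lies outside the narrower one, and there the
  difference is the full height of the wider bump.\<close>

lemma sum_block_bump:
  fixes y s t x :: nat and H :: real
  assumes "2 ^ s \<le> y - x" "x \<le> y"
  shows "(\<Sum>i\<in>{x<..y}. (if y < i + 2 ^ s then H / sqrt (2 ^ s) else 0)\<^sup>2) = H\<^sup>2"
    and "s < t \<Longrightarrow> 2 ^ t \<le> y - x \<Longrightarrow>
      H\<^sup>2 / 2 \<le> (\<Sum>i\<in>{x<..y}. ((if y < i + 2 ^ s then H / sqrt (2 ^ s) else 0) - (if y < i + 2 ^ t then H / sqrt (2 ^ t) else 0))\<^sup>2)"
proof -
  have sq: "(H / sqrt (2 ^ r))\<^sup>2 = H\<^sup>2 / 2 ^ r" for r :: nat by (simp add: power_divide)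
  have "(\<Sum>i\<in>{x<..y}. (if y < i + 2 ^ s then H / sqrt (2 ^ s) else 0)\<^sup>2) = (\<Sum>i\<in>{y - 2 ^ s<..y}. H\<^sup>2 / 2 ^ s)"
    using assms by (intro sum.mono_neutral_cong_right) (auto simp: sq)
  also have "\<dots> = H\<^sup>2" using assms by simp
  finally show "(\<Sum>i\<in>{x<..y}. (if y < i + 2 ^ s then H / sqrt (2 ^ s) else 0)\<^sup>2) = H\<^sup>2" .
  assume st: "s < t" "2 ^ t \<le> y - x"
  have pw: "(2::nat) ^ Suc s \<le> 2 ^ t" using st by (intro power_increasing) auto
  have "H\<^sup>2 / 2 = (2 ^ t / 2) * (H\<^sup>2 / 2 ^ t)" by simp
  also have "\<dots> \<le> real (2 ^ t - 2 ^ s) * (H\<^sup>2 / 2 ^ t)"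
  proof (intro mult_right_mono)
    have "real (2 ^ Suc s) \<le> real (2 ^ t)" using pw by (simp only: of_nat_le_iff)
    moreover have "real (2 ^ t - 2 ^ s) = 2 ^ t - 2 ^ s" using st by (subst of_nat_diff) auto
    ultimately show "2 ^ t / 2 \<le> real (2 ^ t - 2 ^ s)" by simp
  qed simp
  also have "\<dots> = (\<Sum>i\<in>{y - 2 ^ t<..y - 2 ^ s}. H\<^sup>2 / 2 ^ t)"
  proof -
    have "card {y - 2 ^ t<..y - 2 ^ s} = 2 ^ t - 2 ^ s" using st assms pw by simp
    then show ?thesis by simp
  qed
  also have "\<dots> = (\<Sum>i\<in>{y - 2 ^ t<..y - 2 ^ s}. ((if y < i + 2 ^ s then H / sqrt (2 ^ s) else 0) - (if y < i + 2 ^ t then H / sqrt (2 ^ t) else 0))\<^sup>2)"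
    using st assms by (intro sum.cong) (auto simp: sq)
  also have "\<dots> \<le> (\<Sum>i\<in>{x<..y}. ((if y < i + 2 ^ s then H / sqrt (2 ^ s) else 0) - (if y < i + 2 ^ t then H / sqrt (2 ^ t) else 0))\<^sup>2)"
    using st by (intro sum_mono2) auto
  finally show "H\<^sup>2 / 2 \<le> (\<Sum>i\<in>{x<..y}. ((if y < i + 2 ^ s then H / sqrt (2 ^ s) else 0) - (if y < i + 2 ^ t then H / sqrt (2 ^ t) else 0))\<^sup>2)" .
qed

lemma sum_block_risk_le:
  assumes \<sigma>: "\<sigma> > 0" and T: "T \<in> estimators n" and K: "K * N \<le> n"
  shows "(\<Sum>b<K. block_risk n \<sigma> T (block n K N b) \<theta>) \<le> sq_risk n \<sigma> T \<theta>"
proof -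
  have meas: "(\<lambda>x. ennreal (\<Sum>i\<in>B. (T x i - \<theta> i)\<^sup>2)) \<in> borel_measurable (gauss_model n \<sigma> \<theta>)" if "B \<subseteq> {1..n}" for B
  proof -
    have "(\<lambda>x. ennreal (\<Sum>i\<in>B. (T x i - \<theta> i)\<^sup>2)) \<in> borel_measurable (leb n)"
      using estimator_component_measurable [OF T] that
      by (intro measurable_compose [OF _ measurable_ennreal] borel_measurable_sum borel_measurable_power borel_measurable_diff) auto
    then show ?thesis using measurable_cong_sets [OF gauss_model_facts(2) [OF \<sigma>] refl] by blast
  qed
  have "(\<Sum>b<K. block_risk n \<sigma> T (block n K N b) \<theta>) = (\<integral>\<^sup>+ x. (\<Sum>b<K. ennreal (\<Sum>i\<in>block n K N b. (T x i - \<theta> i)\<^sup>2)) \<partial>gauss_model n \<sigma> \<theta>)"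
    unfolding block_risk_def by (rule nn_integral_sum [symmetric]) (use meas block_subset [OF K] in auto)
  also have "\<dots> \<le> sq_risk n \<sigma> T \<theta>"
    unfolding sq_risk_def
  proof (rule nn_integral_mono)
    fix x
    have disj: "block n K N b \<inter> block n K N b' = {}" if "b \<noteq> b'" for b b'
      using block_index [of _ n K N] that by blast
    have "(\<Sum>b<K. \<Sum>i\<in>block n K N b. (T x i - \<theta> i)\<^sup>2) = (\<Sum>i\<in>(\<Union>b<K. block n K N b). (T x i - \<theta> i)\<^sup>2)"
      by (rule sum.UNION_disjoint [symmetric]) (use disj in \<open>auto simp: block_def\<close>)
    also have "\<dots> \<le> (\<Sum>i\<in>{1..n}. (T x i - \<theta> i)\<^sup>2)"
      using block_subset [OF K] by (intro sum_mono2) auto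
    finally have "ennreal (\<Sum>b<K. \<Sum>i\<in>block n K N b. (T x i - \<theta> i)\<^sup>2) \<le> ennreal (\<Sum>i\<in>{1..n}. (T x i - \<theta> i)\<^sup>2)"
      by (rule ennreal_leI)
    then show "(\<Sum>b<K. ennreal (\<Sum>i\<in>block n K N b. (T x i - \<theta> i)\<^sup>2)) \<le> ennreal (\<Sum>i\<in>{1..n}. (T x i - \<theta> i)\<^sup>2)"
      by (subst sum_ennreal) (auto intro: sum_nonneg)
  qed
  finally show ?thesis .
qed

lemma minimax_lower_blocks:
  assumes K: "K \<ge> 1" "K * N \<le> n" "2 * K \<le> k" and N: "N \<ge> 2" and \<sigma>: "\<sigma> > 0"
  shows "ennreal (\<sigma>\<^sup>2 * (real K * ln (real (levels N)) / 128)) \<le> (INF T\<in>estimators n. SUP \<theta>\<in>unimodal_pieces n k. sq_risk n \<sigma> T \<theta>)"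
proof -
  define L where "L = levels N"
  define H where "H = sqrt (\<sigma>\<^sup>2 / 2 * ln (real L))"
  define S where "S = PiE {..<K} (\<lambda>_. {..<L})"
  have N1: "N \<ge> 1" using N by simp
  have L2: "L \<ge> 2" using less_levels_iff [OF N1, of 1] N by (simp add: L_def)
  have H: "H\<^sup>2 = \<sigma>\<^sup>2 / 2 * ln (real L)" "H \<ge> 0" using L2 by (auto simp: H_def)
  have pw: "2 ^ e \<le> N" if "e < L" for e using less_levels_iff [OF N1] that by (simp add: L_def)
  have cardS: "card S = L ^ K" by (simp add: S_def card_PiE)
  have blockrisk: "ennreal (real L * (H\<^sup>2 / 64)) \<le> (\<Sum>s<L. block_risk n \<sigma> T (block n K N b) (staircase n K N H (c(b := s))))"
    if T: "T \<in> estimators n" and b: "b < K" for T b c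
  proof -
    define x where "x = n - K * N + b * N"
    define y where "y = n - K * N + (b + 1) * N"
    have xy: "x \<le> y" "y - x = N" by (auto simp: x_def y_def)
    have bl: "block n K N b = {x<..y}" by (simp add: block_def x_def y_def)
    let ?g = "\<lambda>s i. if y < i + 2 ^ s then H / sqrt (2 ^ s) else 0"
    \<comment> \<open>The centre flattens block \<open>b\<close> only and keeps the others, so every
      hypothesis is one bump away from it, at squared distance \<open>H^2\<close> whatever the
      width.\<close>
    define base where "base = (\<lambda>i. if i \<in> block n K N b then real b * H else staircase n K N H c i)"
    have on: "staircase n K N H (c(b := s)) i = real b * H + ?g s i" if "i \<in> block n K N b" for i s
      using staircase_on_block [OF K(2) b that, of H "c(b := s)"] by (simp add: y_def)
    have "ennreal (real (card {..<L}) * (H\<^sup>2 / 2) / 32) \<le> (\<Sum>s\<in>{..<L}. block_risk n \<sigma> T (block n K N b) (staircase n K N H (c(b := s))))"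
    proof (rule multiple_hypotheses_bound [where base = base, OF \<sigma> _ _ T])
      show "block n K N b \<subseteq> {1..n}" by (rule block_subset [OF K(2) b])
      show "(\<Sum>i\<in>{1..n}. (staircase n K N H (c(b := s)) i - base i)\<^sup>2) \<le> \<sigma>\<^sup>2 / 2 * ln (real (card {..<L}))" if s: "s \<in> {..<L}" for s
      proof -
        have "(\<Sum>i\<in>{1..n}. (staircase n K N H (c(b := s)) i - base i)\<^sup>2) = (\<Sum>i\<in>block n K N b. (?g s i)\<^sup>2)"
          using block_subset [OF K(2) b] staircase_upd_off_block [OF K(2) N1, of _ b H c s]
          by (intro sum.mono_neutral_cong_right) (auto simp: base_def on)
        also have "\<dots> = H\<^sup>2" unfolding bl using pw s xy by (intro sum_block_bump(1)) auto
        finally show ?thesis using H by simp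
      qed
      have sepw: "H\<^sup>2 / 2 \<le> (\<Sum>i\<in>block n K N b. (staircase n K N H (c(b := s)) i - staircase n K N H (c(b := t)) i)\<^sup>2)" if "s < t" "t < L" for s t
      proof -
        have "H\<^sup>2 / 2 \<le> (\<Sum>i\<in>block n K N b. (?g s i - ?g t i)\<^sup>2)"
          unfolding bl using pw [of s] pw [of t] that xy by (intro sum_block_bump(2)) auto
        also have "\<dots> = (\<Sum>i\<in>block n K N b. (staircase n K N H (c(b := s)) i - staircase n K N H (c(b := t)) i)\<^sup>2)"
          by (intro sum.cong) (auto simp: on)
        finally show ?thesis .
      qed
      show "H\<^sup>2 / 2 \<le> (\<Sum>i\<in>block n K N b. (staircase n K N H (c(b := s)) i - staircase n K N H (c(b := t)) i)\<^sup>2)"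
        if "s \<in> {..<L}" "t \<in> {..<L}" "s \<noteq> t" for s t
      proof (cases "s < t")
        case True
        then show ?thesis using sepw that by simp
      next
        case False
        then have "H\<^sup>2 / 2 \<le> (\<Sum>i\<in>block n K N b. (staircase n K N H (c(b := t)) i - staircase n K N H (c(b := s)) i)\<^sup>2)"
          using that by (intro sepw) auto
        then show ?thesis by (simp only: power2_commute)
      qed
    qed (use L2 in auto)
    then show ?thesis by simp
  qed
  show ?thesis
  proof (rule minimax_lower_from_average [where S = S and th = "staircase n K N H"])
    show "finite S" by (simp add: S_def finite_PiE)
    show "S \<noteq> {}" using cardS L2 by auto
    show "staircase n K N H c \<in> unimodal_pieces n k" if "c \<in> S" for c
      by (rule staircase_in_unimodal_pieces [OF K H(2)]) (use that pw in \<open>auto simp: S_def PiE_iff\<close>)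
    show "0 \<le> \<sigma>\<^sup>2 * (real K * ln (real (levels N)) / 128)" using L2 by (simp add: L_def)
    fix T assume T: "T \<in> estimators n"
    have inner: "ennreal (real (L ^ K) * (H\<^sup>2 / 64)) \<le> (\<Sum>c\<in>S. block_risk n \<sigma> T (block n K N b) (staircase n K N H c))" if b: "b < K" for b
    proof -
      define S' where "S' = PiE ({..<K} - {b}) (\<lambda>_. {..<L})"
      let ?f = "\<lambda>c. block_risk n \<sigma> T (block n K N b) (staircase n K N H c)"
      have ins: "{..<K} = insert b ({..<K} - {b})" using b by auto
      \<comment> \<open>A labelling is a label for block \<open>b\<close> together with a labelling
        of the rest, which turns the sum over all hypotheses into a sum of testing problems for
        block \<open>b\<close>.\<close>
      have S_eq: "S = (\<lambda>(s, c). c(b := s)) ` ({..<L} \<times> S')"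
        unfolding S_def S'_def by (subst ins) (rule PiE_insert_eq)
      have inj: "inj_on (\<lambda>(s, c). c(b := s)) ({..<L} \<times> S')"
        unfolding S'_def by (rule inj_combinator) simp
      have "real (L ^ K) = real (card S') * real L"
      proof -
        have "card S = card ({..<L} \<times> S')" unfolding S_eq by (rule card_image [OF inj])
        then show ?thesis using cardS by (simp add: card_cartesian_product mult.commute flip: of_nat_mult of_nat_power)
      qed
      then have "real (L ^ K) * (H\<^sup>2 / 64) = real (card S') * (real L * (H\<^sup>2 / 64))" by simp
      then have "ennreal (real (L ^ K) * (H\<^sup>2 / 64)) = (\<Sum>c\<in>S'. ennreal (real L * (H\<^sup>2 / 64)))"
        by (simp only: ennreal_mult' of_nat_0_le_iff sum_constant ennreal_of_nat_eq_real_of_nat)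
      also have "\<dots> \<le> (\<Sum>c\<in>S'. \<Sum>s<L. ?f (c(b := s)))"
        by (intro sum_mono blockrisk T b)
      also have "\<dots> = (\<Sum>s<L. \<Sum>c\<in>S'. ?f (c(b := s)))" by (rule sum.swap)
      also have "\<dots> = (\<Sum>(s, c)\<in>{..<L} \<times> S'. ?f (c(b := s)))" by (rule sum.cartesian_product)
      also have "\<dots> = (\<Sum>c\<in>S. ?f c)"
        unfolding S_eq by (subst sum.reindex [OF inj]) (auto intro!: sum.cong)
      finally show ?thesis .
    qed
    have "ennreal (real (card S) * (\<sigma>\<^sup>2 * (real K * ln (real (levels N)) / 128))) = (\<Sum>b<K. ennreal (real (L ^ K) * (H\<^sup>2 / 64)))"
    proof -
      have "real (card S) * (\<sigma>\<^sup>2 * (real K * ln (real (levels N)) / 128)) = real K * (real (L ^ K) * (H\<^sup>2 / 64))"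
        by (simp add: cardS H L_def)
      then show ?thesis by (simp only: ennreal_mult' of_nat_0_le_iff) (simp add: ennreal_of_nat_eq_real_of_nat)
    qed
    also have "\<dots> \<le> (\<Sum>b<K. \<Sum>c\<in>S. block_risk n \<sigma> T (block n K N b) (staircase n K N H c))"
      by (intro sum_mono inner) simp
    also have "\<dots> = (\<Sum>c\<in>S. \<Sum>b<K. block_risk n \<sigma> T (block n K N b) (staircase n K N H c))" by (rule sum.swap)
    also have "\<dots> \<le> (\<Sum>c\<in>S. sq_risk n \<sigma> T (staircase n K N H c))"
      by (intro sum_mono sum_block_risk_le \<sigma> T K)
    finally show "ennreal (real (card S) * (\<sigma>\<^sup>2 * (real K * ln (real (levels N)) / 128))) \<le> (\<Sum>c\<in>S. sq_risk n \<sigma> T (staircase n K N H c))" .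
  qed
qed

section \<open>Inner products of noise with unimodal vectors\<close>

text \<open>Gluing by Cauchy-Schwarz: if \<open>c\<close> holds squared norms of parts with disjoint
  supports, the noise factors \<open>b\<close> simply add.\<close>

lemma sum_square_le_parts:
  fixes a b c :: "'i \<Rightarrow> real"
  assumes "\<And>q. q \<in> Q \<Longrightarrow> (a q)\<^sup>2 \<le> b q * c q" "\<And>q. q \<in> Q \<Longrightarrow> 0 \<le> b q" "\<And>q. q \<in> Q \<Longrightarrow> 0 \<le> c q"
  shows "(\<Sum>q\<in>Q. a q)\<^sup>2 \<le> (\<Sum>q\<in>Q. b q) * (\<Sum>q\<in>Q. c q)"
proof -
  have ab: "\<bar>a q\<bar> \<le> sqrt (b q) * sqrt (c q)" if "q \<in> Q" for q
    using assms(1) [OF that] by (metis real_sqrt_abs real_sqrt_le_iff real_sqrt_mult)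
  have "\<bar>\<Sum>q\<in>Q. a q\<bar> \<le> (\<Sum>q\<in>Q. sqrt (b q) * sqrt (c q))"
    by (rule order_trans [OF sum_abs sum_mono]) (rule ab)
  then have "(\<Sum>q\<in>Q. a q)\<^sup>2 \<le> (\<Sum>q\<in>Q. sqrt (b q) * sqrt (c q))\<^sup>2"
    by (intro power2_le_iff_abs_le [THEN iffD2]) (auto intro!: sum_nonneg simp: assms)
  also have "\<dots> \<le> (\<Sum>q\<in>Q. (sqrt (b q))\<^sup>2) * (\<Sum>q\<in>Q. (sqrt (c q))\<^sup>2)"
    by (rule Cauchy_Schwarz_ineq_sum)
  also have "\<dots> = (\<Sum>q\<in>Q. b q) * (\<Sum>q\<in>Q. c q)"
    by (intro arg_cong2 [where f = "(*)"] sum.cong) (auto simp: assms)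
  finally show ?thesis .
qed

lemma square_add_le_parts:
  fixes a1 a2 b1 b2 c1 c2 :: real
  assumes "a1\<^sup>2 \<le> b1 * c1" "a2\<^sup>2 \<le> b2 * c2" "0 \<le> b1" "0 \<le> b2" "0 \<le> c1" "0 \<le> c2"
  shows "(a1 + a2)\<^sup>2 \<le> (b1 + b2) * (c1 + c2)"
  using sum_square_le_parts [of UNIV "\<lambda>q. if q then a1 else a2" "\<lambda>q. if q then b1 else b2" "\<lambda>q. if q then c1 else c2"] assms
  by (simp add: UNIV_bool add.commute)

lemma truncated_decreasing:
  fixes w :: "nat \<Rightarrow> real"
  assumes w: "\<And>i j. i \<le> j \<Longrightarrow> j < N \<Longrightarrow> w j \<le> w i" "\<And>i. i < N \<Longrightarrow> 0 \<le> w i"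
  shows "decseq (\<lambda>j. if j < N then w j else 0)"
  using w by (auto simp: decseq_def)

text \<open>Padding \<open>w\<close> with zeros up to \<open>M\<close> keeps \<open>N\<close> out of
  the noise functional. This matters when \<open>N\<close> is determined by the mode of the fit
  while \<open>M\<close> is the length of a fixed interval. The drop to zero after the last entry is
  the extra jump in \<open>+ 1\<close>.\<close>

lemma monotone_inner_le_lil:
  fixes g w :: "nat \<Rightarrow> real"
  assumes N: "N \<le> M" "M \<ge> 1"
    and w: "\<And>i j. i \<le> j \<Longrightarrow> j < N \<Longrightarrow> w j \<le> w i" "\<And>i. i < N \<Longrightarrow> 0 \<le> w i"
    and m: "card {r. Suc r < N \<and> w r \<noteq> w (Suc r)} + 1 \<le> m" and s: "s \<ge> 0"
  shows "(\<Sum>j<N. g j * w j)\<^sup>2 \<le> min (real m) (1 + ln (real M)) * lil M s g * (\<Sum>j<N. (w j)\<^sup>2)"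
proof -
  define u where "u = (\<lambda>j. if j < N then w j else 0)"
  have u: "decseq u" "\<And>r. r \<ge> M \<Longrightarrow> u r = 0"
    unfolding u_def using truncated_decreasing [of N w] w N by auto
  have "{r. r < M \<and> u r \<noteq> u (Suc r)} \<subseteq> insert (N - 1) {r. Suc r < N \<and> w r \<noteq> w (Suc r)}"
    by (auto simp: u_def split: if_splits)
  moreover have fin: "finite {r. Suc r < N \<and> w r \<noteq> w (Suc r)}"
    by (rule finite_subset [of _ "{..<N}"]) auto
  ultimately have "card {r. r < M \<and> u r \<noteq> u (Suc r)} \<le> card (insert (N - 1) {r. Suc r < N \<and> w r \<noteq> w (Suc r)})"
    by (intro card_mono) auto
  also have "\<dots> \<le> m" using m card_insert_le_m1 [of m "{r. Suc r < N \<and> w r \<noteq> w (Suc r)}" "N - 1"]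
    by (simp add: card_insert_if fin split: if_splits)
  finally have "(\<Sum>j<M. g j * u j)\<^sup>2 \<le> min (real m) (1 + ln (real M)) * lil M s g * (\<Sum>j<M. (u j)\<^sup>2)"
    by (intro decreasing_inner_le_lil u N s)
  moreover have "(\<Sum>j<M. g j * u j) = (\<Sum>j<N. g j * w j)" "(\<Sum>j<M. (u j)\<^sup>2) = (\<Sum>j<N. (w j)\<^sup>2)"
    using N by (auto intro!: sum.mono_neutral_cong_right simp: u_def split: if_splits)
  ultimately show ?thesis by simp
qed

lemma monotone_inner_le_shells:
  fixes g w :: "nat \<Rightarrow> real"
  assumes N: "N \<le> M" "M \<ge> 1"
    and w: "\<And>i j. i \<le> j \<Longrightarrow> j < N \<Longrightarrow> w j \<le> w i" "\<And>i. i < N \<Longrightarrow> 0 \<le> w i"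
  shows "(\<Sum>j<N. g j * w j)\<^sup>2 \<le> 2 * shell_sum M g * (\<Sum>j<N. (w j)\<^sup>2)"
proof -
  define u where "u = (\<lambda>j. if j < N then w j else 0)"
  have u: "decseq u" "\<And>r. r \<ge> M \<Longrightarrow> u r = 0"
    unfolding u_def using truncated_decreasing [of N w] w N by auto
  have "(\<Sum>j<M. g j * u j)\<^sup>2 \<le> 2 * shell_sum M g * (\<Sum>j<M. (u j)\<^sup>2)"
    by (intro decreasing_inner_le_shells u N)
  moreover have "(\<Sum>j<M. g j * u j) = (\<Sum>j<N. g j * w j)" "(\<Sum>j<M. (u j)\<^sup>2) = (\<Sum>j<N. (w j)\<^sup>2)"
    using N by (auto intro!: sum.mono_neutral_cong_right simp: u_def split: if_splits)
  ultimately show ?thesis by simp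
qed

section \<open>Intervals read from either end, and signed vectors\<close>

lemma sum_Ioc_upwards: "(\<Sum>i\<in>{x<..y}. f i) = (\<Sum>j<y - x. f (Suc x + j))" for f :: "nat \<Rightarrow> real"
  by (rule sum.reindex_bij_witness [of _ "\<lambda>j. Suc x + j" "\<lambda>i. i - Suc x"]) auto

lemma sum_Ioc_downwards: "(\<Sum>i\<in>{x<..y}. f i) = (\<Sum>j<y - x. f (y - j))" for f :: "nat \<Rightarrow> real"
  by (rule sum.reindex_bij_witness [of _ "\<lambda>j. y - j" "\<lambda>i. y - i"]) auto

definition jumps :: "nat \<Rightarrow> nat \<Rightarrow> (nat \<Rightarrow> 'a) \<Rightarrow> nat set" where
  "jumps x y v = {i. x < i \<and> i < y \<and> v i \<noteq> v (Suc i)}"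

lemma finite_jumps [simp]: "finite (jumps x y v)"
  by (rule finite_subset [of _ "{..<y}"]) (auto simp: jumps_def)

lemma jumps_mono: "x \<le> x' \<Longrightarrow> y' \<le> y \<Longrightarrow> jumps x' y' v \<subseteq> jumps x y v"
  by (auto simp: jumps_def)

lemma antimono_Ioc_le_lil:
  fixes z h :: "nat \<Rightarrow> real"
  assumes M: "y - x \<le> M" "M \<ge> 1"
    and h: "\<And>i j. x < i \<Longrightarrow> i \<le> j \<Longrightarrow> j \<le> y \<Longrightarrow> h j \<le> h i" "\<And>i. x < i \<Longrightarrow> i \<le> y \<Longrightarrow> 0 \<le> h i"
    and m: "card (jumps x y h) + 1 \<le> m" and s: "s \<ge> 0"
  shows "(\<Sum>i\<in>{x<..y}. z i * h i)\<^sup>2 \<le> min (real m) (1 + ln (real M)) * lil M s (\<lambda>j. z (Suc x + j)) * (\<Sum>i\<in>{x<..y}. (h i)\<^sup>2)"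
proof -
  have "card {r. Suc r < y - x \<and> h (Suc x + r) \<noteq> h (Suc x + Suc r)} \<le> card (jumps x y h)"
    by (rule card_inj_on_le [of "\<lambda>r. Suc x + r"]) (auto simp: jumps_def inj_on_def)
  then show ?thesis unfolding sum_Ioc_upwards
    by (intro monotone_inner_le_lil [where w = "\<lambda>j. h (Suc x + j)"]) (use M h m s in auto)
qed

lemma mono_Ioc_le_lil:
  fixes z h :: "nat \<Rightarrow> real"
  assumes M: "y - x \<le> M" "M \<ge> 1"
    and h: "\<And>i j. x < i \<Longrightarrow> i \<le> j \<Longrightarrow> j \<le> y \<Longrightarrow> h i \<le> h j" "\<And>i. x < i \<Longrightarrow> i \<le> y \<Longrightarrow> 0 \<le> h i"
    and m: "card (jumps x y h) + 1 \<le> m" and s: "s \<ge> 0"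
  shows "(\<Sum>i\<in>{x<..y}. z i * h i)\<^sup>2 \<le> min (real m) (1 + ln (real M)) * lil M s (\<lambda>j. z (y - j)) * (\<Sum>i\<in>{x<..y}. (h i)\<^sup>2)"
proof -
  have "card {r. Suc r < y - x \<and> h (y - r) \<noteq> h (y - Suc r)} \<le> card (jumps x y h)"
  proof (rule card_inj_on_le [of "\<lambda>r. y - Suc r"])
    show "(\<lambda>r. y - Suc r) ` {r. Suc r < y - x \<and> h (y - r) \<noteq> h (y - Suc r)} \<subseteq> jumps x y h"
      by (auto simp: jumps_def Suc_diff_Suc)
  qed (auto simp: inj_on_def)
  then show ?thesis unfolding sum_Ioc_downwards
    by (intro monotone_inner_le_lil [where w = "\<lambda>j. h (y - j)"]) (use M h m s in auto)
qed

lemma antimono_Ioc_le_shells: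
  fixes z h :: "nat \<Rightarrow> real"
  assumes M: "y - x \<le> M" "M \<ge> 1"
    and h: "\<And>i j. x < i \<Longrightarrow> i \<le> j \<Longrightarrow> j \<le> y \<Longrightarrow> h j \<le> h i" "\<And>i. x < i \<Longrightarrow> i \<le> y \<Longrightarrow> 0 \<le> h i"
  shows "(\<Sum>i\<in>{x<..y}. z i * h i)\<^sup>2 \<le> 2 * shell_sum M (\<lambda>j. z (Suc x + j)) * (\<Sum>i\<in>{x<..y}. (h i)\<^sup>2)"
  unfolding sum_Ioc_upwards
  by (intro monotone_inner_le_shells [where w = "\<lambda>j. h (Suc x + j)"]) (use M h in auto)

lemma mono_Ioc_le_shells:
  fixes z h :: "nat \<Rightarrow> real"
  assumes M: "y - x \<le> M" "M \<ge> 1"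
    and h: "\<And>i j. x < i \<Longrightarrow> i \<le> j \<Longrightarrow> j \<le> y \<Longrightarrow> h i \<le> h j" "\<And>i. x < i \<Longrightarrow> i \<le> y \<Longrightarrow> 0 \<le> h i"
  shows "(\<Sum>i\<in>{x<..y}. z i * h i)\<^sup>2 \<le> 2 * shell_sum M (\<lambda>j. z (y - j)) * (\<Sum>i\<in>{x<..y}. (h i)\<^sup>2)"
  unfolding sum_Ioc_downwards
  by (intro monotone_inner_le_shells [where w = "\<lambda>j. h (y - j)"]) (use M h in auto)

definition pos :: "real \<Rightarrow> real" where "pos t = max t 0"
definition neg :: "real \<Rightarrow> real" where "neg t = max (- t) 0"

lemma pos_neg:
  "0 \<le> pos t" "0 \<le> neg t" "t = pos t - neg t" "t\<^sup>2 = (pos t)\<^sup>2 + (neg t)\<^sup>2"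
  "s \<le> t \<Longrightarrow> pos s \<le> pos t" "s \<le> t \<Longrightarrow> neg t \<le> neg s"
  by (auto simp: pos_def neg_def max_def)

lemma sum_pos_neg:
  "(\<Sum>i\<in>I. z i * V i) = (\<Sum>i\<in>I. z i * pos (V i)) + - (\<Sum>i\<in>I. z i * neg (V i))"
  "(\<Sum>i\<in>I. (V i)\<^sup>2) = (\<Sum>i\<in>I. (pos (V i))\<^sup>2) + (\<Sum>i\<in>I. (neg (V i))\<^sup>2)"
proof -
  have "(\<Sum>i\<in>I. z i * V i) = (\<Sum>i\<in>I. z i * pos (V i) - z i * neg (V i))"
    by (rule sum.cong [OF refl]) (subst pos_neg(3), simp add: algebra_simps)
  then show "(\<Sum>i\<in>I. z i * V i) = (\<Sum>i\<in>I. z i * pos (V i)) + - (\<Sum>i\<in>I. z i * neg (V i))"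
    by (simp add: sum_subtractf)
  show "(\<Sum>i\<in>I. (V i)\<^sup>2) = (\<Sum>i\<in>I. (pos (V i))\<^sup>2) + (\<Sum>i\<in>I. (neg (V i))\<^sup>2)"
    unfolding sum.distrib [symmetric] by (rule sum.cong [OF refl]) (rule pos_neg(4))
qed

lemma card_jumps_comp_le: "card (jumps x y (\<lambda>i. F (v i))) \<le> card (jumps x y v)"
  by (intro card_mono finite_jumps) (auto simp: jumps_def)

definition lil2 :: "nat \<Rightarrow> nat \<Rightarrow> real \<Rightarrow> (nat \<Rightarrow> real) \<Rightarrow> real" where
  "lil2 x y s z = lil (y - x) s (\<lambda>j. z (Suc x + j)) + lil (y - x) s (\<lambda>j. z (y - j))"

definition piece_factor :: "nat \<Rightarrow> nat \<Rightarrow> (nat \<Rightarrow> real) \<Rightarrow> real" where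
  "piece_factor x y V = min (real (card (jumps x y V) + 1)) (1 + ln (real (y - x)))"

lemma piece_factor_nonneg: "x < y \<Longrightarrow> 0 \<le> piece_factor x y V"
  by (auto simp: piece_factor_def min_def intro!: add_nonneg_nonneg ln_ge_zero)

text \<open>If \<open>V\<close> increases, its positive part decreases away from \<open>y\<close>
  and its negative part away from \<open>x\<close>; if \<open>V\<close> decreases, the ends are
  exchanged. Either way both parts are anchored at the ends of the interval, not at a point chosen
  by the fit.\<close>

lemma monotone_on_Ioc_bound:
  fixes z V :: "nat \<Rightarrow> real"
  assumes xy: "x < y" and s: "s \<ge> 0"
    and V: "(\<forall>i j. x < i \<longrightarrow> i \<le> j \<longrightarrow> j \<le> y \<longrightarrow> V i \<le> V j) \<or> (\<forall>i j. x < i \<longrightarrow> i \<le> j \<longrightarrow> j \<le> y \<longrightarrow> V j \<le> V i)"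
  shows "(\<Sum>i\<in>{x<..y}. z i * V i)\<^sup>2 \<le> piece_factor x y V * lil2 x y s z * (\<Sum>i\<in>{x<..y}. (V i)\<^sup>2)"
proof -
  define k where "k = card (jumps x y V) + 1"
  have c: "piece_factor x y V = min (real k) (1 + ln (real (y - x)))" by (simp add: piece_factor_def k_def)
  have kp: "card (jumps x y (\<lambda>i. pos (V i))) + 1 \<le> k" "card (jumps x y (\<lambda>i. neg (V i))) + 1 \<le> k"
    using card_jumps_comp_le [of x y pos V] card_jumps_comp_le [of x y neg V] by (auto simp: k_def)
  define U where "U = lil (y - x) s (\<lambda>j. z (Suc x + j))"
  define D where "D = lil (y - x) s (\<lambda>j. z (y - j))"
  have UD: "0 \<le> U" "0 \<le> D" using s by (auto simp: U_def D_def lil_nonneg)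
  have c0: "0 \<le> piece_factor x y V" using xy by (rule piece_factor_nonneg)
  from V show ?thesis
  proof
    assume inc: "\<forall>i j. x < i \<longrightarrow> i \<le> j \<longrightarrow> j \<le> y \<longrightarrow> V i \<le> V j"
    have 1: "(\<Sum>i\<in>{x<..y}. z i * pos (V i))\<^sup>2 \<le> (piece_factor x y V * D) * (\<Sum>i\<in>{x<..y}. (pos (V i))\<^sup>2)"
      unfolding c D_def by (rule mono_Ioc_le_lil) (use xy s inc kp pos_neg in auto)
    have 2: "(- (\<Sum>i\<in>{x<..y}. z i * neg (V i)))\<^sup>2 \<le> (piece_factor x y V * U) * (\<Sum>i\<in>{x<..y}. (neg (V i))\<^sup>2)"
      unfolding c U_def power2_minus by (rule antimono_Ioc_le_lil) (use xy s inc kp pos_neg in auto)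
    show ?thesis
      using square_add_le_parts [OF 1 2] UD c0 unfolding lil2_def U_def [symmetric] D_def [symmetric] sum_pos_neg(1) [where V = V] sum_pos_neg(2) [where V = V]
      by (simp add: sum_nonneg distrib_left add.commute)
  next
    assume dec: "\<forall>i j. x < i \<longrightarrow> i \<le> j \<longrightarrow> j \<le> y \<longrightarrow> V j \<le> V i"
    have 1: "(\<Sum>i\<in>{x<..y}. z i * pos (V i))\<^sup>2 \<le> (piece_factor x y V * U) * (\<Sum>i\<in>{x<..y}. (pos (V i))\<^sup>2)"
      unfolding c U_def by (rule antimono_Ioc_le_lil) (use xy s dec kp pos_neg in auto)
    have 2: "(- (\<Sum>i\<in>{x<..y}. z i * neg (V i)))\<^sup>2 \<le> (piece_factor x y V * D) * (\<Sum>i\<in>{x<..y}. (neg (V i))\<^sup>2)"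
      unfolding c D_def power2_minus by (rule mono_Ioc_le_lil) (use xy s dec kp pos_neg in auto)
    show ?thesis
      using square_add_le_parts [OF 1 2] UD c0 unfolding lil2_def U_def [symmetric] D_def [symmetric] sum_pos_neg(1) [where V = V] sum_pos_neg(2) [where V = V]
      by (simp add: sum_nonneg distrib_left add.commute)
  qed
qed

definition mode_term :: "nat \<Rightarrow> nat \<Rightarrow> (nat \<Rightarrow> real) \<Rightarrow> real" where
  "mode_term n e z = 2 * shell_sum e (\<lambda>j. z (e - j)) + 2 * shell_sum (n - e) (\<lambda>j. z (Suc e + j))"

lemma shell_sum_nonneg: "0 \<le> shell_sum N g"
  unfolding shell_sum_def by (intro sum_nonneg wmax_nonneg)

text \<open>On both sides of \<open>e\<close> the negative part still decreases away from
  \<open>x\<close> or \<open>y\<close>. Only the positive part decreases away from \<open>e\<close>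
  itself and needs \<open>mode_term\<close>, which reads the noise all the way to \<open>1\<close>
  and to \<open>n\<close> and so depends on \<open>e\<close> but not on the interval.\<close>

lemma unimodal_on_Ioc_bound:
  fixes z V :: "nat \<Rightarrow> real"
  assumes xy: "x < e" "e < y" "y \<le> n" and s: "s \<ge> 0"
    and inc: "\<And>i j. x < i \<Longrightarrow> i \<le> j \<Longrightarrow> j \<le> e \<Longrightarrow> V i \<le> V j"
    and dec: "\<And>i j. e < i \<Longrightarrow> i \<le> j \<Longrightarrow> j \<le> y \<Longrightarrow> V j \<le> V i"
  shows "(\<Sum>i\<in>{x<..y}. z i * V i)\<^sup>2 \<le> (piece_factor x y V * lil2 x y s z + mode_term n e z) * (\<Sum>i\<in>{x<..y}. (V i)\<^sup>2)"
proof -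
  define k where "k = card (jumps x y V) + 1"
  have c: "piece_factor x y V = min (real k) (1 + ln (real (y - x)))" by (simp add: piece_factor_def k_def)
  have "card (jumps x e (\<lambda>i. neg (V i))) \<le> card (jumps x y V)" "card (jumps e y (\<lambda>i. neg (V i))) \<le> card (jumps x y V)"
    using xy by (intro order_trans [OF card_jumps_comp_le card_mono [OF finite_jumps jumps_mono]]; simp)+
  then have kp: "card (jumps x e (\<lambda>i. neg (V i))) + 1 \<le> k" "card (jumps e y (\<lambda>i. neg (V i))) + 1 \<le> k"
    by (auto simp: k_def)
  define U where "U = lil (y - x) s (\<lambda>j. z (Suc x + j))"
  define D where "D = lil (y - x) s (\<lambda>j. z (y - j))"
  define R1 where "R1 = 2 * shell_sum e (\<lambda>j. z (e - j))"
  define R2 where "R2 = 2 * shell_sum (n - e) (\<lambda>j. z (Suc e + j))"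
  have UD: "0 \<le> U" "0 \<le> D" "0 \<le> R1" "0 \<le> R2" using s by (auto simp: U_def D_def lil_nonneg R1_def R2_def shell_sum_nonneg)
  have c0: "0 \<le> piece_factor x y V" using xy by (intro piece_factor_nonneg) auto
  have 1: "(\<Sum>i\<in>{x<..e}. z i * pos (V i))\<^sup>2 \<le> R1 * (\<Sum>i\<in>{x<..e}. (pos (V i))\<^sup>2)"
    unfolding R1_def by (rule mono_Ioc_le_shells) (use xy inc pos_neg in auto)
  have 2: "(- (\<Sum>i\<in>{x<..e}. z i * neg (V i)))\<^sup>2 \<le> (piece_factor x y V * U) * (\<Sum>i\<in>{x<..e}. (neg (V i))\<^sup>2)"
    unfolding c U_def power2_minus by (rule antimono_Ioc_le_lil) (use xy s inc kp pos_neg in auto)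
  have 3: "(\<Sum>i\<in>{e<..y}. z i * pos (V i))\<^sup>2 \<le> R2 * (\<Sum>i\<in>{e<..y}. (pos (V i))\<^sup>2)"
    unfolding R2_def by (rule antimono_Ioc_le_shells) (use xy dec pos_neg in auto)
  have 4: "(- (\<Sum>i\<in>{e<..y}. z i * neg (V i)))\<^sup>2 \<le> (piece_factor x y V * D) * (\<Sum>i\<in>{e<..y}. (neg (V i))\<^sup>2)"
    unfolding c D_def power2_minus by (rule mono_Ioc_le_lil) (use xy s dec kp pos_neg in auto)
  have L: "(\<Sum>i\<in>{x<..e}. z i * V i)\<^sup>2 \<le> (R1 + piece_factor x y V * U) * (\<Sum>i\<in>{x<..e}. (V i)\<^sup>2)"
    using square_add_le_parts [OF 1 2] UD c0 unfolding sum_pos_neg(1) [where V = V] sum_pos_neg(2) [where V = V] by (simp add: sum_nonneg)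
  have R: "(\<Sum>i\<in>{e<..y}. z i * V i)\<^sup>2 \<le> (R2 + piece_factor x y V * D) * (\<Sum>i\<in>{e<..y}. (V i)\<^sup>2)"
    using square_add_le_parts [OF 3 4] UD c0 unfolding sum_pos_neg(1) [where V = V] sum_pos_neg(2) [where V = V] by (simp add: sum_nonneg)
  have split: "(\<Sum>i\<in>{x<..y}. f i) = (\<Sum>i\<in>{x<..e}. f i) + (\<Sum>i\<in>{e<..y}. f i)" for f :: "nat \<Rightarrow> real"
  proof -
    have "{x<..y} = {x<..e} \<union> {e<..y}" using xy by auto
    then show ?thesis by (simp add: sum.union_disjoint)
  qed
  have "(\<Sum>i\<in>{x<..y}. z i * V i)\<^sup>2 \<le> ((R1 + piece_factor x y V * U) + (R2 + piece_factor x y V * D)) * (\<Sum>i\<in>{x<..y}. (V i)\<^sup>2)"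
    unfolding split using UD c0 by (intro square_add_le_parts L R) (auto simp: sum_nonneg)
  also have "(R1 + piece_factor x y V * U) + (R2 + piece_factor x y V * D) = piece_factor x y V * lil2 x y s z + mode_term n e z"
    by (simp add: lil2_def mode_term_def U_def D_def R1_def R2_def algebra_simps)
  finally show ?thesis .
qed

text \<open>The random part of \<open>lil2\<close>, isolated so that it and the deterministic
  \<open>4 * s\<close> can be given different factors.\<close>

definition excess :: "nat \<Rightarrow> nat \<Rightarrow> real \<Rightarrow> (nat \<Rightarrow> real) \<Rightarrow> real" where
  "excess x y s z = (\<Sum>i<levels (y - x). exp ((wmax (min (2 ^ Suc i) (y - x)) (\<lambda>j. z (Suc x + j)) - s) / 4))
     + (\<Sum>i<levels (y - x). exp ((wmax (min (2 ^ Suc i) (y - x)) (\<lambda>j. z (y - j)) - s) / 4))"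

lemma excess_nonneg: "0 \<le> excess x y s z"
  unfolding excess_def by (intro add_nonneg_nonneg sum_nonneg) auto

lemma lil2_eq: "lil2 x y s z = 4 * s + 8 * excess x y s z"
  by (simp add: lil2_def lil_def excess_def algebra_simps)

section \<open>Gluing over a partition of the index range\<close>

definition succ_in :: "nat set \<Rightarrow> nat \<Rightarrow> nat" where
  "succ_in P p = Min {q \<in> P. p < q}"

lemma succ_in:
  assumes "finite P" "n \<in> P" "p < n"
  shows "p < succ_in P p" "succ_in P p \<in> P" "succ_in P p \<le> n" "\<And>q. q \<in> P \<Longrightarrow> p < q \<Longrightarrow> succ_in P p \<le> q"
proof -
  have ne: "finite {q \<in> P. p < q}" "{q \<in> P. p < q} \<noteq> {}" using assms by auto
  have "Min {q \<in> P. p < q} \<in> {q \<in> P. p < q}" using ne by (rule Min_in)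
  then show "p < succ_in P p" "succ_in P p \<in> P" by (auto simp: succ_in_def)
  show "succ_in P p \<le> q" if "q \<in> P" "p < q" for q
    unfolding succ_in_def using ne that by (intro Min_le) auto
  then show "succ_in P p \<le> n" using assms by blast
qed

lemma Ioc_partition:
  assumes P: "finite P" "P \<subseteq> {0..n}" "0 \<in> P" "n \<in> P"
  shows "{1..n} = (\<Union>p\<in>P - {n}. {p<..succ_in P p})"
    and "\<And>p q. p \<in> P - {n} \<Longrightarrow> q \<in> P - {n} \<Longrightarrow> p \<noteq> q \<Longrightarrow> {p<..succ_in P p} \<inter> {q<..succ_in P q} = {}"
proof -
  have lt: "p < n" if "p \<in> P - {n}" for p using that P by auto
  show "{1..n} = (\<Union>p\<in>P - {n}. {p<..succ_in P p})"
  proof (intro equalityI subsetI)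
    fix i assume i: "i \<in> {1..n}"
    define p where "p = Max {q \<in> P. q < i}"
    have ne: "finite {q \<in> P. q < i}" "{q \<in> P. q < i} \<noteq> {}" using P i by auto
    have "p \<in> {q \<in> P. q < i}" unfolding p_def using ne by (rule Max_in)
    then have p: "p \<in> P" "p < i" by auto
    have "p < n" using p i by auto
    have "i \<le> succ_in P p"
    proof (rule ccontr)
      assume "\<not> i \<le> succ_in P p"
      then have "succ_in P p \<le> p"
        using succ_in(2) [OF P(1,4) \<open>p < n\<close>] ne unfolding p_def by (intro Max_ge) auto
      then show False using succ_in(1) [OF P(1,4) \<open>p < n\<close>] by simp
    qed
    then show "i \<in> (\<Union>p\<in>P - {n}. {p<..succ_in P p})" using p \<open>p < n\<close> by auto
  next
    fix i assume "i \<in> (\<Union>p\<in>P - {n}. {p<..succ_in P p})"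
    then obtain p where "p \<in> P - {n}" "p < i" "i \<le> succ_in P p" by auto
    then show "i \<in> {1..n}" using succ_in(3) [OF P(1,4) lt] by fastforce
  qed
  show "{p<..succ_in P p} \<inter> {q<..succ_in P q} = {}" if pq: "p \<in> P - {n}" "q \<in> P - {n}" "p \<noteq> q" for p q
  proof (cases "p < q")
    case True
    then have "succ_in P p \<le> q" using succ_in(4) [OF P(1,4) lt [OF pq(1)]] pq by auto
    then show ?thesis by auto
  next
    case False
    then have "succ_in P q \<le> p" using succ_in(4) [OF P(1,4) lt [OF pq(2)]] pq by auto
    then show ?thesis by auto
  qed
qed

lemma sum_jumps_partition:
  assumes P: "finite P" "P \<subseteq> {0..n}" "0 \<in> P" "n \<in> P"
  shows "(\<Sum>p\<in>P - {n}. card (jumps p (succ_in P p) v)) \<le> card (jumps 0 n v)"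
proof -
  have "(\<Sum>p\<in>P - {n}. card (jumps p (succ_in P p) v)) = card (\<Union>p\<in>P - {n}. jumps p (succ_in P p) v)"
  proof (rule card_UN_disjoint [symmetric])
    show "\<forall>p\<in>P - {n}. \<forall>q\<in>P - {n}. p \<noteq> q \<longrightarrow> jumps p (succ_in P p) v \<inter> jumps q (succ_in P q) v = {}"
      using Ioc_partition(2) [OF P] by (fastforce simp: jumps_def)
  qed (use P in auto)
  also have "\<dots> \<le> card (jumps 0 n v)"
  proof (intro card_mono finite_jumps UN_least jumps_mono)
    fix p assume "p \<in> P - {n}"
    then show "succ_in P p \<le> n" using P by (intro succ_in(3)) auto
  qed auto
  finally show ?thesis .
qed

text \<open>No relation between \<open>v e\<close> and \<open>v (Suc e)\<close> is asked for, so the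
  top may be on either side; \<open>e = 0\<close> and \<open>e = n\<close> are the monotone
  cases.\<close>

definition split_at :: "nat \<Rightarrow> nat \<Rightarrow> (nat \<Rightarrow> real) \<Rightarrow> bool" where
  "split_at n e v \<longleftrightarrow> e \<le> n \<and> (\<forall>i j. 1 \<le> i \<longrightarrow> i \<le> j \<longrightarrow> j \<le> e \<longrightarrow> v i \<le> v j)
     \<and> (\<forall>i j. e < i \<longrightarrow> i \<le> j \<longrightarrow> j \<le> n \<longrightarrow> v j \<le> v i)"

text \<open>Subtracting a constant changes neither order nor jumps, so on each interval the
  difference behaves like \<open>v\<close>. The factors of the intervals add: the jump counts total
  at most the jumps of \<open>v\<close> plus the number of intervals, and at most one interval has
  \<open>e\<close> strictly inside. The factor sees \<open>v\<close> only through its jump count and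
  \<open>e\<close>.\<close>

lemma noise_inner_bound:
  fixes z v \<theta> :: "nat \<Rightarrow> real"
  assumes P: "finite P" "P \<subseteq> {0..n}" "0 \<in> P" "n \<in> P"
    and len: "\<And>p. p \<in> P - {n} \<Longrightarrow> succ_in P p - p \<le> N"
    and const: "\<And>p i. p \<in> P - {n} \<Longrightarrow> p < i \<Longrightarrow> i \<le> succ_in P p \<Longrightarrow> \<theta> i = \<theta> (Suc p)"
    and v: "split_at n e v" and s: "s \<ge> 0"
  shows "(\<Sum>i\<in>{1..n}. z i * (v i - \<theta> i))\<^sup>2
     \<le> (4 * s * real (card (jumps 0 n v) + card P) + 8 * (1 + ln (real N)) * (\<Sum>p\<in>P - {n}. excess p (succ_in P p) s z)
          + (if 0 < e \<and> e < n then mode_term n e z else 0)) * (\<Sum>i\<in>{1..n}. (v i - \<theta> i)\<^sup>2)"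
proof -
  define Q where "Q = P - {n}"
  define V where "V = (\<lambda>i. v i - \<theta> i)"
  define m where "m = (\<lambda>p. if p < e \<and> e < succ_in P p then mode_term n e z else 0)"
  define a where "a = (\<lambda>p. \<Sum>i\<in>{p<..succ_in P p}. z i * V i)"
  define c where "c = (\<lambda>p. \<Sum>i\<in>{p<..succ_in P p}. (V i)\<^sup>2)"
  define b where "b = (\<lambda>p. 4 * s * real (card (jumps p (succ_in P p) v) + 1) + 8 * (1 + ln (real N)) * excess p (succ_in P p) s z + m p)"
  have lt: "p < n" if "p \<in> Q" for p using that P by (auto simp: Q_def)
  have finQ: "finite Q" using P by (simp add: Q_def)
  have mt: "0 \<le> mode_term n e z" by (simp add: mode_term_def shell_sum_nonneg)
  have sumP: "(\<Sum>i\<in>{1..n}. f i) = (\<Sum>p\<in>Q. \<Sum>i\<in>{p<..succ_in P p}. f i)" for f :: "nat \<Rightarrow> real"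
    unfolding Ioc_partition(1) [OF P] Q_def
    by (rule sum.UNION_disjoint) (use P Ioc_partition(2) [OF P] in auto)
  have N1: "1 \<le> N" if "p \<in> Q" for p
    using len [of p] that succ_in(1) [OF P(1,4) lt [OF that]] by (auto simp: Q_def)
  have m0: "0 \<le> m p" for p using mt by (simp add: m_def)
  have b0: "0 \<le> b p" if "p \<in> Q" for p
    unfolding b_def using s m0 N1 [OF that] excess_nonneg
    by (intro add_nonneg_nonneg mult_nonneg_nonneg ln_ge_zero) auto
  have ab: "(a p)\<^sup>2 \<le> b p * c p" if p: "p \<in> Q" for p
  proof -
    define y where "y = succ_in P p"
    have y: "p < y" "y \<le> n" using succ_in [OF P(1,4) lt [OF p]] by (auto simp: y_def)
    have th: "\<theta> i = \<theta> (Suc p)" if "p < i" "i \<le> y" for i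
      using const [of p i] that p by (auto simp: Q_def y_def)
    have jV: "jumps p y V = jumps p y v"
    proof -
      have "\<theta> i = \<theta> (Suc i)" if "p < i" "i < y" for i using th [of i] th [of "Suc i"] that by simp
      then show ?thesis by (auto simp: jumps_def V_def)
    qed
    have VV: "V i \<le> V j \<longleftrightarrow> v i \<le> v j" if "p < i" "i \<le> y" "p < j" "j \<le> y" for i j
      using th [of i] th [of j] that by (simp add: V_def)
    have "(a p)\<^sup>2 \<le> (piece_factor p y V * lil2 p y s z + m p) * c p"
    proof (cases "p < e \<and> e < y")
      case True
      then show ?thesis using v y VV s unfolding a_def c_def m_def y_def [symmetric] split_at_def
        by (simp only: simp_thms if_True) (intro unimodal_on_Ioc_bound; auto)
    next
      case False
      have mon: "(\<forall>i j. p < i \<longrightarrow> i \<le> j \<longrightarrow> j \<le> y \<longrightarrow> V i \<le> V j) \<or> (\<forall>i j. p < i \<longrightarrow> i \<le> j \<longrightarrow> j \<le> y \<longrightarrow> V j \<le> V i)"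
      proof (cases "y \<le> e")
        case True
        have "V i \<le> V j" if "p < i" "i \<le> j" "j \<le> y" for i j
          using v that True VV [of i j] by (auto simp: split_at_def)
        then show ?thesis by blast
      next
        case False
        have "V j \<le> V i" if "p < i" "i \<le> j" "j \<le> y" for i j
          using v that y False \<open>\<not> (p < e \<and> e < y)\<close> VV [of j i] by (auto simp: split_at_def)
        then show ?thesis by blast
      qed
      have "m p = 0" using False by (auto simp: m_def y_def)
      then show ?thesis using monotone_on_Ioc_bound [OF y(1) s mon, of z]
        unfolding a_def c_def y_def [symmetric] by simp
    qed
    also have "piece_factor p y V * lil2 p y s z + m p \<le> b p"
    proof -
      \<comment> \<open>The minimum in \<open>piece_factor\<close> is used both ways: its jump count
        for the deterministic \<open>4 * s\<close>, its logarithm for the excess.\<close>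
      have "piece_factor p y V * (4 * s) \<le> real (card (jumps p y v) + 1) * (4 * s)"
        using s by (intro mult_right_mono) (auto simp: piece_factor_def jV)
      moreover have "piece_factor p y V * (8 * excess p y s z) \<le> (1 + ln (real N)) * (8 * excess p y s z)"
      proof (intro mult_right_mono)
        have "piece_factor p y V \<le> 1 + ln (real (y - p))" by (simp add: piece_factor_def)
        also have "ln (real (y - p)) \<le> ln (real N)"
          using len [of p] p y by (intro ln_mono) (auto simp: Q_def y_def)
        finally show "piece_factor p y V \<le> 1 + ln (real N)" by simp
      qed (simp add: excess_nonneg)
      moreover have "real (card (jumps p y v) + 1) * (4 * s) = 4 * s * real (card (jumps p y v) + 1)"
        "(1 + ln (real N)) * (8 * excess p y s z) = 8 * (1 + ln (real N)) * excess p y s z" by simp_all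
      ultimately show ?thesis unfolding b_def lil2_eq y_def [symmetric] distrib_left by linarith
    qed
    finally show ?thesis by (simp add: c_def mult_right_mono sum_nonneg)
  qed
  have c0: "0 \<le> c p" for p by (simp add: c_def sum_nonneg)
  have "(\<Sum>i\<in>{1..n}. z i * V i)\<^sup>2 \<le> (\<Sum>p\<in>Q. b p) * (\<Sum>p\<in>Q. c p)"
    unfolding sumP a_def [symmetric] by (rule sum_square_le_parts) (auto simp: ab b0 c0)
  also have "(\<Sum>p\<in>Q. c p) = (\<Sum>i\<in>{1..n}. (V i)\<^sup>2)" unfolding sumP c_def ..
  also have "(\<Sum>p\<in>Q. b p) \<le> 4 * s * real (card (jumps 0 n v) + card P) + 8 * (1 + ln (real N)) * (\<Sum>p\<in>Q. excess p (succ_in P p) s z)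
          + (if 0 < e \<and> e < n then mode_term n e z else 0)"
  proof -
    have "(\<Sum>p\<in>Q. 4 * s * real (card (jumps p (succ_in P p) v) + 1)) = 4 * s * real (\<Sum>p\<in>Q. card (jumps p (succ_in P p) v) + 1)"
      by (simp only: of_nat_sum sum_distrib_left)
    also have "\<dots> \<le> 4 * s * real (card (jumps 0 n v) + card P)"
    proof (intro mult_left_mono)
      have "(\<Sum>p\<in>Q. card (jumps p (succ_in P p) v) + 1) = (\<Sum>p\<in>Q. card (jumps p (succ_in P p) v)) + card Q"
        by (subst sum.distrib) simp
      also have "\<dots> \<le> card (jumps 0 n v) + card P"
        using sum_jumps_partition [OF P, of v] P by (intro add_mono card_mono) (auto simp: Q_def)
      finally show "real (\<Sum>p\<in>Q. card (jumps p (succ_in P p) v) + 1) \<le> real (card (jumps 0 n v) + card P)"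
        by (simp only: of_nat_le_iff)
    qed (use s in auto)
    finally have 1: "(\<Sum>p\<in>Q. 4 * s * real (card (jumps p (succ_in P p) v) + 1)) \<le> 4 * s * real (card (jumps 0 n v) + card P)" .
    have 2: "(\<Sum>p\<in>Q. m p) \<le> (if 0 < e \<and> e < n then mode_term n e z else 0)"
    proof (cases "\<exists>p\<in>Q. p < e \<and> e < succ_in P p")
      case True
      then obtain p where p: "p \<in> Q" "p < e" "e < succ_in P p" by blast
      have "m q = 0" if "q \<in> Q - {p}" for q
      proof -
        have "\<not> (q < e \<and> e < succ_in P q)"
          using Ioc_partition(2) [OF P, of p q] p that unfolding Q_def by fastforce
        then show ?thesis by (auto simp: m_def)
      qed
      then have "(\<Sum>q\<in>Q. m q) = m p" using finQ p by (subst sum.remove [of Q p]) auto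
      moreover have "0 < e" "e < n" using p succ_in(3) [OF P(1,4) lt [OF p(1)]] by auto
      ultimately show ?thesis using p by (simp add: m_def)
    next
      case False
      then have "(\<Sum>q\<in>Q. m q) = 0" by (intro sum.neutral) (auto simp: m_def)
      then show ?thesis using mt by simp
    qed
    show ?thesis using 1 2 unfolding b_def sum.distrib by (simp add: sum_distrib_left)
  qed
  finally show ?thesis unfolding V_def Q_def by (simp add: mult_right_mono sum_nonneg)
qed

section \<open>Expected size of the noise\<close>

lemma std_gauss_exp_wmax_shift:
  assumes "m \<ge> 1" "inj_on f {..<m}" "f ` {..<m} \<subseteq> I"
  shows "(\<integral>\<^sup>+ z. ennreal (exp ((wmax m (\<lambda>j. z (f j)) - s) / 4)) \<partial>std_gauss I) \<le> ennreal (exp (- s / 4) * wmax_const)"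
proof -
  have "(\<integral>\<^sup>+ z. ennreal (exp ((wmax m (\<lambda>j. z (f j)) - s) / 4)) \<partial>std_gauss I)
      = (\<integral>\<^sup>+ z. ennreal (exp (- s / 4)) * ennreal (exp (wmax m (\<lambda>j. z (f j)) / 4)) \<partial>std_gauss I)"
    by (intro nn_integral_cong) (simp add: ennreal_mult' [symmetric] exp_add [symmetric] diff_divide_distrib)
  also have "\<dots> = ennreal (exp (- s / 4)) * (\<integral>\<^sup>+ z. ennreal (exp (wmax m (\<lambda>j. z (f j)) / 4)) \<partial>std_gauss I)"
    by (rule nn_integral_cmult) measurable
  also have "\<dots> \<le> ennreal (exp (- s / 4)) * ennreal wmax_const"
    by (intro mult_left_mono std_gauss_exp_wmax assms) auto
  also have "\<dots> = ennreal (exp (- s / 4) * wmax_const)" by (simp add: ennreal_mult')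
  finally show ?thesis .
qed

lemma measurable_excess [measurable]: "excess x y s \<in> borel_measurable (std_gauss I)"
  unfolding excess_def [abs_def] by measurable

lemma std_gauss_excess:
  assumes "x < y" "y \<le> n"
  shows "(\<integral>\<^sup>+ z. ennreal (excess x y s z) \<partial>std_gauss {1..n}) \<le> ennreal (2 * real (levels (y - x)) * (exp (- s / 4) * wmax_const))"
proof -
  define K where "K = exp (- s / 4) * wmax_const"
  have K0: "K \<ge> 0" using wmax_const_ge_1 by (simp add: K_def)
  let ?u = "\<lambda>i z. exp ((wmax (min (2 ^ Suc i) (y - x)) (\<lambda>j. z (Suc x + j)) - s) / 4)"
  let ?d = "\<lambda>i z. exp ((wmax (min (2 ^ Suc i) (y - x)) (\<lambda>j. z (y - j)) - s) / 4)"
  have m1: "min (2 ^ Suc i) (y - x) \<ge> 1" for i using assms by auto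
  have u: "(\<integral>\<^sup>+ z. ennreal (?u i z) \<partial>std_gauss {1..n}) \<le> ennreal K" for i
    unfolding K_def by (rule std_gauss_exp_wmax_shift [OF m1]) (use assms in \<open>auto simp: inj_on_def\<close>)
  have d: "(\<integral>\<^sup>+ z. ennreal (?d i z) \<partial>std_gauss {1..n}) \<le> ennreal K" for i
    unfolding K_def by (rule std_gauss_exp_wmax_shift [OF m1]) (use assms in \<open>auto simp: inj_on_def\<close>)
  have "(\<integral>\<^sup>+ z. ennreal (excess x y s z) \<partial>std_gauss {1..n})
     = (\<integral>\<^sup>+ z. (\<Sum>i<levels (y - x). ennreal (?u i z)) + (\<Sum>i<levels (y - x). ennreal (?d i z)) \<partial>std_gauss {1..n})"
    unfolding excess_def by (intro nn_integral_cong) (simp add: sum_nonneg)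
  also have "\<dots> = (\<Sum>i<levels (y - x). \<integral>\<^sup>+ z. ennreal (?u i z) \<partial>std_gauss {1..n}) + (\<Sum>i<levels (y - x). \<integral>\<^sup>+ z. ennreal (?d i z) \<partial>std_gauss {1..n})"
    by (subst nn_integral_add) (simp_all add: nn_integral_sum del: sum_ennreal)
  also have "\<dots> \<le> (\<Sum>i<levels (y - x). ennreal K) + (\<Sum>i<levels (y - x). ennreal K)"
    by (intro add_mono sum_mono u d)
  also have "\<dots> = ennreal (real (levels (y - x)) * K) + ennreal (real (levels (y - x)) * K)"
    by (simp add: ennreal_mult' ennreal_of_nat_eq_real_of_nat)
  also have "\<dots> = ennreal (2 * real (levels (y - x)) * K)"
    using K0 by (subst ennreal_plus [symmetric]) auto
  finally show ?thesis unfolding K_def .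
qed

text \<open>Disjoint shells under an injective \<open>f\<close> give independent maxima, one factor
  per scale. As there are order log N scales, the moment is polynomial in \<open>N\<close>.\<close>

lemma std_gauss_exp_shell_sum:
  assumes N: "N \<ge> 1" and f: "inj_on f {..<N}" "f ` {..<N} \<subseteq> I"
  shows "(\<integral>\<^sup>+ z. ennreal (exp (shell_sum N (\<lambda>j. z (f j)) / 4)) \<partial>std_gauss I) \<le> ennreal (wmax_const ^ levels N)"
proof -
  have bnd: "2 ^ j - 1 + t < N" if "t < shell_length N j" for j t
    using that by (auto simp: shell_length_def min_def split: if_splits)
  have "f 0 \<in> I" using f N by auto
  then have I: "I \<noteq> {}" by auto
  have "(\<integral>\<^sup>+ z. ennreal (exp ((\<Sum>j\<in>{..<levels N}. wmax (shell_length N j) (\<lambda>t. z (f (2 ^ j - 1 + t)))) / 4)) \<partial>std_gauss I)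
     \<le> ennreal (wmax_const ^ card {..<levels N})"
  proof (rule std_gauss_exp_sum_wmax [where f = "\<lambda>j t. f (2 ^ j - 1 + t)"])
    show "shell_length N j \<ge> 1" if "j \<in> {..<levels N}" for j
    proof -
      have "2 ^ j \<le> N" using that less_levels_iff [OF N] by simp
      then show ?thesis by (simp add: shell_length_def)
    qed
    show "inj_on (\<lambda>t. f (2 ^ j - 1 + t)) {..<shell_length N j}" for j
    proof (rule inj_onI)
      fix t t' assume "t \<in> {..<shell_length N j}" "t' \<in> {..<shell_length N j}" "f (2 ^ j - 1 + t) = f (2 ^ j - 1 + t')"
      then have "2 ^ j - 1 + t = 2 ^ j - 1 + t'" using inj_onD [OF f(1)] bnd by simp
      then show "t = t'" by (simp only: add_left_cancel)
    qed
    show "(\<lambda>t. f (2 ^ j - 1 + t)) ` {..<shell_length N j} \<subseteq> I" for j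
    proof (rule image_subsetI)
      fix t assume "t \<in> {..<shell_length N j}"
      then have "2 ^ j - 1 + t \<in> {..<N}" using bnd by simp
      then show "f (2 ^ j - 1 + t) \<in> I" using f(2) by blast
    qed
    have lt: "2 ^ i - 1 + t \<noteq> 2 ^ j - 1 + t'" if "i < j" "t < shell_length N i" for i j t t'
    proof -
      have "(2::nat) ^ Suc i \<le> 2 ^ j" using that by (intro power_increasing) auto
      moreover have "t < 2 ^ i" using that by (simp add: shell_length_def)
      ultimately have "2 ^ i + t < 2 ^ j" by simp
      moreover have "(1::nat) \<le> 2 ^ i" by simp
      ultimately show ?thesis by linarith
    qed
    show "disjoint_family_on (\<lambda>j. (\<lambda>t. f (2 ^ j - 1 + t)) ` {..<shell_length N j}) {..<levels N}"
      unfolding disjoint_family_on_def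
    proof (intro ballI impI)
      fix i j :: nat assume "i \<noteq> j"
      show "(\<lambda>t. f (2 ^ i - 1 + t)) ` {..<shell_length N i} \<inter> (\<lambda>t. f (2 ^ j - 1 + t)) ` {..<shell_length N j} = {}"
      proof (rule ccontr)
        assume "\<not> ?thesis"
        then obtain t t' where t: "t < shell_length N i" "t' < shell_length N j" "f (2 ^ i - 1 + t) = f (2 ^ j - 1 + t')" by auto
        then have "2 ^ i - 1 + t = 2 ^ j - 1 + t'"
          using inj_onD [OF f(1) t(3)] bnd by simp
        then show False using lt [of i j t t'] lt [of j i t' t] t \<open>i \<noteq> j\<close> by (cases "i < j") auto
      qed
    qed
  qed (use I in auto)
  then show ?thesis unfolding shell_sum_def by simp
qed

lemma measurable_shell_sum [measurable]: "(\<lambda>z. shell_sum N (\<lambda>j. z (f j))) \<in> borel_measurable (std_gauss I)"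
  unfolding shell_sum_def by measurable

text \<open>A majorant of \<open>mode_term\<close> for all interior modes at once, from
  \<open>x \<le> A + exp (x - A)\<close> with \<open>x\<close> a quarter of a shell sum. In the
  mean, the sum over \<open>e\<close> acts as a union bound.\<close>

definition mode_bound :: "nat \<Rightarrow> real \<Rightarrow> (nat \<Rightarrow> real) \<Rightarrow> real" where
  "mode_bound n A z = 16 * A + 8 * (\<Sum>e\<in>{1..<n}. exp (shell_sum e (\<lambda>j. z (e - j)) / 4 - A) + exp (shell_sum (n - e) (\<lambda>j. z (Suc e + j)) / 4 - A))"

lemma mode_term_le_mode_bound:
  assumes "0 < e" "e < n"
  shows "mode_term n e z \<le> mode_bound n A z"
proof -
  let ?f = "\<lambda>e. exp (shell_sum e (\<lambda>j. z (e - j)) / 4 - A) + exp (shell_sum (n - e) (\<lambda>j. z (Suc e + j)) / 4 - A)"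
  have "2 * w \<le> 8 * A + 8 * exp (w / 4 - A)" for w :: real
    using exp_ge_add_one_self [of "w / 4 - A"] by linarith
  from add_mono [OF this [of "shell_sum e (\<lambda>j. z (e - j))"] this [of "shell_sum (n - e) (\<lambda>j. z (Suc e + j))"]]
  have "mode_term n e z \<le> 16 * A + 8 * ?f e" by (simp add: mode_term_def)
  also have "?f e \<le> (\<Sum>e\<in>{1..<n}. ?f e)"
    using assms by (intro member_le_sum) (auto intro: add_nonneg_nonneg)
  finally show ?thesis by (simp add: mode_bound_def)
qed

lemma levels_mono: "N \<ge> 1 \<Longrightarrow> N \<le> n \<Longrightarrow> levels N \<le> levels n"
proof (rule ccontr)
  assume N: "N \<ge> 1" "N \<le> n" and "\<not> levels N \<le> levels n"
  then have "2 ^ levels n \<le> N" using less_levels_iff [OF N(1), of "levels n"] by linarith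
  then have "levels n < levels n" using less_levels_iff [of n "levels n"] N by linarith
  then show False by simp
qed

lemma measurable_mode_bound [measurable]: "mode_bound n A \<in> borel_measurable (std_gauss I)"
  unfolding mode_bound_def [abs_def] by measurable

lemma std_gauss_mode_bound:
  assumes "A \<ge> 0" "n \<ge> 1"
  shows "(\<integral>\<^sup>+ z. ennreal (mode_bound n A z) \<partial>std_gauss {1..n}) \<le> ennreal (16 * A + 16 * real n * exp (- A) * wmax_const ^ levels n)"
proof -
  interpret prob_space "std_gauss {1..n}" by (rule prob_space_std_gauss)
  define K where "K = exp (- A) * wmax_const ^ levels n"
  have K0: "K \<ge> 0" using wmax_const_ge_1 by (simp add: K_def)
  let ?l = "\<lambda>e z. exp (shell_sum e (\<lambda>j. z (e - j)) / 4 - A)"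
  let ?r = "\<lambda>e z. exp (shell_sum (n - e) (\<lambda>j. z (Suc e + j)) / 4 - A)"
  have gen: "(\<integral>\<^sup>+ z. ennreal (exp (shell_sum N (\<lambda>j. z (f j)) / 4 - A)) \<partial>std_gauss {1..n}) \<le> ennreal K"
    if "N \<ge> 1" "N \<le> n" "inj_on f {..<N}" "f ` {..<N} \<subseteq> {1..n}" for N f
  proof -
    have "(\<integral>\<^sup>+ z. ennreal (exp (shell_sum N (\<lambda>j. z (f j)) / 4 - A)) \<partial>std_gauss {1..n})
        = (\<integral>\<^sup>+ z. ennreal (exp (- A)) * ennreal (exp (shell_sum N (\<lambda>j. z (f j)) / 4)) \<partial>std_gauss {1..n})"
      by (intro nn_integral_cong) (simp add: ennreal_mult' [symmetric] exp_add [symmetric])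
    also have "\<dots> = ennreal (exp (- A)) * (\<integral>\<^sup>+ z. ennreal (exp (shell_sum N (\<lambda>j. z (f j)) / 4)) \<partial>std_gauss {1..n})"
      by (rule nn_integral_cmult) measurable
    also have "\<dots> \<le> ennreal (exp (- A)) * ennreal (wmax_const ^ levels N)"
      by (intro mult_left_mono std_gauss_exp_shell_sum that) auto
    also have "\<dots> \<le> ennreal (exp (- A)) * ennreal (wmax_const ^ levels n)"
      by (intro mult_left_mono ennreal_leI power_increasing levels_mono that wmax_const_ge_1) auto
    finally show ?thesis by (simp add: K_def ennreal_mult')
  qed
  have l: "(\<integral>\<^sup>+ z. ennreal (?l e z) \<partial>std_gauss {1..n}) \<le> ennreal K" if "e \<in> {1..<n}" for e
    by (rule gen) (use that in \<open>auto simp: inj_on_def\<close>)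
  have r: "(\<integral>\<^sup>+ z. ennreal (?r e z) \<partial>std_gauss {1..n}) \<le> ennreal K" if "e \<in> {1..<n}" for e
    by (rule gen) (use that in \<open>auto simp: inj_on_def\<close>)
  have "(\<integral>\<^sup>+ z. ennreal (mode_bound n A z) \<partial>std_gauss {1..n})
     = (\<integral>\<^sup>+ z. ennreal (16 * A) + ennreal 8 * (\<Sum>e\<in>{1..<n}. ennreal (?l e z) + ennreal (?r e z)) \<partial>std_gauss {1..n})"
  proof (intro nn_integral_cong)
    fix z
    have "(\<Sum>e\<in>{1..<n}. ennreal (?l e z) + ennreal (?r e z)) = ennreal (\<Sum>e\<in>{1..<n}. ?l e z + ?r e z)"
      by (subst sum_ennreal [symmetric]) (auto intro!: add_nonneg_nonneg)
    then show "ennreal (mode_bound n A z) = ennreal (16 * A) + ennreal 8 * (\<Sum>e\<in>{1..<n}. ennreal (?l e z) + ennreal (?r e z))"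
      unfolding mode_bound_def using assms
      by (subst ennreal_plus) (auto simp: ennreal_mult' intro!: sum_nonneg mult_nonneg_nonneg add_nonneg_nonneg)
  qed
  also have "\<dots> = ennreal (16 * A) + ennreal 8 * (\<Sum>e\<in>{1..<n}. (\<integral>\<^sup>+ z. ennreal (?l e z) \<partial>std_gauss {1..n}) + (\<integral>\<^sup>+ z. ennreal (?r e z) \<partial>std_gauss {1..n}))"
    by (simp add: nn_integral_add nn_integral_cmult nn_integral_sum emeasure_space_1 del: One_nat_def)
  also have "\<dots> \<le> ennreal (16 * A) + ennreal 8 * (\<Sum>e\<in>{1..<n}. ennreal K + ennreal K)"
    by (intro add_mono mult_left_mono sum_mono l r) auto
  also have "(\<Sum>e\<in>{1..<n}. ennreal K + ennreal K) \<le> (\<Sum>e\<in>{1..n}. ennreal K + ennreal K)"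
    by (intro sum_mono2) auto
  also have "\<dots> = ennreal (real n * (2 * K))"
  proof -
    have "ennreal K + ennreal K = ennreal (2 * K)" using K0 by (subst ennreal_plus [symmetric]) auto
    then show ?thesis using K0 by (simp add: ennreal_mult ennreal_of_nat_eq_real_of_nat)
  qed
  also have "ennreal (16 * A) + ennreal 8 * \<dots> = ennreal (16 * A + 16 * real n * exp (- A) * wmax_const ^ levels n)"
  proof -
    have "ennreal 8 * ennreal (real n * (2 * K)) = ennreal (16 * real n * exp (- A) * wmax_const ^ levels n)"
      by (subst ennreal_mult' [symmetric]) (auto simp: K_def mult_ac)
    then show ?thesis using assms wmax_const_ge_1 by (subst ennreal_plus) auto
  qed
  finally show ?thesis by (simp add: add_mono mult_left_mono)
qed

section \<open>Upper bounds for unimodal vectors\<close>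

lemma steps_mono:
  fixes f :: "nat \<Rightarrow> 'a::order"
  assumes "i \<le> j" "\<And>r. i \<le> r \<Longrightarrow> r < j \<Longrightarrow> f r \<le> f (Suc r)"
  shows "f i \<le> f j"
  using assms
proof (induction j rule: dec_induct)
  case (step r)
  then show ?case by (meson less_Suc_eq order_trans less_or_eq_imp_le lessI)
qed simp

lemma steps_antimono:
  fixes f :: "nat \<Rightarrow> 'a::order"
  assumes "i \<le> j" "\<And>r. i \<le> r \<Longrightarrow> r < j \<Longrightarrow> f (Suc r) \<le> f r"
  shows "f j \<le> f i"
  using assms
proof (induction j rule: dec_induct)
  case (step r)
  then show ?case by (meson less_Suc_eq order_trans less_or_eq_imp_le lessI)
qed simp

text \<open>Split after the last point of piece \<open>l\<close>, or at \<open>0\<close> when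
  \<open>l = 1\<close>. With \<open>k \<le> 2\<close> the mode is the first or the last piece, so
  the vector is monotone and no interior mode has to be paid for. Jumps sit only at the break points
  \<open>a 1, ..., a (k - 1)\<close>.\<close>

lemma unimodal_pieces_structure:
  assumes v: "v \<in> unimodal_pieces n k" and k: "k \<ge> 1"
  shows "\<exists>e. split_at n e v \<and> (k \<le> 2 \<longrightarrow> e = 0 \<or> e = n)" and "card (jumps 0 n v) \<le> k - 1"
proof -
  obtain a l \<mu> where a: "a 0 = 0" "a k = n" "\<And>j. j < k \<Longrightarrow> a j \<le> a (Suc j)"
    and l: "1 \<le> l" "l \<le> k"
    and up: "\<And>j. 1 \<le> j \<and> j < l \<Longrightarrow> \<mu> j \<le> \<mu> (Suc j)"
    and down: "\<And>j. l \<le> j \<and> j < k \<Longrightarrow> \<mu> (Suc j) \<le> \<mu> j"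
    and val: "\<And>j i. j \<in> {1..k} \<Longrightarrow> a (j - 1) < i \<Longrightarrow> i \<le> a j \<Longrightarrow> v i = \<mu> j"
    using v unfolding unimodal_pieces_def by blast
  have amono: "a i \<le> a j" if "i \<le> j" "j \<le> k" for i j
    by (rule steps_mono) (use that a(3) in auto)
  have mu_up: "\<mu> i \<le> \<mu> j" if "1 \<le> i" "i \<le> j" "j \<le> l" for i j
    by (rule steps_mono) (use that up in auto)
  have mu_down: "\<mu> j \<le> \<mu> i" if "l \<le> i" "i \<le> j" "j \<le> k" for i j
    by (rule steps_antimono) (use that down in auto)
  \<comment> \<open>Break points may coincide, so pieces may be empty; the least index picks the
    nonempty piece that contains \<open>i\<close>.\<close>
  define pc where "pc = (\<lambda>i. LEAST j. i \<le> a j)"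
  have pc_le: "pc i \<le> j" if "i \<le> a j" for i j unfolding pc_def using that by (rule Least_le)
  have pc: "pc i \<in> {1..k}" "a (pc i - 1) < i" "i \<le> a (pc i)" "v i = \<mu> (pc i)" if "i \<in> {1..n}" for i
  proof -
    have ex: "i \<le> a k" using that a by simp
    show 1: "i \<le> a (pc i)" unfolding pc_def using ex by (rule LeastI)
    have "pc i \<noteq> 0" using 1 a that by (metis atLeastAtMost_iff le_zero_eq not_one_le_zero)
    then show 2: "pc i \<in> {1..k}" using pc_le [OF ex] by simp
    show 3: "a (pc i - 1) < i"
    proof (rule ccontr)
      assume "\<not> a (pc i - 1) < i"
      then have "pc i \<le> pc i - 1" by (intro pc_le) simp
      moreover have "1 \<le> pc i" using 2 by simp
      ultimately show False by linarith
    qed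
    show "v i = \<mu> (pc i)" by (rule val [OF 2 3 1])
  qed
  have pc_mono: "pc i \<le> pc j" if "i \<le> j" "1 \<le> i" "j \<le> n" for i j
    using pc(3) [of j] that by (intro pc_le) auto
  show "\<exists>e. split_at n e v \<and> (k \<le> 2 \<longrightarrow> e = 0 \<or> e = n)"
  proof (cases "l = 1")
    case True
    have "v j \<le> v i" if "0 < i" "i \<le> j" "j \<le> n" for i j
      using pc [of i] pc [of j] pc_mono [of i j] that True by (auto intro!: mu_down)
    then show ?thesis by (intro exI [of _ 0]) (auto simp: split_at_def)
  next
    case False
    have "v i \<le> v j" if "1 \<le> i" "i \<le> j" "j \<le> a l" for i j
    proof -
      have "a l \<le> n" using amono [of l k] l a by simp
      then show ?thesis
        using pc [of i] pc [of j] pc_mono [of i j] pc_le [of j l] that by (auto intro!: mu_up)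
    qed
    moreover have "v j \<le> v i" if "a l < i" "i \<le> j" "j \<le> n" for i j
    proof -
      have "l \<le> pc i"
      proof (rule ccontr)
        assume "\<not> l \<le> pc i"
        then have "a (pc i) \<le> a l" using l by (intro amono) auto
        then show False using pc(3) [of i] that by auto
      qed
      then show ?thesis using pc [of i] pc [of j] pc_mono [of i j] that by (auto intro!: mu_down)
    qed
    ultimately have "split_at n (a l) v" using amono [of l k] l a by (auto simp: split_at_def)
    moreover have "k \<le> 2 \<longrightarrow> a l = n" 
    proof
      assume "k \<le> 2"
      then have "l = k" using l False by linarith
      then show "a l = n" using a(2) by simp
    qed
    ultimately show ?thesis by blast
  qed
  have "jumps 0 n v \<subseteq> a ` {1..k - 1}"
  proof
    fix i assume "i \<in> jumps 0 n v"
    then have i: "0 < i" "i < n" "v i \<noteq> v (Suc i)" by (auto simp: jumps_def)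
    have ne: "pc i \<noteq> pc (Suc i)" using pc(4) [of i] pc(4) [of "Suc i"] i by auto
    have "i = a (pc i)"
    proof (rule ccontr)
      assume "i \<noteq> a (pc i)"
      then have "Suc i \<le> a (pc i)" using pc(3) [of i] i by auto
      then have "pc (Suc i) \<le> pc i" by (rule pc_le)
      then show False using pc_mono [of i "Suc i"] ne i by auto
    qed
    moreover have "pc i \<noteq> k" using calculation a i by auto
    ultimately show "i \<in> a ` {1..k - 1}" using pc(1) [of i] i by auto
  qed
  then have "card (jumps 0 n v) \<le> card {1..k - 1}" by (rule surj_card_le [rotated]) simp
  then show "card (jumps 0 n v) \<le> k - 1" by simp
qed

text \<open>The fit depends on the noise, so \<open>B\<close> must dominate the ratio of squared
  inner product to squared norm for every \<open>v\<close> in the class at once; it may depend on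
  the truth. Least squares turns the mean of \<open>B\<close> into a risk bound.\<close>

lemma minimax_upper_bound:
  assumes n: "n \<ge> 1" and k: "k \<ge> 1" and \<sigma>: "\<sigma> > 0" and b: "b \<ge> 0"
    and B: "\<And>\<theta>. \<theta> \<in> unimodal_pieces n k \<Longrightarrow> \<exists>B \<in> borel_measurable (std_gauss {1..n}).
       (\<forall>z. 0 \<le> B z) \<and> (\<forall>z. \<forall>v\<in>unimodal_pieces n k. (\<Sum>i\<in>{1..n}. z i * (v i - \<theta> i))\<^sup>2 \<le> B z * (\<Sum>i\<in>{1..n}. (v i - \<theta> i)\<^sup>2))
       \<and> (\<integral>\<^sup>+ z. ennreal (B z) \<partial>std_gauss {1..n}) \<le> ennreal b"
  shows "(INF T\<in>estimators n. SUP \<theta>\<in>unimodal_pieces n k. sq_risk n \<sigma> T \<theta>) \<le> ennreal (\<sigma>\<^sup>2 * (4 * b + 1))"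
proof -
  interpret G: prob_space "std_gauss {1..n}" by (rule prob_space_std_gauss)
  have "\<sigma>\<^sup>2 / 2 > 0" using \<sigma> by simp
  from approximate_least_squares [OF k this, of n]
  obtain T where T: "T \<in> estimators n" "\<And>x. T x \<in> unimodal_pieces n k"
    "\<And>x \<theta>. \<theta> \<in> unimodal_pieces n k \<Longrightarrow> (\<Sum>i\<in>{1..n}. (x i - T x i)\<^sup>2) \<le> (\<Sum>i\<in>{1..n}. (x i - \<theta> i)\<^sup>2) + \<sigma>\<^sup>2 / 2"
    by blast
  have "sq_risk n \<sigma> T \<theta> \<le> ennreal (\<sigma>\<^sup>2 * (4 * b + 1))" if \<theta>: "\<theta> \<in> unimodal_pieces n k" for \<theta>
  proof -
    obtain B where Bm: "B \<in> borel_measurable (std_gauss {1..n})" and B0: "\<And>z. 0 \<le> B z"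
      and Bz: "\<And>z v. v \<in> unimodal_pieces n k \<Longrightarrow> (\<Sum>i\<in>{1..n}. z i * (v i - \<theta> i))\<^sup>2 \<le> B z * (\<Sum>i\<in>{1..n}. (v i - \<theta> i)\<^sup>2)"
      and Bi: "(\<integral>\<^sup>+ z. ennreal (B z) \<partial>std_gauss {1..n}) \<le> ennreal b"
      using B [OF \<theta>] by blast
    define Z where "Z = (\<lambda>x. \<lambda>i\<in>{1..n}. (x i - \<theta> i) / \<sigma>)"
    define P where "P = gauss_model n \<sigma> \<theta>"
    have sP: "sets P = sets (PiM {1..n} (\<lambda>_. borel))"
      unfolding P_def gauss_model_def by (intro sets_PiM_cong) auto
    have Zm: "Z \<in> measurable P (PiM {1..n} (\<lambda>_. borel))"
    proof -
      have "Z \<in> measurable (PiM {1..n} (\<lambda>_. borel)) (PiM {1..n} (\<lambda>_. borel))"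
        unfolding Z_def by measurable
      then show ?thesis using measurable_cong_sets [OF sP refl] by blast
    qed
    have gm: "(\<lambda>z. ennreal (\<sigma>\<^sup>2 * (4 * B z + 1))) \<in> borel_measurable (std_gauss {1..n})"
      using Bm by measurable
    have gm': "(\<lambda>z. ennreal (\<sigma>\<^sup>2 * (4 * B z + 1))) \<in> borel_measurable (PiM {1..n} (\<lambda>_. borel))"
      using gm measurable_cong_sets [OF sets_std_gauss refl] by blast
    have "sq_risk n \<sigma> T \<theta> \<le> (\<integral>\<^sup>+ x. ennreal (\<sigma>\<^sup>2 * (4 * B (Z x) + 1)) \<partial>P)"
      unfolding sq_risk_def P_def [symmetric]
      by (intro nn_integral_mono ennreal_leI least_squares_inequality [OF \<sigma> B0 Bz [OF T(2)] T(3) [OF \<theta>]])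
        (use \<sigma> in \<open>auto simp: Z_def\<close>)
    also have "\<dots> = (\<integral>\<^sup>+ z. ennreal (\<sigma>\<^sup>2 * (4 * B z + 1)) \<partial>distr P (PiM {1..n} (\<lambda>_. borel)) Z)"
      by (rule nn_integral_distr [OF Zm, symmetric]) (use gm' in simp)
    also have "distr P (PiM {1..n} (\<lambda>_. borel)) Z = std_gauss {1..n}"
      unfolding P_def Z_def by (rule gauss_model_standardise [OF \<sigma> n])
    also have "(\<integral>\<^sup>+ z. ennreal (\<sigma>\<^sup>2 * (4 * B z + 1)) \<partial>std_gauss {1..n}) = (\<integral>\<^sup>+ z. ennreal (4 * \<sigma>\<^sup>2) * ennreal (B z) + ennreal (\<sigma>\<^sup>2) \<partial>std_gauss {1..n})"
      using B0 by (intro nn_integral_cong) (simp add: ennreal_mult' [symmetric] ennreal_plus [symmetric] algebra_simps del: ennreal_plus)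
    also have "\<dots> = ennreal (4 * \<sigma>\<^sup>2) * (\<integral>\<^sup>+ z. ennreal (B z) \<partial>std_gauss {1..n}) + ennreal (\<sigma>\<^sup>2)"
      using Bm G.emeasure_space_1 by (simp add: nn_integral_add nn_integral_cmult del: One_nat_def)
    also have "\<dots> \<le> ennreal (4 * \<sigma>\<^sup>2) * ennreal b + ennreal (\<sigma>\<^sup>2)"
      by (intro add_mono mult_left_mono Bi) auto
    also have "\<dots> = ennreal (\<sigma>\<^sup>2 * (4 * b + 1))"
      using b by (simp add: ennreal_mult' [symmetric] ennreal_plus [symmetric] algebra_simps del: ennreal_plus)
    finally show ?thesis .
  qed
  then have "(SUP \<theta>\<in>unimodal_pieces n k. sq_risk n \<sigma> T \<theta>) \<le> ennreal (\<sigma>\<^sup>2 * (4 * b + 1))"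
    by (rule SUP_least)
  then show ?thesis using T(1) by (rule INF_lower2 [rotated])
qed

section \<open>Size of the iterated logarithms and of the excess\<close>

lemma ln_ln_16: "ln (ln 16) \<ge> (5 / 8 :: real)"
proof -
  have "ln (16::real) = 4 * ln 2" using ln_realpow [of 2 4] by simp
  then have l: "ln (16::real) \<ge> 8 / 3" using ln2_ge_two_thirds by simp
  have "1 - 1 / (8 / 3 :: real) \<le> ln (8 / 3)" using ln_le_minus_one [of "3 / 8 :: real"] by (simp add: ln_div)
  also have "\<dots> \<le> ln (ln 16)" using l by simp
  finally show ?thesis by simp
qed

text \<open>The \<open>16\<close> in the rate keeps both logarithms away from zero, which lets
  additive constants be absorbed throughout: \<open>ln 16 = 4 * ln 2\<close> and
  \<open>ln 2 \<ge> 2 / 3\<close>.\<close>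

lemma ln_16_mult:
  assumes "x \<ge> (1::real)"
  shows "ln (16 * x) \<ge> 8 / 3" "ln (ln (16 * x)) \<ge> 5 / 8"
proof -
  have "ln (16::real) = 4 * ln 2" using ln_realpow [of 2 4] by simp
  then have l: "ln (16::real) \<ge> 8 / 3" using ln2_ge_two_thirds by simp
  have "ln 16 \<le> ln (16 * x)" using assms by simp
  then show "ln (16 * x) \<ge> 8 / 3" using l by simp
  have "ln (ln 16) \<le> ln (ln (16 * x))" using \<open>ln 16 \<le> ln (16 * x)\<close> l by simp
  then show "ln (ln (16 * x)) \<ge> 5 / 8" using ln_ln_16 by simp
qed

text \<open>With \<open>l = ln (16 * N)\<close>, the choice \<open>s = 8 * ln l\<close> gives
  \<open>exp (- s / 4) = 1 / l^2\<close>. One power of \<open>l\<close> cancels the number of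
  scales, the other the factor \<open>1 + ln N\<close> of the jump-free bound.\<close>

lemma std_gauss_excess_scaled:
  assumes "x < y" "y \<le> n" "y - x \<le> N"
  shows "ennreal (1 + ln (real N)) * (\<integral>\<^sup>+ z. ennreal (excess x y (8 * ln (ln (16 * real N))) z) \<partial>std_gauss {1..n}) \<le> ennreal (4 * wmax_const)"
proof -
  define s where "s = 8 * ln (ln (16 * real N))"
  define l where "l = ln (16 * real N)"
  have N: "N \<ge> 1" using assms by simp
  have l0: "l \<ge> 8 / 3" using ln_16_mult(1) [of "real N"] N by (simp add: l_def)
  have lN: "1 + ln (real N) \<le> l" "1 + 2 * ln (real N) \<le> 2 * l"
  proof -
    have "l = ln 16 + ln (real N)" unfolding l_def using N by (subst ln_mult) auto
    moreover have "ln (16::real) \<ge> 8 / 3" using ln_16_mult(1) [of 1] by simp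
    ultimately show "1 + ln (real N) \<le> l" "1 + 2 * ln (real N) \<le> 2 * l" by auto
  qed
  have lev: "real (levels (y - x)) \<le> 2 * l"
  proof -
    have "real (levels (y - x)) \<le> 1 + 2 * ln (real (y - x))" using assms by (intro levels_le) auto
    also have "ln (real (y - x)) \<le> ln (real N)" using assms by (intro ln_mono) auto
    finally show ?thesis using lN by simp
  qed
  have es: "exp (- s / 4) = 1 / l\<^sup>2"
  proof -
    have "- s / 4 = - (2 * ln l)" by (simp add: s_def l_def)
    then have "exp (- s / 4) = inverse (exp (ln l + ln l))" by (simp add: exp_minus)
    also have "\<dots> = 1 / l\<^sup>2" 
    proof -
      have "exp (ln l + ln l) = l * l" using l0 by (subst exp_add) simp
      then show ?thesis by (simp only: power2_eq_square inverse_eq_divide)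
    qed
    finally show ?thesis .
  qed
  have w: "wmax_const \<ge> 0" using wmax_const_ge_1 by simp
  have "ennreal (1 + ln (real N)) * (\<integral>\<^sup>+ z. ennreal (excess x y s z) \<partial>std_gauss {1..n})
     \<le> ennreal (1 + ln (real N)) * ennreal (2 * real (levels (y - x)) * (exp (- s / 4) * wmax_const))"
    by (intro mult_left_mono std_gauss_excess assms) auto
  also have "\<dots> = ennreal ((1 + ln (real N)) * (2 * real (levels (y - x)) * (exp (- s / 4) * wmax_const)))"
    using N by (intro ennreal_mult' [symmetric]) auto
  also have "\<dots> \<le> ennreal (l * (2 * (2 * l) * (exp (- s / 4) * wmax_const)))"
    using lN(1) lev w l0 N by (intro ennreal_leI mult_mono) (auto intro!: mult_nonneg_nonneg)
  also have "l * (2 * (2 * l) * (exp (- s / 4) * wmax_const)) = 4 * wmax_const"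
    unfolding es using l0 by (simp add: power2_eq_square)
  finally show ?thesis unfolding s_def .
qed

text \<open>From any point the next multiple of \<open>N\<close> is at most \<open>N\<close> away.
  It is a cut unless it exceeds \<open>n\<close>, where the interval ends anyway; since
  \<open>n \<le> k * N\<close>, the multiples up to \<open>k * N\<close> suffice.\<close>

lemma truth_partition:
  fixes \<theta> :: "nat \<Rightarrow> real"
  assumes k: "1 \<le> k" and N: "n \<le> k * N" "N \<ge> 1"
  defines "P \<equiv> jumps 0 n \<theta> \<union> {0, n} \<union> ((\<lambda>b. b * N) ` {0..k} \<inter> {..n})"
  shows "finite P" "P \<subseteq> {0..n}" "0 \<in> P" "n \<in> P" "card P \<le> card (jumps 0 n \<theta>) + k + 3"
    "\<And>p. p \<in> P - {n} \<Longrightarrow> succ_in P p - p \<le> N"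
    "\<And>p i. p \<in> P - {n} \<Longrightarrow> p < i \<Longrightarrow> i \<le> succ_in P p \<Longrightarrow> \<theta> i = \<theta> (Suc p)"
proof -
  show fin: "finite P" by (simp add: P_def)
  show sub: "P \<subseteq> {0..n}" by (auto simp: P_def jumps_def)
  show "0 \<in> P" and nP: "n \<in> P" by (auto simp: P_def)
  have "card P \<le> card (jumps 0 n \<theta> \<union> {0, n}) + card ((\<lambda>b. b * N) ` {0..k} \<inter> {..n})"
    unfolding P_def by (rule card_Un_le)
  also have "card (jumps 0 n \<theta> \<union> {0, n}) \<le> card (jumps 0 n \<theta>) + card {0, n}" by (rule card_Un_le)
  also have "card {0, n} \<le> 2" by (simp add: card_insert_if)
  also have "card ((\<lambda>b. b * N) ` {0..k} \<inter> {..n}) \<le> card ((\<lambda>b. b * N) ` {0..k})" by (intro card_mono) auto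
  also have "\<dots> \<le> card {0..k}" by (rule card_image_le) simp
  finally show "card P \<le> card (jumps 0 n \<theta>) + k + 3" by simp
  have lt: "p < n" if "p \<in> P - {n}" for p using that sub by auto
  show "succ_in P p - p \<le> N" if p: "p \<in> P - {n}" for p
  proof -
    define b where "b = p div N"
    have b: "p < (b + 1) * N" "(b + 1) * N \<le> p + N"
      using N(2) dividend_less_div_times [of N p] div_times_less_eq_dividend [of p N] by (auto simp: b_def)
    show ?thesis
    proof (cases "(b + 1) * N \<le> n")
      case True
      then have "(b + 1) * N \<le> k * N" using N by simp
      then have "b + 1 \<le> k" using N by (simp only: mult_le_cancel2)
      then have "(b + 1) * N \<in> (\<lambda>b. b * N) ` {0..k}" by (intro imageI) simp
      then have "(b + 1) * N \<in> P" using True unfolding P_def by blast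
      then have "succ_in P p \<le> (b + 1) * N" using succ_in(4) [OF fin nP lt [OF p]] b by blast
      then show ?thesis using b by linarith
    next
      case False
      then show ?thesis using succ_in(3) [OF fin nP lt [OF p]] b by linarith
    qed
  qed
  show "\<theta> i = \<theta> (Suc p)" if p: "p \<in> P - {n}" and i: "p < i" "i \<le> succ_in P p" for p i
  proof -
    have "Suc p \<le> i" using i by simp
    then show ?thesis using i(2)
    proof (induction i rule: dec_induct)
      case (step r)
      have "r \<notin> P" using succ_in(4) [OF fin nP lt [OF p], of r] step by auto
      moreover have "r < n" using succ_in(3) [OF fin nP lt [OF p]] step by simp
      ultimately have "\<theta> r = \<theta> (Suc r)" using step by (auto simp: P_def jumps_def)
      then show ?case using step by simp
    qed simp
  qed
qed

text \<open>With \<open>l = ln (exp 1 * n)\<close>, the term \<open>l\<close> pays for the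
  \<open>n\<close> modes, and \<open>2 * ln wmax_const * l\<close> for the moment
  \<open>wmax_const ^ levels n\<close>, because \<open>levels n \<le> 2 * l\<close>.\<close>

definition mode_level :: "nat \<Rightarrow> real" where
  "mode_level n = (1 + 2 * ln wmax_const) * ln (exp 1 * real n)"

lemma mode_level_bound:
  assumes "n \<ge> 1"
  shows "mode_level n \<ge> 0" "real n * exp (- mode_level n) * wmax_const ^ levels n \<le> 1"
proof -
  define l where "l = ln (exp 1 * real n)"
  define c where "c = ln wmax_const"
  have l: "l = 1 + ln (real n)" using assms by (simp add: l_def ln_mult)
  have l1: "l \<ge> 1" using assms by (simp add: l)
  have c0: "c \<ge> 0" using wmax_const_ge_1 by (simp add: c_def)
  have wc: "wmax_const = exp c" using wmax_const_ge_1 by (simp add: c_def)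
  have A: "mode_level n = (1 + 2 * c) * l" by (simp add: mode_level_def l_def c_def)
  show "mode_level n \<ge> 0" unfolding A using c0 l1 by simp
  have "wmax_const ^ levels n = exp (real (levels n) * c)" by (simp add: wc exp_of_nat_mult)
  also have "\<dots> \<le> exp (2 * l * c)"
    using levels_le [OF assms] c0 by (simp add: l mult_right_mono)
  finally have "real n * exp (- mode_level n) * wmax_const ^ levels n \<le> exp l * exp (- mode_level n) * exp (2 * l * c)"
    using assms wmax_const_ge_1 by (intro mult_mono) (auto simp: l exp_add)
  also have "\<dots> = exp (l + - mode_level n + 2 * l * c)" by (simp only: exp_add)
  also have "\<dots> = 1" by (simp add: A algebra_simps)
  finally show "real n * exp (- mode_level n) * wmax_const ^ levels n \<le> 1" .
qed

text \<open>Truth and fit have at most \<open>k - 1\<close> jumps each, and the ends and the grid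
  add at most \<open>k + 3\<close> cuts, so jumps of the fit and cuts together number at most
  \<open>4 * k\<close>. Hence \<open>16 = 4 * 4\<close> in front of \<open>s\<close>, and
  \<open>128 = 8 * 4 * 4\<close> from the excesses of at most \<open>4 * k\<close>
  intervals.\<close>

lemma minimax_upper_pieces:
  assumes k: "1 \<le> k" "k \<le> n" and \<sigma>: "\<sigma> > 0"
  defines "s \<equiv> 8 * ln (ln (16 * real (n div k + 1)))"
  shows "(INF T\<in>estimators n. SUP \<theta>\<in>unimodal_pieces n k. sq_risk n \<sigma> T \<theta>)
     \<le> ennreal (\<sigma>\<^sup>2 * (4 * (16 * real k * s + 128 * wmax_const * real k + (if k \<ge> 3 then 16 * mode_level n + 16 else 0)) + 1))"
proof (rule minimax_upper_bound)
  define N where "N = n div k + 1"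
  have N: "N \<ge> 1" "n \<le> k * N"
    using k dividend_less_times_div [of k n] by (auto simp: N_def)
  have s_eq: "s = 8 * ln (ln (16 * real N))" by (simp add: s_def N_def)
  have "ln (ln (16 * real N)) \<ge> 5 / 8" using N by (intro ln_16_mult(2)) simp
  then have s0: "s \<ge> 0" unfolding s_eq by linarith
  have n: "n \<ge> 1" using k by simp
  have A: "mode_level n \<ge> 0" by (rule mode_level_bound [OF n])
  have w: "wmax_const \<ge> 1" by (rule wmax_const_ge_1)
  show "n \<ge> 1" "k \<ge> 1" "\<sigma> > 0" by fact+
  show "0 \<le> 16 * real k * s + 128 * wmax_const * real k + (if k \<ge> 3 then 16 * mode_level n + 16 else 0)"
    using s0 w A by simp
  fix \<theta> assume \<theta>: "\<theta> \<in> unimodal_pieces n k"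
  define P where "P = jumps 0 n \<theta> \<union> {0, n} \<union> ((\<lambda>b. b * N) ` {0..k} \<inter> {..n})"
  note P = truth_partition [OF k(1) N(2,1), where \<theta> = \<theta>, folded P_def]
  have lt: "p < n" if "p \<in> P - {n}" for p using that P(2) by auto
  have cardP: "card P \<le> 2 * k + 2"
    using P(5) unimodal_pieces_structure(2) [OF \<theta> k(1)] k by simp
  have cardQ: "card (P - {n}) \<le> 4 * k" using cardP P(1,4) k by (simp add: card_Diff_singleton)
  define B where "B = (\<lambda>z. 16 * real k * s + 8 * (1 + ln (real N)) * (\<Sum>p\<in>P - {n}. excess p (succ_in P p) s z)
      + (if k \<ge> 3 then mode_bound n (mode_level n) z else 0))"
  have mb0: "0 \<le> mode_bound n (mode_level n) z" for z
    unfolding mode_bound_def using A by (intro add_nonneg_nonneg mult_nonneg_nonneg sum_nonneg) auto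
  have ex0: "0 \<le> (\<Sum>p\<in>P - {n}. excess p (succ_in P p) s z)" for z by (intro sum_nonneg excess_nonneg)
  have lnN: "0 \<le> ln (real N)" using N by simp
  show "\<exists>B\<in>borel_measurable (std_gauss {1..n}). (\<forall>z. 0 \<le> B z) \<and>
      (\<forall>z. \<forall>v\<in>unimodal_pieces n k. (\<Sum>i\<in>{1..n}. z i * (v i - \<theta> i))\<^sup>2 \<le> B z * (\<Sum>i\<in>{1..n}. (v i - \<theta> i)\<^sup>2)) \<and>
      (\<integral>\<^sup>+ z. ennreal (B z) \<partial>std_gauss {1..n}) \<le> ennreal (16 * real k * s + 128 * wmax_const * real k + (if k \<ge> 3 then 16 * mode_level n + 16 else 0))"
  proof (intro bexI [of _ B] conjI allI ballI)
    show "B \<in> borel_measurable (std_gauss {1..n})" unfolding B_def by measurable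
    show "0 \<le> B z" for z
      unfolding B_def using s0 lnN ex0 mb0 by (intro add_nonneg_nonneg mult_nonneg_nonneg) auto
    fix z v assume v: "v \<in> unimodal_pieces n k"
    obtain e where e: "split_at n e v" "k \<le> 2 \<longrightarrow> e = 0 \<or> e = n"
      using unimodal_pieces_structure(1) [OF v k(1)] by blast
    have cardv: "card (jumps 0 n v) + card P \<le> 4 * k"
      using unimodal_pieces_structure(2) [OF v k(1)] cardP k by simp
    have "(\<Sum>i\<in>{1..n}. z i * (v i - \<theta> i))\<^sup>2
      \<le> (4 * s * real (card (jumps 0 n v) + card P) + 8 * (1 + ln (real N)) * (\<Sum>p\<in>P - {n}. excess p (succ_in P p) s z)
          + (if 0 < e \<and> e < n then mode_term n e z else 0)) * (\<Sum>i\<in>{1..n}. (v i - \<theta> i)\<^sup>2)"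
    proof (rule noise_inner_bound [OF P(1-4) _ _ e(1) s0])
      show "succ_in P p - p \<le> N" if "p \<in> P - {n}" for p by (rule P(6) [OF that])
      show "\<theta> i = \<theta> (Suc p)" if "p \<in> P - {n}" "p < i" "i \<le> succ_in P p" for p i by (rule P(7) [OF that])
    qed
    also have "\<dots> \<le> B z * (\<Sum>i\<in>{1..n}. (v i - \<theta> i)\<^sup>2)"
    proof (intro mult_right_mono sum_nonneg)
      have "real (card (jumps 0 n v) + card P) \<le> real (4 * k)" using cardv by (simp only: of_nat_le_iff)
      then have "4 * s * real (card (jumps 0 n v) + card P) \<le> 4 * s * real (4 * k)"
        using s0 by (intro mult_left_mono) auto
      then have 1: "4 * s * real (card (jumps 0 n v) + card P) \<le> 16 * real k * s" by simp
      have 2: "(if 0 < e \<and> e < n then mode_term n e z else 0) \<le> (if k \<ge> 3 then mode_bound n (mode_level n) z else 0)"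
        using e(2) mode_term_le_mode_bound [of e n z "mode_level n"] mb0 [of z] by auto
      show "4 * s * real (card (jumps 0 n v) + card P) + 8 * (1 + ln (real N)) * (\<Sum>p\<in>P - {n}. excess p (succ_in P p) s z)
          + (if 0 < e \<and> e < n then mode_term n e z else 0) \<le> B z"
        unfolding B_def using 1 2 by (intro add_mono) auto
    qed auto
    finally show "(\<Sum>i\<in>{1..n}. z i * (v i - \<theta> i))\<^sup>2 \<le> B z * (\<Sum>i\<in>{1..n}. (v i - \<theta> i)\<^sup>2)" .
  next
    interpret G: prob_space "std_gauss {1..n}" by (rule prob_space_std_gauss)
    let ?M = "if k \<ge> 3 then 16 * mode_level n + 16 else 0"
    have "ennreal (B z) = ennreal (16 * real k * s) + ennreal 8 * (ennreal (1 + ln (real N)) * (\<Sum>p\<in>P - {n}. ennreal (excess p (succ_in P p) s z)))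
        + ennreal (if k \<ge> 3 then mode_bound n (mode_level n) z else 0)" for z
    proof -
      have "ennreal 8 * (ennreal (1 + ln (real N)) * (\<Sum>p\<in>P - {n}. ennreal (excess p (succ_in P p) s z)))
          = ennreal (8 * (1 + ln (real N)) * (\<Sum>p\<in>P - {n}. excess p (succ_in P p) s z))"
      proof -
        have "0 \<le> 1 + ln (real N)" using lnN by simp
        moreover have "(\<Sum>p\<in>P - {n}. ennreal (excess p (succ_in P p) s z)) = ennreal (\<Sum>p\<in>P - {n}. excess p (succ_in P p) s z)"
          by (intro sum_ennreal excess_nonneg)
        ultimately show ?thesis by (simp only: ennreal_mult' [symmetric] mult.assoc zero_le_numeral)
      qed
      then show ?thesis unfolding B_def using s0 lnN ex0 [of z] mb0 [of z] by (simp add: ennreal_plus)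
    qed
    then have "(\<integral>\<^sup>+ z. ennreal (B z) \<partial>std_gauss {1..n})
       = (\<integral>\<^sup>+ z. ennreal (16 * real k * s) + ennreal 8 * (ennreal (1 + ln (real N)) * (\<Sum>p\<in>P - {n}. ennreal (excess p (succ_in P p) s z)))
        + ennreal (if k \<ge> 3 then mode_bound n (mode_level n) z else 0) \<partial>std_gauss {1..n})"
      by simp
    also have "\<dots> = ennreal (16 * real k * s) + ennreal 8 * (\<Sum>p\<in>P - {n}. ennreal (1 + ln (real N)) * (\<integral>\<^sup>+ z. ennreal (excess p (succ_in P p) s z) \<partial>std_gauss {1..n}))
        + (\<integral>\<^sup>+ z. ennreal (if k \<ge> 3 then mode_bound n (mode_level n) z else 0) \<partial>std_gauss {1..n})"
      using G.emeasure_space_1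
      by (simp add: nn_integral_add nn_integral_cmult nn_integral_sum sum_distrib_left del: One_nat_def ennreal_plus sum_ennreal)
    also have "\<dots> \<le> ennreal (16 * real k * s) + ennreal 8 * (\<Sum>p\<in>P - {n}. ennreal (4 * wmax_const)) + ennreal ?M"
    proof (intro add_mono mult_left_mono sum_mono order_refl)
      fix p assume p: "p \<in> P - {n}"
      show "ennreal (1 + ln (real N)) * (\<integral>\<^sup>+ z. ennreal (excess p (succ_in P p) s z) \<partial>std_gauss {1..n}) \<le> ennreal (4 * wmax_const)"
        unfolding s_eq using succ_in [OF P(1,4) lt [OF p]] P(6) [OF p] by (intro std_gauss_excess_scaled) auto
    next
      show "(\<integral>\<^sup>+ z. ennreal (if k \<ge> 3 then mode_bound n (mode_level n) z else 0) \<partial>std_gauss {1..n}) \<le> ennreal ?M"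
      proof (cases "k \<ge> 3")
        case True
        have "(\<integral>\<^sup>+ z. ennreal (mode_bound n (mode_level n) z) \<partial>std_gauss {1..n}) \<le> ennreal (16 * mode_level n + 16 * real n * exp (- mode_level n) * wmax_const ^ levels n)"
          by (rule std_gauss_mode_bound [OF A n])
        also have "\<dots> \<le> ennreal (16 * mode_level n + 16)"
          using mode_level_bound(2) [OF n] by (intro ennreal_leI) (simp add: mult.assoc)
        finally show ?thesis using True by simp
      qed simp
    qed auto
    also have "(\<Sum>p\<in>P - {n}. ennreal (4 * wmax_const)) \<le> ennreal (real (4 * k) * (4 * wmax_const))"
    proof -
      have "(\<Sum>p\<in>P - {n}. ennreal (4 * wmax_const)) = ennreal (real (card (P - {n})) * (4 * wmax_const))"
        using w by (simp add: ennreal_mult ennreal_of_nat_eq_real_of_nat)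
      also have "\<dots> \<le> ennreal (real (4 * k) * (4 * wmax_const))"
      proof (intro ennreal_leI mult_right_mono)
        show "real (card (P - {n})) \<le> real (4 * k)" using cardQ by (simp only: of_nat_le_iff)
      qed (use w in simp)
      finally show ?thesis .
    qed
    also have "ennreal (16 * real k * s) + ennreal 8 * ennreal (real (4 * k) * (4 * wmax_const)) + ennreal ?M
       = ennreal (16 * real k * s + 128 * wmax_const * real k + ?M)"
    proof -
      have "ennreal 8 * ennreal (real (4 * k) * (4 * wmax_const)) = ennreal (128 * wmax_const * real k)"
        by (subst ennreal_mult' [symmetric]) (auto simp: mult_ac)
      then show ?thesis using s0 w A by (simp add: ennreal_plus [symmetric] del: ennreal_plus)
    qed
    finally show "(\<integral>\<^sup>+ z. ennreal (B z) \<partial>std_gauss {1..n}) \<le> ennreal (16 * real k * s + 128 * wmax_const * real k + ?M)"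
      by (simp add: add_mono mult_left_mono)
  qed
qed

text \<open>For one piece the general bound would leave an iterated logarithm. Here fit minus truth
  is constant, so only the total noise sum enters; its square over \<open>n\<close> is at most
  \<open>wmax n\<close>, whose mean is bounded through
  \<open>x \<le> 4 * exp (x / 4)\<close>.\<close>

lemma minimax_upper_constant:
  assumes n: "n \<ge> 1" and \<sigma>: "\<sigma> > 0"
  shows "(INF T\<in>estimators n. SUP \<theta>\<in>unimodal_pieces n 1. sq_risk n \<sigma> T \<theta>) \<le> ennreal (\<sigma>\<^sup>2 * (4 * (4 * wmax_const) + 1))"
proof (rule minimax_upper_bound [OF n _ \<sigma>])
  show "0 \<le> 4 * wmax_const" using wmax_const_ge_1 by simp
  have const: "v i = v 1" if "v \<in> unimodal_pieces n 1" "i \<in> {1..n}" for v i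
  proof -
    have "jumps 0 n v = {}" using unimodal_pieces_structure(2) [OF that(1)] by simp
    then have st: "v r = v (Suc r)" if "0 < r" "r < n" for r using that by (auto simp: jumps_def)
    have "1 \<le> i" "i \<le> n" using that by auto
    then show ?thesis
    proof (induction i rule: dec_induct)
      case (step r)
      then have "v r = v (Suc r)" by (intro st) auto
      then show ?case using step by simp
    qed simp
  qed
  fix \<theta> assume \<theta>: "\<theta> \<in> unimodal_pieces n 1"
  define B where "B = (\<lambda>z. wmax n (\<lambda>j. z (Suc j)))"
  show "\<exists>B\<in>borel_measurable (std_gauss {1..n}). (\<forall>z. 0 \<le> B z) \<and>
      (\<forall>z. \<forall>v\<in>unimodal_pieces n 1. (\<Sum>i\<in>{1..n}. z i * (v i - \<theta> i))\<^sup>2 \<le> B z * (\<Sum>i\<in>{1..n}. (v i - \<theta> i)\<^sup>2)) \<and>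
      (\<integral>\<^sup>+ z. ennreal (B z) \<partial>std_gauss {1..n}) \<le> ennreal (4 * wmax_const)"
  proof (intro bexI [of _ B] conjI allI ballI)
    show "B \<in> borel_measurable (std_gauss {1..n})" unfolding B_def by measurable
    show "0 \<le> B z" for z by (simp add: B_def wmax_nonneg)
    fix z v :: "nat \<Rightarrow> real" assume v: "v \<in> unimodal_pieces n 1"
    define c where "c = v 1 - \<theta> 1"
    have c: "v i - \<theta> i = c" if "i \<in> {1..n}" for i using const [OF v that] const [OF \<theta> that] by (simp add: c_def)
    have "(\<Sum>j<n. z (Suc j)) = (\<Sum>i\<in>{1..n}. z i)"
      by (rule sum.reindex_bij_witness [of _ "\<lambda>i. i - 1" Suc]) auto
    then have "(\<Sum>i\<in>{1..n}. z i)\<^sup>2 \<le> real n * B z"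
      using wmax_ge [of n n "\<lambda>j. z (Suc j)"] n by (simp add: B_def field_simps)
    moreover have "(\<Sum>i\<in>{1..n}. z i * (v i - \<theta> i)) = (\<Sum>i\<in>{1..n}. z i) * c"
      unfolding sum_distrib_right by (intro sum.cong) (auto simp: c)
    moreover have "(\<Sum>i\<in>{1..n}. (v i - \<theta> i)\<^sup>2) = real n * c\<^sup>2" by (simp add: c)
    ultimately show "(\<Sum>i\<in>{1..n}. z i * (v i - \<theta> i))\<^sup>2 \<le> B z * (\<Sum>i\<in>{1..n}. (v i - \<theta> i)\<^sup>2)"
      using mult_right_mono [of "(\<Sum>i\<in>{1..n}. z i)\<^sup>2" "real n * B z" "c\<^sup>2"] by (simp add: power_mult_distrib mult_ac)
  next
    have "(\<integral>\<^sup>+ z. ennreal (B z) \<partial>std_gauss {1..n}) \<le> (\<integral>\<^sup>+ z. ennreal 4 * ennreal (exp (wmax n (\<lambda>j. z (Suc j)) / 4)) \<partial>std_gauss {1..n})"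
    proof (intro nn_integral_mono)
      fix z
      have "B z \<le> 4 * exp (B z / 4)" using exp_ge_add_one_self [of "B z / 4"] by linarith
      then show "ennreal (B z) \<le> ennreal 4 * ennreal (exp (wmax n (\<lambda>j. z (Suc j)) / 4))"
        by (subst ennreal_mult' [symmetric]) (auto simp: B_def intro: ennreal_leI)
    qed
    also have "\<dots> = ennreal 4 * (\<integral>\<^sup>+ z. ennreal (exp (wmax n (\<lambda>j. z (Suc j)) / 4)) \<partial>std_gauss {1..n})"
      by (rule nn_integral_cmult) measurable
    also have "\<dots> \<le> ennreal 4 * ennreal wmax_const"
      using n by (intro mult_left_mono std_gauss_exp_wmax) auto
    finally show "(\<integral>\<^sup>+ z. ennreal (B z) \<partial>std_gauss {1..n}) \<le> ennreal (4 * wmax_const)"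
      by (simp add: ennreal_mult')
  qed
qed simp

section \<open>The minimax rate\<close>

text \<open>With \<open>M = levels N \<ge> 2\<close> one has \<open>N < 2 ^ M\<close>, so
  \<open>ln (16 * N)\<close> is at most \<open>M + 4\<close>, hence at most \<open>3 * M\<close> and
  at most \<open>M ^ 3\<close>.\<close>

lemma ln_ln_le_ln_levels:
  assumes "N \<ge> 2"
  shows "ln (ln (16 * real N)) \<le> 3 * ln (real (levels N))"
proof -
  define M where "M = levels N"
  have N1: "N \<ge> 1" using assms by simp
  have M2: "M \<ge> 2" using less_levels_iff [OF N1, of 1] assms by (simp add: M_def)
  have "N < 2 ^ M" using less_levels_iff [OF N1, of M] by (simp add: M_def)
  then have "real N \<le> real (2 ^ M)" by (simp only: of_nat_le_iff)
  then have "ln (16 * real N) \<le> ln (16 * 2 ^ M)" using assms by simp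
  also have "\<dots> = ln (2 ^ (4 + M))" by (simp add: power_add)
  also have "\<dots> = real (4 + M) * ln 2" by (simp only: ln_realpow)
  also have "\<dots> \<le> real (4 + M) * 1" using ln_2_less_1 by (intro mult_left_mono) auto
  also have "\<dots> \<le> real M * 3" using M2 by simp
  also have "\<dots> \<le> real M * (real M)\<^sup>2"
  proof (intro mult_left_mono)
    have "(2::real)\<^sup>2 \<le> (real M)\<^sup>2" using M2 by (intro power_mono) auto
    then show "3 \<le> (real M)\<^sup>2" by simp
  qed simp
  also have "\<dots> = real M ^ 3" by (simp add: power3_eq_cube power2_eq_square)
  finally have "ln (16 * real N) \<le> real M ^ 3" .
  moreover have "0 < ln (16 * real N)" using assms by simp
  ultimately have "ln (ln (16 * real N)) \<le> ln (real M ^ 3)" using M2 by (intro ln_mono) auto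
  also have "\<dots> = 3 * ln (real M)" using M2 by (simp add: ln_realpow)
  finally show ?thesis by (simp add: M_def)
qed

lemma ln_ln_doubling:
  assumes "x \<ge> (1::real)" "y > 0" "y \<le> 2 * x"
  shows "ln (16 * y) \<le> 2 * ln (16 * x)"
proof -
  have "ln (16 * y) \<le> ln (2 * (16 * x))" using assms by (intro ln_mono) auto
  also have "\<dots> = ln 2 + ln (16 * x)" using assms by (subst ln_mult) auto
  finally show ?thesis using ln_16_mult(1) [OF assms(1)] ln2_le_25_over_36 by simp
qed

lemma ln_ln_of_double:
  assumes "x \<ge> (1::real)" "y \<ge> 1" "ln (16 * y) \<le> 2 * ln (16 * x)"
  shows "ln (ln (16 * y)) \<le> 3 * ln (ln (16 * x))"
proof -
  have y: "ln (16 * y) \<ge> 8 / 3" by (rule ln_16_mult [OF assms(2)])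
  have x: "ln (16 * x) \<ge> 8 / 3" by (rule ln_16_mult [OF assms(1)])
  have "ln (ln (16 * y)) \<le> ln (2 * ln (16 * x))" using assms y by (intro ln_mono) auto
  also have "\<dots> = ln 2 + ln (ln (16 * x))" using x by (subst ln_mult) auto
  finally show ?thesis using ln_16_mult(2) [OF assms(1)] ln2_le_25_over_36 by simp
qed

text \<open>Beyond the threshold log n is absorbed. If \<open>k^2 \<le> n\<close> then
  \<open>16 * n\<close> is at most the square of \<open>16 * n / k\<close>, and the two iterated
  logarithms are comparable. Otherwise \<open>ln n\<close> is at most \<open>2 * ln k\<close>, which
  is already below a multiple of \<open>k\<close>.\<close>

lemma ln_le_pieces:
  assumes k: "1 \<le> k" "k \<le> n" and gt: "ln (exp 1 * real n) < real k * ln (ln (16 * real n))"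
  shows "ln (exp 1 * real n) \<le> 4 * (real k * ln (ln (16 * real n / real k)))"
proof (cases "real k * real k \<le> real n")
  case True
  have x: "real n / real k \<ge> 1" using k by simp
  have "ln (16 * real n) \<le> 2 * ln (16 * (real n / real k))"
  proof -
    have "real k * real k * real n \<le> real n * real n" using True by (intro mult_right_mono) auto
    then have "real n \<le> (real n / real k)\<^sup>2" using k by (simp add: power_divide power2_eq_square field_simps)
    moreover have "(16 * (real n / real k))\<^sup>2 = 256 * (real n / real k)\<^sup>2" by (simp only: power_mult_distrib) simp
    ultimately have "16 * real n \<le> (16 * (real n / real k))\<^sup>2" using zero_le_power2 [of "real n / real k"] by linarith
    then have "ln (16 * real n) \<le> ln ((16 * (real n / real k))\<^sup>2)" using k by (intro ln_mono) auto
    also have "\<dots> = 2 * ln (16 * (real n / real k))" using k by (simp add: ln_realpow)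
    finally show ?thesis .
  qed
  then have "ln (ln (16 * real n)) \<le> 3 * ln (ln (16 * (real n / real k)))"
    using k x by (intro ln_ln_of_double) auto
  then have "real k * ln (ln (16 * real n)) \<le> real k * (3 * ln (ln (16 * (real n / real k))))"
    by (intro mult_left_mono) auto
  moreover have "0 \<le> real k * ln (ln (16 * (real n / real k)))"
    using ln_16_mult(2) [OF x] by (intro mult_nonneg_nonneg) auto
  ultimately show ?thesis using gt by simp
next
  case False
  have x: "real n / real k \<ge> 1" using k by simp
  have "ln (exp 1 * real n) = 1 + ln (real n)" using k by (simp add: ln_mult)
  also have "ln (real n) \<le> ln ((real k)\<^sup>2)" using False k by (intro ln_mono) (auto simp: power2_eq_square)
  also have "\<dots> = 2 * ln (real k)" using k by (simp add: ln_realpow)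
  also have "ln (real k) \<le> real k - 1" using k by (intro ln_le_minus_one) auto
  finally have "ln (exp 1 * real n) \<le> real k * 2" by simp
  also have "\<dots> \<le> real k * (4 * ln (ln (16 * (real n / real k))))"
    using ln_16_mult(2) [OF x] by (intro mult_left_mono) auto
  finally show ?thesis by (simp add: mult.left_commute)
qed

text \<open>\<open>1152 = 3 * 3 * 128\<close>: one \<open>3\<close> from
  \<open>k \<le> 3 * (k div 2)\<close>, one from replacing log log by the log of the number of
  levels, and \<open>128\<close> from the block bound. For \<open>k = 2\<close> a single block of
  length \<open>n\<close> is used.\<close>

lemma minimax_lower:
  assumes k: "1 \<le> k" "k \<le> n" and \<sigma>: "\<sigma> > 0"
  shows "ennreal (1 / 1152 * \<sigma>\<^sup>2 * unimodal_rate n k) \<le> (INF T\<in>estimators n. SUP \<theta>\<in>unimodal_pieces n k. sq_risk n \<sigma> T \<theta>)"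
proof -
  have fin: ?thesis if "ennreal (\<sigma>\<^sup>2 * x) \<le> (INF T\<in>estimators n. SUP \<theta>\<in>unimodal_pieces n k. sq_risk n \<sigma> T \<theta>)"
    "unimodal_rate n k / 1152 \<le> x" for x
  proof -
    have "\<sigma>\<^sup>2 * (unimodal_rate n k / 1152) \<le> \<sigma>\<^sup>2 * x" using that(2) by (intro mult_left_mono) auto
    then have "1 / 1152 * \<sigma>\<^sup>2 * unimodal_rate n k \<le> \<sigma>\<^sup>2 * x" by simp
    then show ?thesis using that(1) by (meson ennreal_leI order_trans)
  qed
  consider "k = 1" | "k = 2" | "k \<ge> 3" "real k \<le> ln (exp 1 * real n) / ln (ln (16 * real n))"
    | "k \<ge> 3" "\<not> real k \<le> ln (exp 1 * real n) / ln (ln (16 * real n))" using k by linarith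
  then show ?thesis
  proof cases
    case 1
    have "unimodal_rate n k / 1152 \<le> ln 2 / 64" using ln2_ge_two_thirds 1 by (simp add: unimodal_rate_def)
    moreover have "n \<ge> 1" using k by simp
    ultimately show ?thesis using fin [OF minimax_lower_constant [OF _ k(1) \<sigma>]] by simp
  next
    case 2
    have "ln (ln (16 * real n)) \<le> 3 * ln (real (levels n))" using k 2 by (intro ln_ln_le_ln_levels) auto
    moreover have "ln (ln (16 * real n)) \<ge> 5 / 8" using k by (intro ln_16_mult(2)) auto
    ultimately have "unimodal_rate n k / 1152 \<le> real 1 * ln (real (levels n)) / 128"
      using 2 by (simp add: unimodal_rate_def)
    moreover have "1 * n \<le> n" "2 * 1 \<le> k" "n \<ge> 2" using k 2 by auto
    ultimately show ?thesis using fin [OF minimax_lower_blocks [of 1 n n k \<sigma>]] \<sigma> by simp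
  next
    case 3
    \<comment> \<open>As \<open>n \<ge> k \<ge> 3\<close> exceeds \<open>exp 1\<close>,
      \<open>ln (exp 1 * n)\<close> is at most twice \<open>ln n\<close>.\<close>
    have "1 \<le> ln (real n)"
    proof -
      have "exp 1 \<le> real n" using exp_le 3 k by linarith
      then show ?thesis using 3 k by (simp add: ln_ge_iff)
    qed
    moreover have "unimodal_rate n k = 1 + ln (real n)" using 3 k by (simp add: unimodal_rate_def ln_mult)
    ultimately have "unimodal_rate n k / 1152 \<le> ln (real n) / 64" by simp
    moreover have "n \<ge> 2" using k 3 by simp
    ultimately show ?thesis using fin [OF minimax_lower_spike [OF _ 3(1) \<sigma>]] by simp
  next
    case 4
    define K where "K = k div 2"
    define N where "N = n div K"
    have K: "K \<ge> 1" "2 * K \<le> k" "k \<le> 3 * K" using 4 by (auto simp: K_def)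
    have KN: "K * N \<le> n" by (simp add: N_def)
    have N2: "N \<ge> 2"
    proof -
      have "2 * K \<le> n" using K k by simp
      then have "2 * K div K \<le> n div K" by (rule div_le_mono)
      then show ?thesis using K by (simp add: N_def)
    qed
    have x: "real n / real k \<ge> 1" using k by simp
    have nk: "real n / real k \<le> real N"
    proof -
      have "n < K * (N + 1)" using K dividend_less_times_div [of K n] by (simp add: N_def)
      also have "\<dots> \<le> K * (2 * N)" using N2 by (intro mult_left_mono) auto
      also have "\<dots> = (2 * K) * N" by simp
      also have "\<dots> \<le> k * N" using K by (intro mult_right_mono) auto
      finally have "n \<le> k * N" by simp
      then have "real n \<le> real k * real N" by (metis of_nat_le_iff of_nat_mult)
      then show ?thesis using k by (simp add: divide_le_eq mult.commute)
    qed
    have ll: "ln (ln (16 * (real n / real k))) \<le> ln (ln (16 * real N))"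
    proof (intro ln_mono)
      show "0 < ln (16 * (real n / real k))" using ln_16_mult(1) [OF x] by linarith
      show "0 < 16 * (real n / real k)" using x by linarith
    qed (use nk in auto)
    also have "\<dots> \<le> 3 * ln (real (levels N))" by (rule ln_ln_le_ln_levels [OF N2])
    finally have l3: "ln (ln (16 * (real n / real k))) \<le> 3 * ln (real (levels N))" .
    have l0: "0 \<le> ln (ln (16 * (real n / real k)))" using ln_16_mult(2) [OF x] by linarith
    have "unimodal_rate n k = real k * ln (ln (16 * (real n / real k)))" using 4 by (simp add: unimodal_rate_def)
    also have "\<dots> \<le> (3 * real K) * (3 * ln (real (levels N)))"
      using K l3 l0 by (intro mult_mono) auto
    finally have "unimodal_rate n k / 1152 \<le> real K * ln (real (levels N)) / 128" by simp
    then show ?thesis by (rule fin [OF minimax_lower_blocks [OF K(1) KN K(2) N2 \<sigma>]])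
  qed
qed

text \<open>\<open>512 = 4 * 128\<close> arises in the last regime, where log n is replaced by four
  times the rate; the other coefficients are rounded up generously.\<close>

definition upper_const :: real where
  "upper_const = 3000 + 3000 * wmax_const + 512 * ln wmax_const"

text \<open>For \<open>k \<ge> 3\<close> the bound is a combination of \<open>r\<close>, the k log
  log (n / k) term, and \<open>e\<close>, the log n term. Below the threshold
  \<open>r \<le> e\<close>, above it \<open>e \<le> 4 * r\<close>, so in either case the rate
  dominates both.\<close>

lemma minimax_upper:
  assumes k: "1 \<le> k" "k \<le> n" and \<sigma>: "\<sigma> > 0"
  shows "(INF T\<in>estimators n. SUP \<theta>\<in>unimodal_pieces n k. sq_risk n \<sigma> T \<theta>) \<le> ennreal (upper_const * \<sigma>\<^sup>2 * unimodal_rate n k)"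
proof -
  have fin: ?thesis if "(INF T\<in>estimators n. SUP \<theta>\<in>unimodal_pieces n k. sq_risk n \<sigma> T \<theta>) \<le> ennreal (\<sigma>\<^sup>2 * x)"
    "x \<le> upper_const * unimodal_rate n k" for x
  proof -
    have "\<sigma>\<^sup>2 * x \<le> \<sigma>\<^sup>2 * (upper_const * unimodal_rate n k)" using that(2) by (intro mult_left_mono) auto
    then have "\<sigma>\<^sup>2 * x \<le> upper_const * \<sigma>\<^sup>2 * unimodal_rate n k" by (simp add: mult_ac)
    then show ?thesis using that(1) by (meson ennreal_leI order_trans)
  qed
  define w where "w = wmax_const"
  define g where "g = ln w"
  have w1: "w \<ge> 1" using wmax_const_ge_1 by (simp add: w_def)
  have g0: "g \<ge> 0" using w1 by (simp add: g_def)
  have C: "upper_const = 3000 + 3000 * w + 512 * g" by (simp add: upper_const_def w_def g_def)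
  define R where "R = unimodal_rate n k"
  define s where "s = 8 * ln (ln (16 * real (n div k + 1)))"
  define M where "M = (if k \<ge> 3 then 16 * mode_level n + 16 else 0)"
  have up: "(INF T\<in>estimators n. SUP \<theta>\<in>unimodal_pieces n k. sq_risk n \<sigma> T \<theta>)
     \<le> ennreal (\<sigma>\<^sup>2 * (4 * (16 * real k * s + 128 * w * real k + M) + 1))"
    unfolding s_def w_def M_def by (rule minimax_upper_pieces [OF k \<sigma>])
  consider "k = 1" | "k = 2" | "k \<ge> 3" using k by linarith
  then show ?thesis
  proof cases
    case 1
    have "(INF T\<in>estimators n. SUP \<theta>\<in>unimodal_pieces n k. sq_risk n \<sigma> T \<theta>) \<le> ennreal (\<sigma>\<^sup>2 * (4 * (4 * w) + 1))"
      unfolding w_def 1 by (rule minimax_upper_constant) (use k \<sigma> in auto)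
    moreover have "4 * (4 * w) + 1 \<le> upper_const * unimodal_rate n k"
      using 1 w1 g0 by (simp add: unimodal_rate_def C)
    ultimately show ?thesis by (rule fin)
  next
    case 2
    define r where "r = ln (ln (16 * real n))"
    have R: "unimodal_rate n k = r" using 2 by (simp add: unimodal_rate_def r_def)
    have r0: "r \<ge> 5 / 8" unfolding r_def using k by (intro ln_16_mult(2)) auto
    have "s \<le> 8 * r"
    proof -
      have "n div 2 + 1 \<le> n" using k 2 by simp
      then have "real (n div k + 1) \<le> real n" unfolding 2 by (simp only: of_nat_le_iff)
      moreover have "ln (16 * real (n div k + 1)) \<ge> 8 / 3" by (intro ln_16_mult(1)) simp
      ultimately have "ln (ln (16 * real (n div k + 1))) \<le> r" unfolding r_def by (intro ln_mono) auto
      then show ?thesis by (simp add: s_def)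
    qed
    then have "4 * (16 * real k * s + 128 * w * real k + M) + 1 \<le> 1024 * r + 1024 * w + 1"
      using 2 by (simp add: M_def)
    \<comment> \<open>Since \<open>r \<ge> 5 / 8\<close>, each additive constant is at most
      \<open>8 / 5 * r\<close> times itself.\<close>
    also have "\<dots> \<le> 1024 * r + 1024 * w * (8 / 5 * r) + 8 / 5 * r"
    proof -
      have "1024 * w * 1 \<le> 1024 * w * (8 / 5 * r)" using w1 r0 by (intro mult_left_mono) auto
      then have "1024 * w \<le> 1024 * w * (8 / 5 * r)" by (simp only: mult_1_right)
      moreover have "1 \<le> 8 / 5 * r" using r0 by simp
      ultimately show ?thesis by (intro add_mono order_refl)
    qed
    also have "\<dots> = (1024 + 1024 * w * (8 / 5) + 8 / 5) * r" by (simp add: algebra_simps)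
    also have "\<dots> \<le> upper_const * r" unfolding C using w1 g0 r0 by (intro mult_right_mono) auto
    finally show ?thesis unfolding R [symmetric] by (rule fin [OF up])
  next
    case 3
    define r where "r = real k * ln (ln (16 * real n / real k))"
    define e where "e = ln (exp 1 * real n)"
    have x: "real n / real k \<ge> 1" using k by simp
    have llx: "ln (ln (16 * real n / real k)) \<ge> 5 / 8" using ln_16_mult(2) [OF x] by simp
    have kr: "real k \<le> 8 / 5 * r"
    proof -
      have "real k * (5 / 8) \<le> real k * ln (ln (16 * real n / real k))" using llx by (intro mult_left_mono) auto
      then show ?thesis by (simp add: r_def)
    qed
    have r0: "r \<ge> 0" using kr by simp
    have e1: "e \<ge> 1" using k by (simp add: e_def ln_mult)
    have sk: "real k * s \<le> 24 * r"
    proof -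
      have "real (n div k) \<le> real n / real k" by (rule of_nat_div_le_of_nat)
      then have "real (n div k + 1) \<le> 2 * (real n / real k)" using x by simp
      then have "ln (16 * real (n div k + 1)) \<le> 2 * ln (16 * (real n / real k))"
        using x by (intro ln_ln_doubling) auto
      then have "ln (ln (16 * real (n div k + 1))) \<le> 3 * ln (ln (16 * (real n / real k)))"
        using x by (intro ln_ln_of_double) auto
      then have "real k * (8 * ln (ln (16 * real (n div k + 1)))) \<le> real k * (24 * ln (ln (16 * real n / real k)))"
        by (intro mult_left_mono) auto
      then show ?thesis by (simp add: s_def r_def)
    qed
    have M: "M = 16 * ((1 + 2 * g) * e) + 16" using 3 by (simp add: M_def mode_level_def g_def w_def e_def)
    have "4 * (16 * real k * s + 128 * w * real k + M) + 1 = 64 * (real k * s) + 512 * w * real k + 64 * ((1 + 2 * g) * e) + 65"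
      by (simp add: M)
    also have "\<dots> \<le> 64 * (24 * r) + 512 * w * (8 / 5 * r) + 64 * ((1 + 2 * g) * e) + 65 * e"
      using sk kr e1 w1 g0 by (intro add_mono mult_left_mono) auto
    \<comment> \<open>\<open>512 * 8 / 5 = 820 - 4 / 5\<close>; the negative remainder is dropped
      next.\<close>
    also have "\<dots> = (1536 + 820 * w) * r - 4 / 5 * (w * r) + (129 + 128 * g) * e" by (simp add: algebra_simps)
    also have "\<dots> \<le> (1536 + 820 * w) * r + (129 + 128 * g) * e" using w1 r0 by simp
    also have "\<dots> \<le> upper_const * unimodal_rate n k"
    proof (cases "real k \<le> e / ln (ln (16 * real n))")
      case True
      have lln: "ln (ln (16 * real n)) \<ge> 5 / 8" using k by (intro ln_16_mult(2)) auto
      have R: "unimodal_rate n k = e" using 3 True by (simp add: unimodal_rate_def e_def)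
      have "r \<le> real k * ln (ln (16 * real n))"
        unfolding r_def
      proof (intro mult_left_mono ln_mono)
        have "ln (16 * (real n / real k)) \<ge> 8 / 3" by (rule ln_16_mult(1) [OF x])
        then show "0 < ln (16 * real n / real k)" by simp
        show "0 < 16 * real n / real k" using k by simp
        show "16 * real n / real k \<le> 16 * real n" using k by (simp add: divide_le_eq)
      qed auto
      also have "\<dots> \<le> e" using True lln by (simp add: le_divide_eq)
      finally have "(1536 + 820 * w) * r + (129 + 128 * g) * e \<le> (1536 + 820 * w) * e + (129 + 128 * g) * e"
        using w1 by (intro add_right_mono mult_left_mono) auto
      also have "\<dots> = (1665 + 820 * w + 128 * g) * e" by (simp add: algebra_simps)
      also have "\<dots> \<le> upper_const * e" unfolding C using w1 g0 e1 by (intro mult_right_mono) auto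
      finally show ?thesis by (simp add: R)
    next
      case False
      have lln: "ln (ln (16 * real n)) \<ge> 5 / 8" using k by (intro ln_16_mult(2)) auto
      have R: "unimodal_rate n k = r" using 3 False by (simp add: unimodal_rate_def e_def r_def)
      have "e < real k * ln (ln (16 * real n))" using False lln by (simp add: divide_less_eq not_le)
      then have "e \<le> 4 * r" unfolding e_def r_def by (rule ln_le_pieces [OF k])
      then have "(1536 + 820 * w) * r + (129 + 128 * g) * e \<le> (1536 + 820 * w) * r + (129 + 128 * g) * (4 * r)"
        using g0 by (intro add_left_mono mult_left_mono) auto
      also have "\<dots> = (2052 + 820 * w + 512 * g) * r" by (simp add: algebra_simps)
      also have "\<dots> \<le> upper_const * r" unfolding C using w1 g0 r0 by (intro mult_right_mono) auto
      finally show ?thesis by (simp add: R)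
    qed
    finally show ?thesis by (rule fin [OF up])
  qed
qed

theorem mainTheorem9:
  "\<exists>c C :: real. 0 < c \<and> 0 < C \<and>
     (\<forall>(n::nat) (k::nat) (\<sigma>::real). 1 \<le> k \<and> k \<le> n \<and> 0 < \<sigma> \<longrightarrow>
        ennreal (c * \<sigma>\<^sup>2 * unimodal_rate n k)
          \<le> (INF T\<in>estimators n. SUP \<theta>\<in>unimodal_pieces n k. sq_risk n \<sigma> T \<theta>) \<and>
        (INF T\<in>estimators n. SUP \<theta>\<in>unimodal_pieces n k. sq_risk n \<sigma> T \<theta>)
          \<le> ennreal (C * \<sigma>\<^sup>2 * unimodal_rate n k))"
proof (intro exI conjI allI impI)
  show "0 < (1 / 1152 :: real)" by simp
  have "ln wmax_const \<ge> 0" using wmax_const_ge_1 by simp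
  then show "0 < upper_const" unfolding upper_const_def using wmax_const_ge_1 by linarith
  fix n k :: nat and \<sigma> :: real assume "1 \<le> k \<and> k \<le> n \<and> 0 < \<sigma>"
  then have *: "1 \<le> k" "k \<le> n" "\<sigma> > 0" by auto
  show "ennreal (1 / 1152 * \<sigma>\<^sup>2 * unimodal_rate n k) \<le> (INF T\<in>estimators n. SUP \<theta>\<in>unimodal_pieces n k. sq_risk n \<sigma> T \<theta>)"
    by (rule minimax_lower [OF *])
  show "(INF T\<in>estimators n. SUP \<theta>\<in>unimodal_pieces n k. sq_risk n \<sigma> T \<theta>) \<le> ennreal (upper_const * \<sigma>\<^sup>2 * unimodal_rate n k)"
    by (rule minimax_upper [OF *])
qed

end
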